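(* Let $k=k(m)\ge 1$ be integers with $k=o(m)$ as $m\to\infty$, and set $n=mk$. Then for every balanced sequence of partitions $\nu\vdash mk$, \[ \langle L_{(m^k)}, s_\nu\rangle \sim \frac{f^\nu}{m^k\,k!}\quad\text{as } m\to\infty . \] Consequently the sequence of higher Lie characters $\psi^{(m^k)}$ indexed by the rectangles $(m^k)$ tends to be regular.
   Context: $(m^k)$ denotes the rectangular partition with $k$ rows of length $m$; note $z_{(m^k)}=m^k k!$, where for $\lambda=(1^{m_1}2^{m_2}\cdots)$, $z_\lambda=\prod_i i^{m_i}m_i!$. For $\nu\vdash n$, $f^\nu$ is the number of standard Young tableaux of shape $\nu$, $\chi^\nu$ the irreducible character of $\mathfrak S_n$, $s_\nu$ the Schur function, $\langle\cdot,\cdot\rangle$ the Hall inner product. For $\lambda=(1^{m_1}2^{m_2}\cdots)\vdash n$, let $Z_\lambda\cong\prod_i \mathfrak S_{m_i}[\mathbb Z_i]$ be the centralizer of a permutation of cycle type $\lambda$, where $\mathbb Z_i$ is the cyclic group generated by an $i$-cycle; let $\zeta_i$ be a primitive (faithful) linear character of $\mathbb Z_i$ and $\mathrm{id}_{m_i}[\zeta_i]$ the character of the wreath product $\mathfrak S_{m_i}[\mathbb Z_i]$ obtained from $\zeta_i$ and the trivial character of $\mathfrak S_{m_i}$. The higher Lie character is $\psi^\lambda=\mathrm{Ind}_{Z_\lambda}^{\mathfrak S_n}(\mathrm{id}_{m_1}[\zeta_1]\otimes\mathrm{id}_{m_2}[\zeta_2]\otimes\cdots)$, of degree $n!/z_\lambda$,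 and $L_\lambda$ is its Frobenius characteristic. A family of partitions $\nu\vdash n$ is balanced if there is a constant $a$ with $\nu_1,\nu'_1\le a\sqrt n$ (first row and first column lengths). A sequence of characters $\rho_n$ tends to be regular if $\langle\rho_n,\chi^{\nu^{(n)}}\rangle/\rho_n(1)\sim f^{\nu^{(n)}}/n!$ for Plancherel-typical $(\nu^{(n)})$; Plancherel-typical sequences are balanced, and for $\rho=\psi^\lambda$ the condition reads $\langle L_\lambda,s_\nu\rangle\sim f^\nu/z_\lambda$. *)

theory Defs
  imports Complex_Main "HOL-Combinatorics.Combinatorics" "HOL-Library.FuncSet"
    "HOL-Library.Landau_Symbols"
begin

definition is_partition :: "nat \<Rightarrow> nat list \<Rightarrow> bool" where
  "is_partition n \<nu> \<longleftrightarrow> sum_list \<nu> = n \<and> (\<forall>x\<in>set \<nu>. 0 < x) \<and> sorted_wrt (\<ge>) \<nu>"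

definition first_row :: "nat list \<Rightarrow> nat" where
  "first_row \<nu> = (case \<nu> of [] \<Rightarrow> 0 | x # _ \<Rightarrow> x)"

definition part_at :: "nat list \<Rightarrow> nat \<Rightarrow> nat" where
  "part_at \<nu> j = (if j < length \<nu> then \<nu> ! j else 0)"

definition cells :: "nat list \<Rightarrow> (nat \<times> nat) set" where
  "cells \<nu> = {(i, j). i < length \<nu> \<and> j < \<nu> ! i}"

definition num_syt :: "nat list \<Rightarrow> nat" where
  "num_syt \<nu> = card {T \<in> cells \<nu> \<rightarrow>\<^sub>E {1..sum_list \<nu>}.
      bij_betw T (cells \<nu>) {1..sum_list \<nu>} \<and>
      (\<forall>i j. (i, j + 1) \<in> cells \<nu> \<longrightarrow> T (i, j) < T (i, j + 1)) \<and>
      (\<forall>i j. (i + 1, j) \<in> cells \<nu> \<longrightarrow> T (i, j) < T (i + 1, j))}"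

definition perms :: "nat \<Rightarrow> (nat \<Rightarrow> nat) set" where
  "perms n = {p. p permutes {0..<n}}"

text \<open>Irreducible character chi^nu of S_n at g, via the Frobenius character formula:
  chi^nu(g) = coefficient of x^(nu+delta) in a_delta * p_(cycle type of g), in N = n variables,
  delta_j = N-1-j. The coefficient of x^alpha in p_(type g) counts the maps f from {0..<n}
  to the variables {0..<N} that are constant on the cycles of g with fibre sizes alpha.\<close>
definition irr_char :: "nat \<Rightarrow> nat list \<Rightarrow> (nat \<Rightarrow> nat) \<Rightarrow> int" where
  "irr_char n \<nu> g =
     (\<Sum>w\<in>perms n. sign w *
        int (card {f \<in> {0..<n} \<rightarrow>\<^sub>E {0..<n}.
                (\<forall>i<n. f (g i) = f i) \<and>
                (\<forall>j<n. int (card {i\<in>{0..<n}. f i = j}) =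
                        int (part_at \<nu> j) + int (n - 1 - j) - int (n - 1 - w j))}))"

definition char_inner :: "nat \<Rightarrow> ((nat \<Rightarrow> nat) \<Rightarrow> complex) \<Rightarrow> ((nat \<Rightarrow> nat) \<Rightarrow> complex) \<Rightarrow> complex" where
  "char_inner n \<alpha> \<beta> = (\<Sum>g\<in>perms n. \<alpha> g * cnj (\<beta> g)) / of_nat (fact n)"

definition ind_char :: "nat \<Rightarrow> (nat \<Rightarrow> nat) set \<Rightarrow> ((nat \<Rightarrow> nat) \<Rightarrow> complex) \<Rightarrow> (nat \<Rightarrow> nat) \<Rightarrow> complex" where
  "ind_char n H \<phi> g =
     (\<Sum>x\<in>perms n. if x \<circ> g \<circ> inv x \<in> H then \<phi> (x \<circ> g \<circ> inv x) else 0) / of_nat (card H)"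

text \<open>Fixed permutation of cycle type (m^k) on {0..<m*k}: the blocks {jm,...,jm+m-1}
  are cycled i -> i+1 (wrapping inside the block).\<close>
definition rect_perm :: "nat \<Rightarrow> nat \<Rightarrow> nat \<Rightarrow> nat" where
  "rect_perm m k i = (if i < m * k then (if i mod m = m - 1 then i - (m - 1) else i + 1) else i)"

definition rect_centralizer :: "nat \<Rightarrow> nat \<Rightarrow> (nat \<Rightarrow> nat) set" where
  "rect_centralizer m k = {z \<in> perms (m * k). z \<circ> rect_perm m k = rect_perm m k \<circ> z}"

text \<open>The character id_k[zeta_m] of Z_(m^k): an element z sends block j to block sigma(j),
  rotated by a_j = z(jm) mod m; its value is zeta^(sum of the a_j), zeta = exp(2 pi i/m).\<close>
definition rect_lin_char :: "nat \<Rightarrow> nat \<Rightarrow> (nat \<Rightarrow> nat) \<Rightarrow> complex" where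
  "rect_lin_char m k z = cis (2 * pi * real (\<Sum>j<k. z (j * m) mod m) / real m)"

definition higher_lie_rect :: "nat \<Rightarrow> nat \<Rightarrow> (nat \<Rightarrow> nat) \<Rightarrow> complex" where
  "higher_lie_rect m k = ind_char (m * k) (rect_centralizer m k) (rect_lin_char m k)"

text \<open><L_(m^k), s_nu> = <psi^(m^k), chi^nu>.\<close>
definition lie_schur_mult :: "nat \<Rightarrow> nat \<Rightarrow> nat list \<Rightarrow> complex" where
  "lie_schur_mult m k \<nu> =
     char_inner (m * k) (higher_lie_rect m k) (\<lambda>g. of_int (irr_char (m * k) \<nu> g))"

end

theory Submission
  imports Defs "HOL-Real_Asymp.Real_Asymp"
begin

text \<open>By Frobenius reciprocity the multiplicity is the average of \<open>\<phi> \<chi>\<^sup>\<nu>\<close> over the centralizer, whose identity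
  element contributes the main term. An element moving exactly \<open>j \<ge> 1\<close> of the \<open>k\<close> blocks has support
  \<open>j m\<close>, and there are at most \<open>(m k\<^sup>2)\<^sup>j\<close> of them, so a bound \<open>\<bar>\<chi>\<^sup>\<nu>(z)\<bar> \<le> m\<^sup>-\<^sup>4\<^sup>j f\<^sup>\<nu>\<close> suffices.

  Removing the fixed points first, the Murnaghan-Nakayama rule without signs reduces this to the count of
  rim hook tableaux of shapes \<open>\<kappa>\<close> of size \<open>s = j m\<close> with all hooks of size at least 2. Cutting
  hooks into pieces bounds this number by the number of standard tableaux in which prescribed pairs
  of consecutive entries, spread densely over \<open>{1..s}\<close>, occupy adjacent cells. Call \<open>i\<close> a jump if
  \<open>i\<close> and \<open>i + 1\<close> are not adjacent. Near every jump one can reorder five consecutive entries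
  so that the nearby prescribed pair is separated; hence tableaux with many jumps are an exponentially small
  fraction of all tableaux. A tableau is determined by its behaviour at the jumps, so there are few tableaux with few
  jumps, compared with the lower bound \<open>f\<^sup>\<kappa> \<ge> 2 ^ ((s - b) div 2)\<close> for shapes in a \<open>b \<times> b\<close> box. Here
  \<open>b = O(\<surd>(m k)) = o(m)\<close> is where balancedness and \<open>k = o(m)\<close> enter.\<close>

section \<open>Bead moves and rim hooks\<close>

text \<open>The exponent 4 is chosen with room. If each moved block has weight
  \<open>\<delta> = m^-4\<close>, the relative error is at most
  \<open>(1 + m * k * \<delta>)^k - 1\<close>; since \<open>k \<le> m\<close>,
  \<open>m * k * \<delta> \<le> m^-2\<close>, and the error is of order \<open>1/m\<close>. The
  critical case is \<open>j = 1\<close>, when only \<open>m\<close> cells remain after the fixed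
  points. Were they a single row, there would be one standard tableau and one rim hook tableau, and
  nothing would be saved. A box of side at most \<open>m/2\<close> excludes this. No cancellation of
  signs is used. Cutting hooks loses no factor, because one of the two orders of the pieces always
  has at least as many chains. Two kinds of tableaux are balanced by a parameter \<open>A\<close> of
  order \<open>j * log m\<close>. Those with at least \<open>5 * A\<close> windows containing a jump
  form a fraction at most \<open>5 * (6/7)^A\<close>, which beats \<open>m^-4j\<close>. The others
  number at most \<open>exp (O(A * log m))\<close>, where \<open>A * log m\<close> is of order
  \<open>j * log^2 m\<close>, while the exponent in the lower bound for standard tableaux is linear
  in \<open>j * m\<close>.\<close>

text \<open>A partition is encoded by the set of its beta numbers. Moving a bead down by \<open>r\<close> positions removes
  a rim hook of size \<open>r\<close>; the position \<open>x\<close> of a unit move is the shifted content of the removed cell.\<close>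
definition bead_move :: "int \<Rightarrow> int \<Rightarrow> int set \<Rightarrow> int set" where
  "bead_move r x B = insert (x - r) (B - {x})"

definition movable :: "int \<Rightarrow> int set \<Rightarrow> int set" where
  "movable r B = {x \<in> B. r \<le> x \<and> x - r \<notin> B}"

text \<open>Rim hook tableaux counted without sign: the ways of reaching \<open>G\<close> from
  \<open>B\<close> by removing hooks of the given sizes in the given order. When all sizes are 1
  these are the standard tableaux of the skew shape between the two. The condition
  \<open>r \<le> x\<close> in \<open>movable\<close> keeps the moved bead at a nonnegative
  position.\<close>

fun chains :: "int set \<Rightarrow> int list \<Rightarrow> int set \<Rightarrow> nat" where
  "chains G [] B = (if B = G then 1 else 0)"
| "chains G (r # rs) B = (\<Sum>x\<in>movable r B. chains G rs (bead_move r x B))"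

lemma finite_bead_move [simp]: "finite B \<Longrightarrow> finite (bead_move r x B)"
  by (simp add: bead_move_def)

lemma finite_movable [simp]: "finite B \<Longrightarrow> finite (movable r B)"
  by (simp add: movable_def)

lemma card_bead_move: "finite B \<Longrightarrow> x \<in> movable r B \<Longrightarrow> card (bead_move r x B) = card B"
  using card_Suc_Diff1[of B x] by (simp add: bead_move_def movable_def card.insert_remove)

lemma sum_bead_move:
  "finite B \<Longrightarrow> x \<in> movable r B \<Longrightarrow> \<Sum>(bead_move r x B) = \<Sum>B - r"
  by (simp add: bead_move_def movable_def sum_diff1)

text \<open>A move of the bead at \<open>x\<close> by \<open>a + b\<close> factors in two ways. If
  \<open>x - a\<close> is free, the same bead moves by \<open>a\<close> and then by
  \<open>b\<close>. If \<open>x - b\<close> is occupied, the bead there first moves to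
  \<open>x - a - b\<close>, and the bead at \<open>x\<close> then takes its place. The positions
  decrease in the first case and increase in the second, so no pair of moves is counted
  twice.\<close>

lemma chains_two_steps_ge:
  assumes B: "finite B" and ab: "0 < a" "0 < b"
  shows "(\<Sum>x\<in>{x\<in>movable (a + b) B. x - a \<notin> B}. chains G rs (bead_move (a + b) x B))
       + (\<Sum>x\<in>{x\<in>movable (a + b) B. x - b \<in> B}. chains G rs (bead_move (a + b) x B))
      \<le> chains G (a # b # rs) B"
proof -
  let ?M = "movable (a + b) B"
  let ?F = "\<lambda>x. chains G rs (bead_move (a + b) x B)"
  let ?S = "SIGMA x:movable a B. movable b (bead_move a x B)"
  let ?H = "\<lambda>(x, y). chains G rs (bead_move b y (bead_move a x B))"
  let ?P1 = "(\<lambda>x. (x, x - a)) ` {x\<in>?M. x - a \<notin> B}"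
  let ?P2 = "(\<lambda>x. (x - b, x)) ` {x\<in>?M. x - b \<in> B}"
  have finS: "finite ?S" using B by auto
  have sub1: "?P1 \<subseteq> ?S"
    using ab by (auto simp: movable_def bead_move_def diff_diff_eq)
  have sub2: "?P2 \<subseteq> ?S"
    using ab by (auto simp: movable_def bead_move_def diff_diff_eq add.commute)
  have disj: "?P1 \<inter> ?P2 = {}" using ab by auto
  have fin: "finite ?P1" "finite ?P2" using B by auto
  have mv1: "bead_move b (x - a) (bead_move a x B) = bead_move (a + b) x B"
    if "x \<in> ?M" "x - a \<notin> B" for x
    using that by (auto simp: movable_def bead_move_def diff_diff_eq)
  have mv2: "bead_move b x (bead_move a (x - b) B) = bead_move (a + b) x B"
    if "x \<in> ?M" "x - b \<in> B" for x
    using that ab by (auto simp: movable_def bead_move_def diff_diff_eq add.commute)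
  have "sum ?H ?P1 = (\<Sum>x\<in>{x\<in>?M. x - a \<notin> B}. ?F x)"
    by (subst sum.reindex) (auto simp: inj_on_def mv1 intro!: sum.cong)
  moreover have "sum ?H ?P2 = (\<Sum>x\<in>{x\<in>?M. x - b \<in> B}. ?F x)"
    by (subst sum.reindex) (auto simp: inj_on_def mv2 intro!: sum.cong)
  moreover have "sum ?H ?P1 + sum ?H ?P2 = sum ?H (?P1 \<union> ?P2)"
    using fin disj by (simp add: sum.union_disjoint)
  moreover have "sum ?H (?P1 \<union> ?P2) \<le> sum ?H ?S"
    using finS sub1 sub2 by (intro sum_mono2) auto
  moreover have "sum ?H ?S = chains G (a # b # rs) B"
    using B by (simp add: sum.Sigma)
  ultimately show ?thesis by simp
qed

text \<open>The two factorisations of a move by \<open>a + b\<close> into moves by \<open>a\<close> and by \<open>b\<close> depend on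
  whether the intermediate positions \<open>x - a\<close> and \<open>x - b\<close> are occupied; over both orders there
  are always exactly two of them.\<close>
lemma chains_split_head:
  assumes "finite B" "0 < a" "0 < b"
  shows "2 * chains G ((a + b) # rs) B \<le> chains G (a # b # rs) B + chains G (b # a # rs) B"
proof -
  let ?M = "movable (a + b) B"
  let ?F = "\<lambda>x. chains G rs (bead_move (a + b) x B)"
  have split: "sum ?F ?M = sum ?F {x\<in>?M. x - c \<notin> B} + sum ?F {x\<in>?M. x - c \<in> B}" for c
    using assms(1) by (subst sum.union_disjoint[symmetric]) (auto intro!: sum.cong)
  have "chains G ((a + b) # rs) B = sum ?F ?M" by simp
  moreover have "sum ?F {x\<in>?M. x - b \<notin> B} + sum ?F {x\<in>?M. x - a \<in> B} \<le> chains G (b # a # rs) B"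
    using chains_two_steps_ge[OF assms(1,3,2), of G rs] unfolding add.commute[of b a] .
  ultimately show ?thesis
    using split[of a] split[of b] chains_two_steps_ge[OF assms, of G rs] by linarith
qed

lemma chains_split:
  assumes "finite B" "0 < a" "0 < b"
  shows "2 * chains G (p @ (a + b) # q) B \<le> chains G (p @ a # b # q) B + chains G (p @ b # a # q) B"
  using assms(1)
proof (induction p arbitrary: B)
  case Nil
  then show ?case using chains_split_head[OF Nil assms(2,3)] by simp
next
  case (Cons c p)
  have "2 * chains G ((c # p) @ (a + b) # q) B
      = (\<Sum>x\<in>movable c B. 2 * chains G (p @ (a + b) # q) (bead_move c x B))"
    by (simp add: sum_distrib_left)
  also have "\<dots> \<le> (\<Sum>x\<in>movable c B. chains G (p @ a # b # q) (bead_move c x B)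
       + chains G (p @ b # a # q) (bead_move c x B))"
    using Cons by (intro sum_mono) auto
  finally show ?case by (simp add: sum.distrib)
qed

section \<open>Cutting hooks into dominoes and single cells\<close>

definition hook_split :: "nat \<Rightarrow> int list \<Rightarrow> bool" where
  "hook_split r u \<longleftrightarrow> (\<exists>p q. 2 * (p + q) = r \<and> u = replicate p 2 @ replicate q 2 \<or> 
      p + q > 0 \<and> 2 * (p + q) + 1 = r \<and> u = replicate p 2 @ 1 # replicate q 2)"

lemma hook_split_Cons: "hook_split r u \<Longrightarrow> hook_split (r + 2) (2 # u)"
  unfolding hook_split_def
  apply (elim exE)
  subgoal for p q by (rule exI[of _ "Suc p"], rule exI[of _ q]) auto
  done

lemma hook_split_snoc: "hook_split r u \<Longrightarrow> hook_split (r + 2) (u @ [2])"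
  unfolding hook_split_def
  apply (elim exE)
  subgoal for p q by (rule exI[of _ "p"], rule exI[of _ "Suc q"]) (auto simp: replicate_append_same)
  done

text \<open>Peel off dominoes one at a time: by \<open>chains_split\<close> twice the count is at
  most the sum over the two orders, so one of the orders is at least as large. Which one is unknown,
  and this is why \<open>hook_split\<close> leaves open where the single cell of an odd hook stands.
  The condition \<open>p + q > 0\<close> there guarantees a domino in every odd hook.\<close>

lemma chains_hook_split:
  assumes "finite B" "2 \<le> r"
  shows "\<exists>u. hook_split r u \<and> chains G (p @ int r # q) B \<le> chains G (p @ u @ q) B"
  using assms(2)
proof (induction r arbitrary: p q rule: less_induct)
  case (less r)
  consider "r = 2" | "r = 3" | "4 \<le> r" using less.prems by linarith
  then show ?case
  proof cases
    case 1
    have "hook_split r [2]" unfolding hook_split_def using 1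
      by (intro exI[of _ 0] exI[of _ 1]) auto
    then show ?thesis using 1 by (intro exI[of _ "[2]"]) auto
  next
    case 2
    have *: "hook_split r [2, 1]" unfolding hook_split_def using 2
      by (intro exI[of _ 1] exI[of _ 0]) auto
    have **: "hook_split r [1, 2]" unfolding hook_split_def using 2
      by (intro exI[of _ 0] exI[of _ 1]) auto
    have "chains G (p @ int r # q) B \<le> chains G (p @ [2, 1] @ q) B \<or>
          chains G (p @ int r # q) B \<le> chains G (p @ [1, 2] @ q) B"
      using chains_split[OF assms(1), of 2 1 G p q] 2 by auto
    then show ?thesis using * ** by blast
  next
    case 3
    define s where "s = r - 2"
    have s: "s < r" "2 \<le> s" "r = s + 2" using 3 by (auto simp: s_def)
    have eq: "2 + int s = int r" using s by simp
    have "2 * chains G (p @ int r # q) B \<le> chains G (p @ 2 # int s # q) B + chains G (p @ int s # 2 # q) B"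
      using chains_split[OF assms(1), of 2 "int s" G p q] s unfolding eq by simp
    then consider "chains G (p @ int r # q) B \<le> chains G ((p @ [2]) @ int s # q) B"
       | "chains G (p @ int r # q) B \<le> chains G (p @ int s # 2 # q) B" by fastforce
    then show ?thesis
    proof cases
      case 1
      obtain u where "hook_split s u" "chains G ((p @ [2]) @ int s # q) B \<le> chains G ((p @ [2]) @ u @ q) B"
        using less.IH[OF s(1,2)] by blast
      then show ?thesis using 1 s hook_split_Cons[of s u] by (intro exI[of _ "2 # u"]) auto
    next
      case 2
      obtain u where "hook_split s u" "chains G (p @ int s # 2 # q) B \<le> chains G (p @ u @ 2 # q) B"
        using less.IH[OF s(1,2)] by blast
      then show ?thesis using 2 s hook_split_snoc[of s u] by (intro exI[of _ "u @ [2]"]) auto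
    qed
  qed
qed

text \<open>Two single cells may be neighbours, since one hook can end with its single cell and the
  next begin with one. Three in a row do not arise, and this keeps the dominoes dense.\<close>

fun spread :: "int list \<Rightarrow> bool" where
  "spread [] = True"
| "spread (x # xs) = ((x = 2 \<or> x = 1 \<and> \<not> (length xs \<ge> 2 \<and> xs ! 0 = 1 \<and> xs ! 1 = 1)) \<and> spread xs)"

text \<open>Strengthens the induction: a list without two leading ones can be preceded by a 1
  without creating three in a row.\<close>

definition no_lead :: "int list \<Rightarrow> bool" where
  "no_lead xs \<longleftrightarrow> \<not> (length xs \<ge> 2 \<and> xs ! 0 = 1 \<and> xs ! 1 = 1)"

lemma spread_twos: "spread v \<Longrightarrow> spread (replicate p 2 @ v)"
  by (induction p) auto

lemma no_lead_2: "no_lead (2 # v)"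
  by (simp add: no_lead_def)

lemma spread_hook_split:
  assumes "hook_split r u" "2 \<le> r" "spread v" "no_lead v"
  shows "spread (u @ v) \<and> no_lead (u @ v)"
proof -
  obtain p q where "2 * (p + q) = r \<and> u = replicate p 2 @ replicate q 2 \<or> 
      p + q > 0 \<and> 2 * (p + q) + 1 = r \<and> u = replicate p 2 @ 1 # replicate q 2"
    using assms(1) unfolding hook_split_def by blast
  then show ?thesis
  proof (elim disjE conjE)
    assume *: "2 * (p + q) = r" "u = replicate p 2 @ replicate q 2"
    then have "u = 2 # replicate (p + q - 1) 2" using assms(2)
      by (cases p; cases q) (auto simp: replicate_add replicate_app_Cons_same)
    then show ?thesis using assms(3) by (auto simp: no_lead_2 spread_twos)
  next
    assume *: "0 < p + q" "u = replicate p 2 @ 1 # replicate q 2"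
    have sq: "spread (replicate q 2 @ v)" using assms(3) by (rule spread_twos)
    have lq: "no_lead (replicate q 2 @ v)" using assms(4) by (cases q) (auto simp: no_lead_2)
    have s1: "spread (1 # replicate q 2 @ v)" using sq lq by (simp add: no_lead_def)
    have "no_lead (u @ v)"
    proof (cases p)
      case 0
      then have "q > 0" using * by simp
      then show ?thesis using 0 *(2) by (cases q) (auto simp: no_lead_def)
    next
      case (Suc p')
      then show ?thesis using *(2) by (simp add: no_lead_2)
    qed
    then show ?thesis using spread_twos[OF s1, of p] *(2) by simp
  qed
qed

lemma sum_hook_split: "hook_split r u \<Longrightarrow> sum_list u = int r"
  unfolding hook_split_def by (auto simp: sum_list_replicate)

lemma chains_spread_aux:
  assumes "finite B" "\<forall>r\<in>set rs. 2 \<le> r"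
  shows "\<exists>ts. spread ts \<and> no_lead ts \<and> sum_list ts = int (sum_list rs) \<and>
           chains G (p @ map int rs) B \<le> chains G (p @ ts) B"
  using assms(2)
proof (induction rs arbitrary: p)
  case Nil
  then show ?case by (intro exI[of _ "[]"]) (auto simp: no_lead_def)
next
  case (Cons r rs)
  obtain u where u: "hook_split r u" "chains G (p @ int r # map int rs) B \<le> chains G (p @ u @ map int rs) B"
    using chains_hook_split[OF assms(1), of r G p "map int rs"] Cons.prems by auto
  obtain ts where ts: "spread ts" "no_lead ts" "sum_list ts = int (sum_list rs)"
     "chains G ((p @ u) @ map int rs) B \<le> chains G ((p @ u) @ ts) B"
    using Cons.IH[of "p @ u"] Cons.prems by auto
  have "spread (u @ ts) \<and> no_lead (u @ ts)"
    using u(1) ts Cons.prems by (intro spread_hook_split) auto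
  then show ?case using u ts sum_hook_split[OF u(1)] by (intro exI[of _ "u @ ts"]) auto
qed

lemma chains_spread:
  assumes "finite B" "\<forall>r\<in>set rs. 2 \<le> r"
  shows "\<exists>ts. spread ts \<and> sum_list ts = int (sum_list rs) \<and> chains G (map int rs) B \<le> chains G ts B"
  using chains_spread_aux[OF assms, of G "[]"] by auto

section \<open>Sequences of unit moves\<close>

fun path :: "int set \<Rightarrow> int list \<Rightarrow> int set \<Rightarrow> bool" where
  "path B [] C = (B = C)"
| "path B (x # w) C = (x \<in> movable 1 B \<and> path (bead_move 1 x B) w C)"

text \<open>When \<open>C\<close> is the ground state, these are the standard Young tableaux of the
  shape with beads \<open>B\<close>, written as the shifted contents of the cells in order of
  removal, largest entry first.\<close>

definition words :: "int set \<Rightarrow> int set \<Rightarrow> int list set" where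
  "words B C = {w. path B w C}"

definition run :: "int set \<Rightarrow> int list \<Rightarrow> int set" where
  "run B w = foldl (\<lambda>B x. bead_move 1 x B) B w"

lemma path_append: "path B (u @ v) C \<longleftrightarrow> (\<exists>D. path B u D \<and> path D v C)"
  by (induction u arbitrary: B) auto

lemma path_run: "path B w C \<Longrightarrow> run B w = C"
  unfolding run_def by (induction w arbitrary: B) auto

lemma finite_run [simp]: "finite B \<Longrightarrow> finite (run B w)"
  unfolding run_def by (induction w arbitrary: B) auto

lemma path_length: "finite B \<Longrightarrow> path B w C \<Longrightarrow> \<Sum>B = \<Sum>C + int (length w)"
proof (induction w arbitrary: B)
  case (Cons x w)
  then show ?case using sum_bead_move[of B x 1] Cons.IH[of "bead_move 1 x B"] by auto
qed auto

lemma path_letters: "path B w C \<Longrightarrow> B \<subseteq> {..U} \<Longrightarrow> set w \<subseteq> {1..U}"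
proof (induction w arbitrary: B)
  case (Cons x w)
  have "bead_move 1 x B \<subseteq> {..U}" "1 \<le> x" "x \<le> U"
    using Cons.prems by (auto simp: bead_move_def movable_def)
  then show ?case using Cons by auto
qed auto

lemma words_length: "finite B \<Longrightarrow> \<Sum>B = \<Sum>C + int s \<Longrightarrow> w \<in> words B C \<Longrightarrow> length w = s"
  using path_length[of B w C] by (auto simp: words_def)

lemma finite_words_from: "finite B \<Longrightarrow> finite {w. length w = n \<and> (\<exists>C. path B w C)}"
proof -
  assume "finite B"
  then obtain U where "B \<subseteq> {..U}"
    by (metis Max_ge atMost_iff subsetI)
  then have "{w. length w = n \<and> (\<exists>C. path B w C)} \<subseteq> {w. set w \<subseteq> {1..U} \<and> length w = n}"
    using path_letters by blast
  then show ?thesis by (rule finite_subset) (simp add: finite_lists_length_eq)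
qed

lemma finite_words [simp]: "finite B \<Longrightarrow> finite (words B C)"
proof -
  assume B: "finite B"
  have "words B C \<subseteq> {w. length w = nat (\<Sum>B - \<Sum>C) \<and> (\<exists>C. path B w C)}"
    using path_length[OF B, of _ C] by (auto simp: words_def)
  then show ?thesis using finite_words_from[OF B] finite_subset by blast
qed

lemma chains_ones:
  assumes "finite B"
  shows "chains G (replicate s 1) B = card {w. path B w G \<and> length w = s}"
  using assms
proof (induction s arbitrary: B)
  case 0
  have "{w. path B w G \<and> length w = 0} = (if B = G then {[]} else {})" by auto
  then show ?case by simp
next
  case (Suc s)
  let ?S = "\<lambda>x. {w. path (bead_move 1 x B) w G \<and> length w = s}"
  have fin: "finite (?S x)" for x
    using Suc.prems by (intro finite_subset[OF _ finite_words_from[of "bead_move 1 x B" s]]) auto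
  have eq: "{w. path B w G \<and> length w = Suc s} = (\<lambda>(x, w). x # w) ` (SIGMA x:movable 1 B. ?S x)"
    by (auto simp: image_iff length_Suc_conv)
  have "card {w. path B w G \<and> length w = Suc s} = (\<Sum>x\<in>movable 1 B. card (?S x))"
    unfolding eq using Suc.prems fin
    by (subst card_image) (auto simp: inj_on_def)
  then show ?case using Suc by simp
qed

lemma card_words_chains:
  assumes "finite B" "\<Sum>B = \<Sum>G + int s"
  shows "card (words B G) = chains G (replicate s 1) B"
  using words_length[OF assms] unfolding chains_ones[OF assms(1)]
  by (intro arg_cong[where f = card]) (auto simp: words_def)

section \<open>Domino chains as words with adjacent letters\<close>

fun dominoed :: "int list \<Rightarrow> int list \<Rightarrow> bool" where
  "dominoed [] w = (w = [])"
| "dominoed (t # ts) w = (if t = 2 then \<exists>x y v. w = x # y # v \<and> \<bar>x - y\<bar> = 1 \<and> dominoed ts v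
     else \<exists>x v. w = x # v \<and> dominoed ts v)"

text \<open>A domino has only one standard filling: its removal is the pair of unit moves
  \<open>x - 1, x\<close> when the position in between is occupied and \<open>x, x - 1\<close> when
  it is free. In both cases the letters differ by one, and the larger of them gives back
  \<open>x\<close>, so the translation into words is injective.\<close>

lemma chains_le_dominoed:
  assumes "finite B" "spread ts"
  shows "chains G ts B \<le> card {w. path B w G \<and> dominoed ts w}"
  using assms
proof (induction ts arbitrary: B)
  case Nil
  have "{w. path B w G \<and> dominoed [] w} = (if B = G then {[]} else {})" by auto
  then show ?case by simp
next
  case (Cons t ts)
  let ?S = "\<lambda>x. {w. path (bead_move t x B) w G \<and> dominoed ts w}"
  define pre where "pre x = (if t = 1 then [x] else if x - 1 \<in> B then [x - 1, x] else [x, x - 1])" for x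
  have t: "t = 2 \<or> t = 1" using Cons.prems by auto
  have finW: "finite {w. path B w G \<and> P w}" if "finite B" for B P
    using that by (intro finite_subset[OF _ finite_words[of B G]]) (auto simp: words_def)
  have preP: "path B (pre x @ w) G \<and> dominoed (t # ts) (pre x @ w)" 
    if "x \<in> movable t B" "w \<in> ?S x" for x w
  proof (cases "t = 1")
    case True
    then show ?thesis using that by (auto simp: pre_def)
  next
    case False
    then have t: "t = 2" using t by simp
    have D: "dominoed ts w" using that by simp
    show ?thesis
    proof (cases "x - 1 \<in> B")
      case True
      have "bead_move 1 x (bead_move 1 (x - 1) B) = bead_move 2 x B"
        using True that(1) t by (auto simp: bead_move_def movable_def)
      moreover have "x - 1 \<in> movable 1 B" "x \<in> movable 1 (bead_move 1 (x - 1) B)"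
        using True that(1) t by (auto simp: bead_move_def movable_def)
      ultimately show ?thesis using that True t D by (auto simp: pre_def)
    next
      case False
      have "bead_move 1 (x - 1) (bead_move 1 x B) = bead_move 2 x B"
        using False that(1) t by (auto simp: bead_move_def movable_def)
      moreover have "x \<in> movable 1 B" "x - 1 \<in> movable 1 (bead_move 1 x B)"
        using False that(1) t by (auto simp: bead_move_def movable_def)
      ultimately show ?thesis using that False t D by (auto simp: pre_def)
    qed
  qed
  have pre_eq: "x = y \<and> v = w" if "pre x @ v = pre y @ w" for x y v w
  proof (cases "t = 1")
    case True
    then show ?thesis using that by (simp add: pre_def)
  next
    case False
    then have pre: "pre z = (if z - 1 \<in> B then [z - 1, z] else [z, z - 1])" for z
      by (simp add: pre_def)
    have "length (pre x) = length (pre y)" by (simp add: pre)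
    then have "pre x = pre y" "v = w" using that append_eq_append_conv by blast+
    moreover have "z = Max (set (pre z))" for z by (simp add: pre)
    ultimately show ?thesis by metis
  qed
  have inj: "inj_on (\<lambda>(x, w). pre x @ w) (SIGMA x:movable t B. ?S x)"
  proof (rule inj_onI)
    fix a b assume "(\<lambda>(x, w). pre x @ w) a = (\<lambda>(x, w). pre x @ w) b"
    then show "a = b" using pre_eq[of "fst a" "snd a" "fst b" "snd b"]
      by (simp add: case_prod_unfold prod_eq_iff)
  qed
  have "spread ts" using Cons.prems(2) by simp
  then have "chains G ts (bead_move t x B) \<le> card (?S x)" for x
    using Cons.IH Cons.prems(1) by simp
  then have "chains G (t # ts) B \<le> (\<Sum>x\<in>movable t B. card (?S x))"
    by (simp add: sum_mono)
  also have "\<dots> = card (SIGMA x:movable t B. ?S x)"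
    using Cons.prems finW by simp
  also have "\<dots> = card ((\<lambda>(x, w). pre x @ w) ` (SIGMA x:movable t B. ?S x))"
    using inj by (simp add: card_image)
  also have "\<dots> \<le> card {w. path B w G \<and> dominoed (t # ts) w}"
    using preP finW[OF Cons.prems(1)] by (intro card_mono) auto
  finally show ?case .
qed

fun two_starts :: "int list \<Rightarrow> nat set" where
  "two_starts [] = {}"
| "two_starts (t # ts) = (if t = 2 then insert 0 ((\<lambda>i. i + 2) ` two_starts ts) else Suc ` two_starts ts)"

lemma dominoed_two_starts:
  "dominoed ts w \<Longrightarrow> i \<in> two_starts ts \<Longrightarrow> \<bar>w ! i - w ! (i + 1)\<bar> = 1"
  by (induction ts arbitrary: w i) (auto split: if_splits)

lemma two_starts_first:
  assumes "spread ts" "3 \<le> sum_list ts"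
  shows "\<exists>j\<in>two_starts ts. j \<le> 2"
proof -
  obtain t ts1 where 1: "ts = t # ts1" using assms(2) by (cases ts) auto
  show ?thesis
  proof (cases "t = 2")
    case True then show ?thesis using 1 by auto
  next
    case False
    then have t: "t = 1" using assms 1 by auto
    obtain t' ts2 where 2: "ts1 = t' # ts2" using assms(2) 1 t by (cases ts1) auto
    show ?thesis
    proof (cases "t' = 2")
      case True then show ?thesis using 1 2 t by auto
    next
      case False
      then have t': "t' = 1" using assms 1 2 by auto
      obtain t'' ts3 where 3: "ts2 = t'' # ts3" using assms(2) 1 2 t t' by (cases ts2) auto
      have "t'' = 2" using assms 1 2 3 t t' by auto
      then show ?thesis using 1 2 3 t t' by auto
    qed
  qed
qed

text \<open>A position at which no domino starts is a single cell or the second cell of a domino, so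
  at most three of them follow one another: the end of a domino and two single cells. Hence one of
  the four positions \<open>i - 2, ..., i + 1\<close> is a start. These are exactly the starts
  \<open>j\<close> for which the five letters \<open>j - 1, ..., j + 3\<close> contain both
  \<open>i\<close> and \<open>i + 1\<close>.\<close>

lemma two_starts_dense:
  assumes "spread ts" "2 \<le> i" "int i + 1 < sum_list ts"
  shows "\<exists>j\<in>two_starts ts. j \<le> i + 1 \<and> i \<le> j + 2"
  using assms
proof (induction ts arbitrary: i)
  case (Cons t ts)
  show ?case
  proof (cases "t = 2")
    case True
    consider "i = 2" | "i = 3" | "4 \<le> i" using Cons.prems by linarith
    then show ?thesis
    proof cases
      case 2
      obtain j where "j \<in> two_starts ts" "j \<le> 2" using two_starts_first[of ts] Cons.prems 2 True by auto
      then show ?thesis using 2 True by (intro bexI[of _ "j + 2"]) auto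
    next
      case 3
      obtain j where "j \<in> two_starts ts" "j \<le> i - 2 + 1" "i - 2 \<le> j + 2"
        using Cons.IH[of "i - 2"] Cons.prems 3 True by fastforce
      then show ?thesis using 3 True by (intro bexI[of _ "j + 2"]) auto
    qed (use True in auto)
  next
    case False
    then have t: "t = 1" using Cons.prems by auto
    show ?thesis
    proof (cases "i = 2")
      case True
      obtain j where "j \<in> two_starts ts" "j \<le> 2" using two_starts_first[of ts] Cons.prems t True by auto
      then show ?thesis using True t by (intro bexI[of _ "Suc j"]) auto
    next
      case False
      obtain j where "j \<in> two_starts ts" "j \<le> i - 1 + 1" "i - 1 \<le> j + 2"
        using Cons.IH[of "i - 1"] Cons.prems False t by fastforce
      then show ?thesis using False t Cons.prems by (intro bexI[of _ "Suc j"]) auto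
    qed
  qed
qed auto

section \<open>Commuting moves and forbidden patterns\<close>

lemma path_swap:
  assumes "path B (u @ x # y # v) C" "\<bar>x - y\<bar> \<noteq> 1"
  shows "path B (u @ y # x # v) C"
proof -
  obtain D where D: "path B u D" "path D (x # y # v) C" using assms(1) by (auto simp: path_append)
  have ne: "x \<noteq> y" using D(2) by (auto simp: bead_move_def movable_def)
  have ne': "x - 1 \<noteq> y" "y - 1 \<noteq> x" using assms(2) by auto
  have "bead_move 1 y (bead_move 1 x D) = bead_move 1 x (bead_move 1 y D)"
    using ne ne' by (auto simp: bead_move_def)
  moreover have "y \<in> movable 1 D" "x \<in> movable 1 (bead_move 1 y D)"
    using D(2) ne ne' by (auto simp: bead_move_def movable_def)
  ultimately have "path D (y # x # v) C" using D(2) by auto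
  then show ?thesis using D(1) by (auto simp: path_append)
qed

lemma path_neq: "path B (u @ x # y # v) C \<Longrightarrow> x \<noteq> y"
  by (auto simp: path_append bead_move_def movable_def)

text \<open>After the moves \<open>x, x - 1\<close> position \<open>x\<close> is still empty, and
  after \<open>x, x + 1\<close> position \<open>x - 1\<close> is still occupied, so a third move at
  \<open>x\<close> is impossible. For shapes: consecutive cells of one diagonal are never separated
  by a single removal.\<close>

lemma path_neq3: "path B (u @ x # y # z # v) C \<Longrightarrow> \<bar>x - y\<bar> = 1 \<Longrightarrow> z \<noteq> x"
  by (auto simp: path_append bead_move_def movable_def abs_if split: if_splits)

text \<open>An integer has only two neighbours. If every admissible swap left the second and third
  letters adjacent, then either one letter would have three distinct neighbours among the others, or
  some \<open>p \<noteq> a\<close> would be adjacent to both neighbours \<open>b\<close> and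
  \<open>c\<close> of \<open>a\<close>.\<close>

lemma window4:
  assumes P: "path B (p # a # b # c # v) C" and ab: "\<bar>a - b\<bar> = 1"
    and jump: "\<bar>p - a\<bar> \<noteq> 1 \<or> \<bar>b - c\<bar> \<noteq> 1"
  shows "path B (p # a # c # b # v) C \<and> \<bar>a - c\<bar> \<noteq> 1
       \<or> path B (a # p # b # c # v) C \<and> \<bar>p - b\<bar> \<noteq> 1
       \<or> path B (a # p # c # b # v) C \<and> \<bar>p - c\<bar> \<noteq> 1"
proof (rule ccontr)
  assume H: "\<not> ?thesis"
  show False
  proof (cases "\<bar>b - c\<bar> = 1")
    case False
    have 1: "path B (p # a # c # b # v) C" using path_swap[of B "[p, a]" b c v C] P False by (simp del: path.simps)
    have ac: "\<bar>a - c\<bar> = 1" using 1 H by auto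
    have bc: "b \<noteq> c" using path_neq[of B "[p, a]" b c v C] P by (simp del: path.simps)
    show False
    proof (cases "\<bar>p - a\<bar> = 1")
      case True
      have "p \<noteq> b" using path_neq3[of B "[]" p a b "c # v" C] P True by (auto simp del: path.simps)
      moreover have "p \<noteq> c" using path_neq3[of B "[]" p a c "b # v" C] 1 True by (auto simp del: path.simps)
      ultimately show False using True ac ab bc by linarith
    next
      case pa: False
      have 2: "path B (a # p # b # c # v) C" using path_swap[of B "[]" p a "b # c # v" C] P pa by (simp del: path.simps)
      have 3: "path B (a # p # c # b # v) C" using path_swap[of B "[]" p a "c # b # v" C] 1 pa by (simp del: path.simps)
      have "p \<noteq> a" using path_neq[of B "[]" p a "b # c # v" C] P by (simp del: path.simps)
      then show False using 2 3 H ab ac bc pa by linarith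
    qed
  next
    case bc: True
    then have pa: "\<bar>p - a\<bar> \<noteq> 1" using jump by simp
    have 2: "path B (a # p # b # c # v) C" using path_swap[of B "[]" p a "b # c # v" C] P pa by (simp del: path.simps)
    then have pb: "\<bar>p - b\<bar> = 1" using H by auto
    have "c \<noteq> a" using path_neq3[of B "[p]" a b c v C] P ab by (auto simp del: path.simps)
    moreover have "c \<noteq> p" using path_neq3[of B "[a]" p b c v C] 2 pb by (auto simp del: path.simps)
    moreover have "p \<noteq> a" using path_neq[of B "[]" p a "b # c # v" C] P by (simp del: path.simps)
    ultimately show False using ab bc pb by linarith
  qed
qed

text \<open>The three outcomes of \<open>window4\<close> with the fifth letter in place, and the
  same three after the last two letters have been exchanged. Their number, six, is the origin of the
  constant \<open>7/6\<close> below.\<close>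

definition rearrangements :: "nat list set" where
  "rearrangements = {[0,1,3,2,4], [1,0,2,3,4], [1,0,3,2,4], [0,1,4,2,3], [1,0,2,4,3], [1,0,4,2,3]}"

definition jumps :: "int list \<Rightarrow> nat set" where
  "jumps w = {i. i + 1 < length w \<and> \<bar>w ! i - w ! (i + 1)\<bar> \<noteq> 1}"

lemma length_5: "length v = 5 \<Longrightarrow> \<exists>p a b c d. v = [p, a, b, c, d]"
  by (auto simp: numeral_eq_Suc length_Suc_conv)

lemma jumps_5: "jumps [p, a, b, c, d] \<noteq> {} \<longleftrightarrow>
    \<bar>p - a\<bar> \<noteq> 1 \<or> \<bar>a - b\<bar> \<noteq> 1 \<or> \<bar>b - c\<bar> \<noteq> 1 \<or> \<bar>c - d\<bar> \<noteq> 1"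
proof -
  have *: "i + 1 < 5 \<longleftrightarrow> i = 0 \<or> i = 1 \<or> i = 2 \<or> i = 3" for i :: nat by linarith
  have len: "length [p, a, b, c, d] = 5" by simp
  show ?thesis unfolding jumps_def len * 
    by (simp only: Collect_empty_eq) (simp add: conj_disj_distribR ex_disj_distrib)
qed

text \<open>Commuting swaps near a jump break up the domino at the second position: otherwise two
  swapped words would contain a pattern \<open>a (a \<plusminus> 1) a\<close>, which is never a valid move sequence.\<close>
lemma window5:
  assumes P: "path B v C" and v: "length v = 5" and ab: "\<bar>v ! 1 - v ! 2\<bar> = 1"
    and jump: "jumps v \<noteq> {}"
  shows "\<exists>\<sigma>\<in>rearrangements. path B (map ((!) v) \<sigma>) C \<and> \<bar>map ((!) v) \<sigma> ! 1 - map ((!) v) \<sigma> ! 2\<bar> \<noteq> 1"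
proof -
  obtain p a b c d where v: "v = [p, a, b, c, d]" using length_5[OF v] by auto
  have ab': "\<bar>a - b\<bar> = 1" using ab v by simp
  show ?thesis
  proof (cases "\<bar>p - a\<bar> \<noteq> 1 \<or> \<bar>b - c\<bar> \<noteq> 1")
    case True
    then have "path B [p, a, c, b, d] C \<and> \<bar>a - c\<bar> \<noteq> 1
       \<or> path B [a, p, b, c, d] C \<and> \<bar>p - b\<bar> \<noteq> 1
       \<or> path B [a, p, c, b, d] C \<and> \<bar>p - c\<bar> \<noteq> 1"
      using P v by (intro window4[OF _ ab']) auto
    then show ?thesis unfolding rearrangements_def v by (auto simp del: path.simps)
  next
    case False
    then have cd: "\<bar>c - d\<bar> \<noteq> 1" and pa: "\<bar>p - a\<bar> = 1" and bc: "\<bar>b - c\<bar> = 1"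
      using jump ab' unfolding v jumps_5 by auto
    \<comment> \<open>The only jump is between \<open>c\<close> and \<open>d\<close>, so these are
      exchanged first. The neighbours of \<open>b\<close> are already \<open>a\<close> and
      \<open>c\<close>; hence \<open>d\<close> is not one of them, and \<open>window4\<close>
      applies to \<open>p, a, b, d\<close>.\<close>
    have P1: "path B [p, a, b, d, c] C"
      using path_swap[of B "[p, a, b]" c d "[]" C] P cd v by (simp del: path.simps)
    have "d \<noteq> b" using path_neq[of B "[p, a]" b d "[c]" C] P1 by (simp del: path.simps)
    moreover have "d \<noteq> a" using path_neq3[of B "[p]" a b d "[c]" C] P1 ab' by (simp del: path.simps)
    moreover have "d \<noteq> c" using path_neq[of B "[p, a, b]" d c "[]" C] P1 by (simp del: path.simps)
    moreover have "c \<noteq> a" using path_neq3[of B "[p]" a b c "[d]" C] P v ab' by (simp del: path.simps)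
    ultimately have bd: "\<bar>b - d\<bar> \<noteq> 1" using ab' bc by linarith
    have "path B [p, a, d, b, c] C \<and> \<bar>a - d\<bar> \<noteq> 1
       \<or> path B [a, p, b, d, c] C \<and> \<bar>p - b\<bar> \<noteq> 1
       \<or> path B [a, p, d, b, c] C \<and> \<bar>p - d\<bar> \<noteq> 1"
      using P1 bd by (intro window4[OF _ ab']) auto
    then show ?thesis unfolding rearrangements_def v by (auto simp del: path.simps)
  qed
qed

section \<open>Breaking up dominoes\<close>

definition words_from :: "nat \<Rightarrow> int set \<Rightarrow> int list set" where
  "words_from n B = {w. length w = n \<and> (\<exists>C. path B w C)}"

lemma finite_words_from' [simp]: "finite B \<Longrightarrow> finite (words_from n B)"
  using finite_words_from unfolding words_from_def by blast

lemma sum_run: "finite B \<Longrightarrow> v \<in> words_from n B \<Longrightarrow> \<Sum>B = \<Sum>(run B v) + int n"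
  unfolding words_from_def using path_length path_run by blast

lemma sum_words_split:
  fixes h :: "int list \<Rightarrow> real"
  assumes B: "finite B" "\<Sum>B = \<Sum>G + int (n + s)"
  shows "sum h (words B G) = (\<Sum>v\<in>words_from n B. \<Sum>w\<in>words (run B v) G. h (v @ w))"
proof -
  have eq: "words B G = (\<lambda>(v, w). v @ w) ` (SIGMA v:words_from n B. words (run B v) G)"
  proof (intro set_eqI iffI)
    fix w assume w: "w \<in> words B G"
    then have "length w = n + s" using words_length[OF B] by simp
    moreover obtain D where "path B (take n w) D" "path D (drop n w) G"
      using w path_append[of B "take n w" "drop n w" G] by (auto simp: words_def)
    ultimately show "w \<in> (\<lambda>(v, w). v @ w) ` (SIGMA v:words_from n B. words (run B v) G)"
      using path_run by (intro image_eqI[of _ _ "(take n w, drop n w)"]) (auto simp: words_from_def words_def)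
  next
    fix w assume "w \<in> (\<lambda>(v, w). v @ w) ` (SIGMA v:words_from n B. words (run B v) G)"
    then show "w \<in> words B G" using path_run by (auto simp: words_from_def words_def path_append)
  qed
  have inj: "inj_on (\<lambda>(v, w). v @ w) (SIGMA v:words_from n B. words (run B v) G)"
    by (auto simp: inj_on_def words_from_def)
  have "sum h (words B G) = (\<Sum>(v, w)\<in>(SIGMA v:words_from n B. words (run B v) G). h (v @ w))"
    unfolding eq by (subst sum.reindex[OF inj]) (auto intro!: sum.cong)
  then show ?thesis using B by (simp add: sum.Sigma)
qed

text \<open>A test weight whose mean over all words is at most 1 but which exceeds 1 on the words to
  be counted. A word with the prescribed pair and a jump is taken by one of six rearrangements to a
  word without the pair. Hence the words of weight 0 have at least a sixth of the mass of those of
  weight \<open>7/6\<close>, and they pay for the excess \<open>1/6\<close>.\<close>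

definition window_weight :: "int list \<Rightarrow> real" where
  "window_weight v = (if \<bar>v ! 1 - v ! 2\<bar> \<noteq> 1 then 0 else if jumps v \<noteq> {} then 7 / 6 else 1)"

lemma rearrangement_inj:
  assumes "\<sigma> \<in> rearrangements" shows "inj_on (\<lambda>v. map ((!) v) \<sigma>) {v. length v = 5}"
proof (rule inj_onI)
  fix v w :: "'a list" assume "v \<in> {v. length v = 5}" "w \<in> {v. length v = 5}"
    and eq: "map ((!) v) \<sigma> = map ((!) w) \<sigma>"
  then have len: "length v = 5" "length w = 5" by auto
  have "set \<sigma> = {..<5}" using assms unfolding rearrangements_def by auto
  moreover have "v ! i = w ! i" if "i \<in> set \<sigma>" for i using eq that by (simp add: map_eq_conv)
  ultimately show "v = w" using len by (intro nth_equalityI) auto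
qed

lemma sum_UN_le:
  fixes f :: "'b \<Rightarrow> real"
  assumes "finite J" "\<And>j. finite (A j)" "\<And>x. 0 \<le> f x"
  shows "sum f (\<Union>j\<in>J. A j) \<le> (\<Sum>j\<in>J. sum f (A j))"
  using assms(1)
proof (induction J)
  case (insert j J)
  have "sum f (A j \<union> (\<Union>j\<in>J. A j)) \<le> sum f (A j) + sum f (\<Union>j\<in>J. A j)"
    using insert assms sum.union_inter[of "A j" "\<Union>j\<in>J. A j" f] 
      sum_nonneg[of "A j \<inter> (\<Union>j\<in>J. A j)" f] by simp
  then show ?case using insert by simp
qed simp

text \<open>The rearrangements keep the end state of the window, so the comparison survives any
  nonnegative weight \<open>F\<close> of that state. Taking for \<open>F\<close> the number of
  completions allows windows to be treated one after the other.\<close>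

lemma window_weight_sum:
  fixes F :: "int set \<Rightarrow> real"
  assumes B: "finite B" and F: "\<And>C. 0 \<le> F C"
  shows "(\<Sum>v\<in>words_from 5 B. window_weight v * F (run B v)) \<le> (\<Sum>v\<in>words_from 5 B. F (run B v))"
proof -
  let ?V = "words_from 5 B"
  define D where "D = {v \<in> ?V. \<bar>v ! 1 - v ! 2\<bar> \<noteq> 1}"
  define A where "A = {v \<in> ?V. \<bar>v ! 1 - v ! 2\<bar> = 1 \<and> jumps v \<noteq> {}}"
  define R where "R = {v \<in> ?V. \<bar>v ! 1 - v ! 2\<bar> = 1 \<and> jumps v = {}}"
  define A' where "A' \<sigma> = {v \<in> ?V. map ((!) v) \<sigma> \<in> D \<and> run B (map ((!) v) \<sigma>) = run B v}" for \<sigma>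
  let ?F = "\<lambda>v. F (run B v)"
  have fin: "finite ?V" "finite A" "finite D" "finite R" "finite (A' \<sigma>)" for \<sigma>
    using B by (auto simp: A_def D_def R_def A'_def)
  have V: "?V = A \<union> D \<union> R" "A \<inter> D = {}" "(A \<union> D) \<inter> R = {}" by (auto simp: A_def D_def R_def)
  have split: "sum h ?V = sum h A + sum h D + sum h R" for h :: "int list \<Rightarrow> real"
    unfolding V(1) using fin V(2,3) by (simp add: sum.union_disjoint)
  have finr: "finite rearrangements" and cardr: "card rearrangements \<le> 6"
    unfolding rearrangements_def by (auto intro: order.trans[OF card_insert_le_m1])
  have sub: "A \<subseteq> (\<Union>\<sigma>\<in>rearrangements. A' \<sigma>)"
  proof
    fix v assume v: "v \<in> A"
    then obtain C where C: "path B v C" and len: "length v = 5" by (auto simp: A_def words_from_def)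
    obtain \<sigma> where \<sigma>: "\<sigma> \<in> rearrangements" "path B (map ((!) v) \<sigma>) C"
        "\<bar>map ((!) v) \<sigma> ! 1 - map ((!) v) \<sigma> ! 2\<bar> \<noteq> 1"
      using window5[OF C len] v by (auto simp: A_def)
    have "length \<sigma> = 5" using \<sigma>(1) unfolding rearrangements_def by auto
    then have "v \<in> A' \<sigma>" using v \<sigma> C path_run by (auto simp: A'_def D_def A_def words_from_def)
    then show "v \<in> (\<Union>\<sigma>\<in>rearrangements. A' \<sigma>)" using \<sigma>(1) by blast
  qed
  have A'le: "sum ?F (A' \<sigma>) \<le> sum ?F D" if "\<sigma> \<in> rearrangements" for \<sigma>
  proof -
    have inj: "inj_on (\<lambda>v. map ((!) v) \<sigma>) (A' \<sigma>)"
      by (rule inj_on_subset[OF rearrangement_inj[OF that]]) (auto simp: A'_def words_from_def)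
    have "sum ?F (A' \<sigma>) = sum ?F ((\<lambda>v. map ((!) v) \<sigma>) ` A' \<sigma>)"
      by (subst sum.reindex[OF inj]) (auto simp: A'_def intro!: sum.cong)
    also have "\<dots> \<le> sum ?F D" using fin F by (intro sum_mono2) (auto simp: A'_def)
    finally show ?thesis .
  qed
  have "sum ?F A \<le> sum ?F (\<Union>\<sigma>\<in>rearrangements. A' \<sigma>)"
    using sub finr fin F by (intro sum_mono2) auto
  also have "\<dots> \<le> (\<Sum>\<sigma>\<in>rearrangements. sum ?F (A' \<sigma>))"
    using finr fin(5) F by (intro sum_UN_le) auto
  also have "\<dots> \<le> (\<Sum>\<sigma>\<in>rearrangements. sum ?F D)" by (intro sum_mono A'le)
  also have "\<dots> \<le> 6 * sum ?F D"
    using cardr F by (auto intro!: mult_right_mono sum_nonneg)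
  finally have AD: "sum ?F A \<le> 6 * sum ?F D" .
  have "(\<Sum>v\<in>?V. window_weight v * ?F v) = 7 / 6 * sum ?F A + sum ?F R"
    unfolding split sum_distrib_left by (simp add: A_def D_def R_def window_weight_def)
  also have "\<dots> \<le> sum ?F A + sum ?F D + sum ?F R" using AD by simp
  finally show ?thesis unfolding split .
qed

definition block_weight :: "bool \<Rightarrow> int list \<Rightarrow> real" where
  "block_weight b v = (if b then window_weight v else 1)"

lemma block_weight_nonneg: "0 \<le> block_weight b v"
  by (simp add: block_weight_def window_weight_def)

text \<open>A supermartingale argument: given the state after the first window, the later windows
  are estimated by induction, and \<open>window_weight_sum\<close> then removes the first. The flag
  \<open>b l\<close> tells whether window \<open>l\<close> has a prescribed pair at its second
  letter; otherwise its weight is 1.\<close>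

lemma sum_block_weights:
  assumes "finite B" "\<Sum>B = \<Sum>G + int s" "5 * q \<le> s"
  shows "(\<Sum>w\<in>words B G. \<Prod>l<q. block_weight (b l) (take 5 (drop (5 * l) w))) \<le> card (words B G)"
  using assms
proof (induction q arbitrary: B b s)
  case 0
  then show ?case by simp
next
  case (Suc q)
  define s' where "s' = s - 5"
  have s: "s = 5 + s'" using Suc.prems by (simp add: s'_def)
  have sB: "\<Sum>B = \<Sum>G + int (5 + s')" using Suc.prems s by simp
  let ?h = "\<lambda>w. \<Prod>l<Suc q. block_weight (b l) (take 5 (drop (5 * l) w))"
  have "sum ?h (words B G) = (\<Sum>v\<in>words_from 5 B. \<Sum>w\<in>words (run B v) G. ?h (v @ w))"
    by (rule sum_words_split[OF Suc.prems(1) sB])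
  also have "\<dots> = (\<Sum>v\<in>words_from 5 B. block_weight (b 0) v * 
      (\<Sum>w\<in>words (run B v) G. \<Prod>l<q. block_weight (b (Suc l)) (take 5 (drop (5 * l) w))))"
    unfolding sum_distrib_left
    by (intro sum.cong refl) (auto simp: prod.lessThan_Suc_shift words_from_def simp del: prod.lessThan_Suc)
  also have "\<dots> \<le> (\<Sum>v\<in>words_from 5 B. block_weight (b 0) v * real (card (words (run B v) G)))"
  proof (intro sum_mono mult_left_mono block_weight_nonneg)
    fix v assume v: "v \<in> words_from 5 B"
    have "\<Sum>(run B v) = \<Sum>G + int s'" using sum_run[OF Suc.prems(1) v] sB by simp
    then show "(\<Sum>w\<in>words (run B v) G. \<Prod>l<q. block_weight (b (Suc l)) (take 5 (drop (5 * l) w)))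
       \<le> real (card (words (run B v) G))"
      using Suc.IH[of "run B v" s' "\<lambda>l. b (Suc l)"] Suc.prems s by simp
  qed
  also have "\<dots> \<le> (\<Sum>v\<in>words_from 5 B. real (card (words (run B v) G)))"
    using window_weight_sum[OF Suc.prems(1), of "\<lambda>C. real (card (words C G))"]
    by (cases "b 0") (auto simp: block_weight_def)
  also have "\<dots> = (\<Sum>w\<in>words B G. 1)"
    by (subst sum_words_split[OF Suc.prems(1) sB]) simp
  finally show ?case by simp
qed

text \<open>The disjoint windows must be allowed to start at any residue modulo 5; the first
  \<open>d\<close> letters are summed out.\<close>

lemma sum_block_weights_offset:
  assumes "finite B" "\<Sum>B = \<Sum>G + int s" "d + 5 * q \<le> s"
  shows "(\<Sum>w\<in>words B G. \<Prod>l<q. block_weight (b l) (take 5 (drop (d + 5 * l) w))) \<le> card (words B G)"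
proof -
  define s' where "s' = s - d"
  have sB: "\<Sum>B = \<Sum>G + int (d + s')" using assms by (simp add: s'_def)
  have "(\<Sum>w\<in>words B G. \<Prod>l<q. block_weight (b l) (take 5 (drop (d + 5 * l) w)))
     = (\<Sum>v\<in>words_from d B. \<Sum>w\<in>words (run B v) G. \<Prod>l<q. block_weight (b l) (take 5 (drop (5 * l) w)))"
    unfolding sum_words_split[OF assms(1) sB]
    by (intro sum.cong prod.cong refl) (auto simp: words_from_def)
  also have "\<dots> \<le> (\<Sum>v\<in>words_from d B. real (card (words (run B v) G)))"
  proof (intro sum_mono)
    fix v assume v: "v \<in> words_from d B"
    have "\<Sum>(run B v) = \<Sum>G + int s'" using sum_run[OF assms(1) v] sB by simp
    then show "(\<Sum>w\<in>words (run B v) G. \<Prod>l<q. block_weight (b l) (take 5 (drop (5 * l) w)))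
       \<le> real (card (words (run B v) G))"
      using sum_block_weights[of "run B v" G s' q b] assms by (simp add: s'_def)
  qed
  also have "\<dots> = (\<Sum>w\<in>words B G. 1)"
    by (subst sum_words_split[OF assms(1) sB]) simp
  finally show ?thesis by simp
qed

section \<open>Rigid words with many active windows\<close>

definition active :: "nat set \<Rightarrow> int list \<Rightarrow> nat set" where
  "active I w = {c. c + 4 < length w \<and> Suc c \<in> I \<and> jumps (take 5 (drop c w)) \<noteq> {}}"

definition rigid :: "nat set \<Rightarrow> int list \<Rightarrow> bool" where
  "rigid I w \<longleftrightarrow> (\<forall>i\<in>I. i + 1 < length w \<longrightarrow> \<bar>w ! i - w ! (i + 1)\<bar> = 1)"

lemma finite_active [simp]: "finite (active I w)"
  by (rule finite_subset[of _ "{..<length w}"]) (auto simp: active_def)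

text \<open>Rigidity excludes the weight 0, so every window contributes \<open>7/6\<close> or 1, and
  \<open>7/6\<close> exactly when it is active.\<close>

lemma prod_block_weights:
  assumes "rigid I w" "d < 5" "d \<le> length w"
  shows "(\<Prod>l<(length w - d) div 5. block_weight (d + 5 * l + 1 \<in> I) (take 5 (drop (d + 5 * l) w)))
     = (7 / 6) ^ card {c \<in> active I w. c mod 5 = d}"
proof -
  let ?q = "(length w - d) div 5"
  let ?L = "{l\<in>{..<?q}. d + 5 * l \<in> active I w}"
  have "(\<Prod>l<?q. block_weight (d + 5 * l + 1 \<in> I) (take 5 (drop (d + 5 * l) w)))
      = (\<Prod>l<?q. if d + 5 * l \<in> active I w then 7 / 6 else 1)"
  proof (intro prod.cong refl)
    fix l assume "l \<in> {..<?q}"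
    then have l: "d + 5 * l + 4 < length w" using assms(3) by auto
    have "\<bar>take 5 (drop (d + 5 * l) w) ! 1 - take 5 (drop (d + 5 * l) w) ! 2\<bar> = 1" if "d + 5 * l + 1 \<in> I"
      using assms(1) that l by (auto simp: rigid_def nth_append dest!: bspec)
    then show "block_weight (d + 5 * l + 1 \<in> I) (take 5 (drop (d + 5 * l) w)) 
         = (if d + 5 * l \<in> active I w then 7 / 6 else 1)"
      using l by (auto simp: block_weight_def window_weight_def active_def)
  qed
  also have "\<dots> = (\<Prod>l\<in>?L. 7 / 6)"
    by (rule prod.inter_filter[symmetric]) simp
  also have "\<dots> = (7 / 6) ^ card ?L" by (rule prod_constant)
  also have "card ?L = card ((\<lambda>l. d + 5 * l) ` ?L)" by (subst card_image) (auto simp: inj_on_def)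
  also have "(\<lambda>l. d + 5 * l) ` ?L = {c \<in> active I w. c mod 5 = d}"
  proof (intro set_eqI iffI)
    fix c assume c: "c \<in> {c \<in> active I w. c mod 5 = d}"
    then have "c = d + 5 * (c div 5)" by (metis (mono_tags, lifting) mem_Collect_eq mod_mult_div_eq)
    moreover have "c + 4 < length w" using c by (auto simp: active_def)
    ultimately have "c div 5 < ?q" by linarith
    then show "c \<in> (\<lambda>l. d + 5 * l) ` ?L"
      using c \<open>c = d + 5 * (c div 5)\<close> by (intro image_eqI[of _ _ "c div 5"]) auto
  qed (use assms in auto)
  finally show ?thesis .
qed

text \<open>Markov's inequality for the product of the window weights. Active windows may overlap,
  while the product estimate needs disjoint ones; so they are sorted by their start modulo 5. One
  class contains at least \<open>A\<close> of the \<open>5 * A\<close> windows, and the union over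
  the classes gives the factor 5.\<close>

lemma card_many_active:
  assumes B: "finite B" "\<Sum>B = \<Sum>G + int s" "5 \<le> s"
  shows "real (card {w \<in> words B G. rigid I w \<and> 5 * A \<le> card (active I w)}) * (7 / 6) ^ A
     \<le> 5 * real (card (words B G))"
proof -
  let ?W = "{w \<in> words B G. rigid I w \<and> 5 * A \<le> card (active I w)}"
  define X where "X d = {w \<in> words B G. rigid I w \<and> A \<le> card {c \<in> active I w. c mod 5 = d}}" for d
  have finX: "finite (X d)" for d using B by (simp add: X_def)
  have sub: "?W \<subseteq> (\<Union>d<5. X d)"
  proof
    fix w assume w: "w \<in> ?W"
    have "card (active I w) = card (\<Union>d<5. {c \<in> active I w. c mod 5 = d})"
      by (rule arg_cong[where f = card]) auto
    also have "\<dots> \<le> (\<Sum>d<5. card {c \<in> active I w. c mod 5 = d})"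
      by (rule card_UN_le) simp
    finally have le: "card (active I w) \<le> (\<Sum>d<5. card {c \<in> active I w. c mod 5 = d})" .
    have lt: "(\<Sum>d<5. card {c \<in> active I w. c mod 5 = d}) < 5 * A"
      if "\<forall>d<5. card {c \<in> active I w. c mod 5 = d} < A"
    proof -
      have "0 \<in> {..<5::nat}" by simp
      then have "{..<5::nat} \<noteq> {}" by blast
      then have "(\<Sum>d<5. card {c \<in> active I w. c mod 5 = d}) < (\<Sum>d<(5::nat). A)"
        using that by (intro sum_strict_mono) simp_all
      then show ?thesis by simp
    qed
    have ex: "\<exists>d<5. A \<le> card {c \<in> active I w. c mod 5 = d}"
    proof (rule ccontr)
      assume "\<not> ?thesis"
      then have "\<forall>d<5. card {c \<in> active I w. c mod 5 = d} < A" by (simp add: not_le)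
      from lt[OF this] le have "card (active I w) < 5 * A" by simp
      then show False using w by simp
    qed
    then obtain d where "d < 5" "A \<le> card {c \<in> active I w. c mod 5 = d}" by blast
    then show "w \<in> (\<Union>d<5. X d)" using w unfolding X_def by blast
  qed
  have Xle: "real (card (X d)) * (7 / 6) ^ A \<le> real (card (words B G))" if d: "d < 5" for d
  proof -
    let ?g = "\<lambda>w. \<Prod>l<(s - d) div 5. block_weight (d + 5 * l + 1 \<in> I) (take 5 (drop (d + 5 * l) w))"
    have "real (card (X d)) * (7 / 6) ^ A = (\<Sum>w\<in>X d. (7 / 6) ^ A)" by simp
    also have "\<dots> \<le> (\<Sum>w\<in>X d. ?g w)"
    proof (intro sum_mono)
      fix w assume w: "w \<in> X d"
      then have len: "length w = s" using words_length[OF B(1,2)] by (auto simp: X_def)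
      have "?g w = (7 / 6) ^ card {c \<in> active I w. c mod 5 = d}"
        using prod_block_weights[of I w d] w d B(3) len by (auto simp: X_def)
      also have "\<dots> \<ge> (7 / 6) ^ A" using w by (intro power_increasing) (auto simp: X_def)
      finally show "(7 / 6) ^ A \<le> ?g w" .
    qed
    also have "\<dots> \<le> (\<Sum>w\<in>words B G. ?g w)"
      using B by (intro sum_mono2) (auto simp: X_def intro!: prod_nonneg block_weight_nonneg)
    also have "\<dots> \<le> card (words B G)"
      using B d by (intro sum_block_weights_offset) auto
    finally show ?thesis .
  qed
  have "card ?W \<le> card (\<Union>d<5. X d)" using finX sub by (intro card_mono) auto
  also have "\<dots> \<le> (\<Sum>d<5. card (X d))" by (intro card_UN_le) auto
  finally have "real (card ?W) * (7 / 6) ^ A \<le> (\<Sum>d<5. real (card (X d))) * (7 / 6) ^ A"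
    by (intro mult_right_mono) (auto simp flip: of_nat_sum)
  also have "\<dots> = (\<Sum>d<5. real (card (X d)) * (7 / 6) ^ A)" by (simp add: sum_distrib_right)
  also have "\<dots> \<le> (\<Sum>d<(5::nat). real (card (words B G)))" by (intro sum_mono Xle) auto
  finally show ?thesis by simp
qed

text \<open>Apart from three positions at either end, a jump lies in the five-letter window around a
  nearby prescribed pair, and this window is then active. Five letters contain four places for a
  jump.\<close>

lemma card_jumps_le:
  assumes "rigid I w" and dense: "\<And>i. 2 \<le> i \<Longrightarrow> i + 1 < length w \<Longrightarrow> \<exists>j\<in>I. j \<le> i + 1 \<and> i \<le> j + 2"
  shows "card (jumps w) \<le> 6 + 4 * card (active I w)"
proof -
  let ?n = "length w"
  have "jumps w \<subseteq> {..<3} \<union> {?n - 4..<?n - 1} \<union> (\<Union>c\<in>active I w. {c..<c + 4})"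
  proof
    fix i assume i: "i \<in> jumps w"
    then have lt: "i + 1 < ?n" and ne: "\<bar>w ! i - w ! (i + 1)\<bar> \<noteq> 1" by (auto simp: jumps_def)
    show "i \<in> {..<3} \<union> {?n - 4..<?n - 1} \<union> (\<Union>c\<in>active I w. {c..<c + 4})"
    proof (cases "i < 3 \<or> ?n - 4 \<le> i")
      case True
      then show ?thesis using lt by auto
    next
      case False
      then obtain j where j: "j \<in> I" "j \<le> i + 1" "i \<le> j + 2" using dense[of i] lt by auto
      have ji: "j \<noteq> 0" using False j by auto
      define c where "c = j - 1"
      have c: "Suc c = j" "c + 4 < ?n" "c \<le> i" "i < c + 4" using False j ji by (auto simp: c_def)
      have "i - c \<in> jumps (take 5 (drop c w))"
        using c ne by (auto simp: jumps_def)
      then have "c \<in> active I w" using c j by (auto simp: active_def)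
      then show ?thesis using c by auto
    qed
  qed
  then have "card (jumps w) \<le> card ({..<3} \<union> {?n - 4..<?n - 1} \<union> (\<Union>c\<in>active I w. {c..<c + 4}))"
    by (intro card_mono) auto
  also have "\<dots> \<le> card ({..<3::nat} \<union> {?n - 4..<?n - 1}) + card (\<Union>c\<in>active I w. {c..<c + 4})"
    by (rule card_Un_le)
  also have "\<dots> \<le> (card {..<3::nat} + card {?n - 4..<?n - 1}) + (\<Sum>c\<in>active I w. card {c..<c + 4})"
    by (intro add_mono card_Un_le card_UN_le) auto
  also have "\<dots> \<le> 6 + 4 * card (active I w)" by auto
  finally show ?thesis .
qed

section \<open>Sequences with few jumps\<close>

text \<open>Such a set is the set of entries of a list of length exactly \<open>K\<close>, padded
  with one of its own elements; nonemptiness supplies that element.\<close>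

lemma card_small_subsets_le:
  assumes "finite X"
  shows "card {S. S \<subseteq> X \<and> S \<noteq> {} \<and> card S \<le> K} \<le> card X ^ K"
proof -
  have "{S. S \<subseteq> X \<and> S \<noteq> {} \<and> card S \<le> K} \<subseteq> set ` {xs. set xs \<subseteq> X \<and> length xs = K}"
  proof
    fix S assume "S \<in> {S. S \<subseteq> X \<and> S \<noteq> {} \<and> card S \<le> K}"
    then have S: "S \<subseteq> X" "S \<noteq> {}" "card S \<le> K" by auto
    then have "finite S" using assms finite_subset by blast
    then obtain xs where xs: "set xs = S" "distinct xs" using finite_distinct_list by blast
    then have "length xs \<le> K" using S(3) distinct_card by fastforce
    moreover obtain x where "x \<in> S" using S(2) by blast
    ultimately show "S \<in> set ` {xs. set xs \<subseteq> X \<and> length xs = K}"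
      using xs(1) S(1) by (intro image_eqI[of _ _ "xs @ replicate (K - length xs) x"]) auto
  qed
  then have "card {S. S \<subseteq> X \<and> S \<noteq> {} \<and> card S \<le> K} \<le> card {xs. set xs \<subseteq> X \<and> length xs = K}"
    using assms by (intro surj_card_le) (auto simp: finite_lists_length_eq)
  then show ?thesis using assms by (simp add: card_lists_length_eq)
qed

text \<open>Two unit steps either continue or return, and a return is excluded by
  \<open>path_neq3\<close>. Away from jumps a word is therefore an arithmetic progression with
  difference \<plusminus>1.\<close>

lemma words_straight:
  assumes "w \<in> words B G" "i + 2 < length w" "i \<notin> jumps w" "Suc i \<notin> jumps w"
  shows "w ! (i + 2) = 2 * w ! (i + 1) - w ! i"
proof -
  have "w = take i w @ w ! i # w ! (i + 1) # w ! (i + 2) # drop (i + 3) w"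
    using assms(2) by (simp add: Cons_nth_drop_Suc id_take_nth_drop numeral_eq_Suc)
  then have P: "path B (take i w @ w ! i # w ! (i + 1) # w ! (i + 2) # drop (i + 3) w) G"
    using assms(1) by (simp add: words_def)
  have 1: "\<bar>w ! i - w ! (i + 1)\<bar> = 1" "\<bar>w ! (i + 1) - w ! (i + 2)\<bar> = 1"
    using assms(2-4) by (auto simp: jumps_def)
  then have "w ! (i + 2) \<noteq> w ! i" using path_neq3[OF P] by simp
  then show ?thesis using 1 by linarith
qed

text \<open>A move sequence is determined by its letters at the beginning and in the two positions
  after each jump, since it continues straight everywhere else.\<close>
lemma card_few_jumps:
  assumes B: "finite B" "\<Sum>B = \<Sum>G + int s" "1 \<le> s" "B \<subseteq> {..int M}"
  shows "card {w \<in> words B G. card (jumps w) \<le> t} \<le> (s * M) ^ (2 * t + 2)"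
proof -
  \<comment> \<open>The letters not forced by \<open>words_straight\<close>: the two initial ones
    and the two after each jump, at most \<open>2 * t + 2\<close>. The set \<open>g w\<close> stores
    them together with their positions, so \<open>K w\<close> can be read off from it.\<close>
  define K where "K w = ({0, 1} \<union> Suc ` jumps w \<union> (\<lambda>i. i + 2) ` jumps w) \<inter> {..<s}" for w
  define g where "g w = (\<lambda>i. (i, w ! i)) ` K w" for w :: "int list"
  let ?W = "{w \<in> words B G. card (jumps w) \<le> t}"
  let ?X = "{..<s} \<times> {1..int M}"
  have finj: "finite (jumps w)" for w by (rule finite_subset[of _ "{..<length w}"]) (auto simp: jumps_def)
  have len: "length w = s" if "w \<in> words B G" for w using words_length[OF B(1,2) that] .
  have "g w \<in> {S. S \<subseteq> ?X \<and> S \<noteq> {} \<and> card S \<le> 2 * t + 2}" if "w \<in> ?W" for w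
  proof -
    have w: "w \<in> words B G" "card (jumps w) \<le> t" using that by auto
    have "set w \<subseteq> {1..int M}" using w path_letters[OF _ B(4)] by (auto simp: words_def)
    then have "g w \<subseteq> ?X" using len[OF w(1)] by (auto simp: g_def K_def subset_iff)
    moreover have "0 \<in> K w" using B(3) by (simp add: K_def)
    then have "g w \<noteq> {}" by (auto simp: g_def)
    moreover have "card (g w) \<le> 2 * t + 2"
    proof -
      have "card (g w) \<le> card (K w)" unfolding g_def by (rule card_image_le) (simp add: K_def)
      also have "\<dots> \<le> card (({0, 1} \<union> Suc ` jumps w) \<union> (\<lambda>i. i + 2) ` jumps w)"
        using finj unfolding K_def by (intro card_mono) auto
      also have "\<dots> \<le> card ({0, 1::nat} \<union> Suc ` jumps w) + card ((\<lambda>i. i + 2) ` jumps w)"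
        by (rule card_Un_le)
      also have "\<dots> \<le> (card {0, 1::nat} + card (Suc ` jumps w)) + card ((\<lambda>i. i + 2) ` jumps w)"
        by (intro add_mono card_Un_le order.refl)
      also have "\<dots> \<le> (2 + card (jumps w)) + card (jumps w)"
        by (intro add_mono card_image_le finj) auto
      finally show ?thesis using w(2) by simp
    qed
    ultimately show ?thesis by blast
  qed
  then have sub: "g ` ?W \<subseteq> {S. S \<subseteq> ?X \<and> S \<noteq> {} \<and> card S \<le> 2 * t + 2}" by blast
  have inj: "inj_on g ?W"
  proof (rule inj_onI)
    fix w w' assume ww: "w \<in> ?W" "w' \<in> ?W" "g w = g w'"
    have "K w = fst ` g w" "K w' = fst ` g w'" by (auto simp: g_def image_image)
    then have KK: "K w = K w'" using ww(3) by simp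
    have agree: "w ! i = w' ! i" if "i \<in> K w" for i
    proof -
      have "(i, w ! i) \<in> g w'" using that ww(3) by (auto simp: g_def)
      then show ?thesis by (auto simp: g_def)
    qed
    have l: "length w = s" "length w' = s" using ww len by auto
    have "i < s \<Longrightarrow> w ! i = w' ! i" for i
    proof (induction i rule: less_induct)
      case (less i)
      show ?case
      proof (cases "i \<in> K w")
        case True then show ?thesis by (rule agree)
      next
        case False
        then have i2: "2 \<le> i" using less.prems by (cases i) (auto simp: K_def)
        define j where "j = i - 2"
        have ij: "i = j + 2" using i2 by (simp add: j_def)
        have nj: "j \<notin> jumps w \<and> Suc j \<notin> jumps w" if "i \<notin> K w" for w
          using that less.prems unfolding K_def ij by auto
        have "w ! (j + 2) = 2 * w ! (j + 1) - w ! j"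
          using words_straight[of w B G j] nj[OF False] ww(1) l less.prems ij by simp
        moreover have "w' ! (j + 2) = 2 * w' ! (j + 1) - w' ! j"
          using words_straight[of w' B G j] nj[of w'] False KK ww(2) l less.prems ij by simp
        ultimately show ?thesis using less.IH[of j] less.IH[of "j + 1"] less.prems ij by simp
      qed
    qed
    then show "w = w'" using l by (intro nth_equalityI) auto
  qed
  have "card ?W = card (g ` ?W)" using inj by (simp add: card_image)
  also have "\<dots> \<le> card {S. S \<subseteq> ?X \<and> S \<noteq> {} \<and> card S \<le> 2 * t + 2}"
    using sub by (intro card_mono) auto
  also have "\<dots> \<le> card ?X ^ (2 * t + 2)" by (rule card_small_subsets_le) simp
  finally show ?thesis by (simp add: card_cartesian_product)
qed

text \<open>The shape fits into a \<open>b\<close> by \<open>b\<close> square: the lowest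
  \<open>n - b\<close> positions are filled, so at most \<open>b\<close> rows are nonempty, and the
  largest bead is below \<open>n + b\<close>, so the first row has at most \<open>b\<close>
  cells.\<close>

definition boxed :: "nat \<Rightarrow> nat \<Rightarrow> int set \<Rightarrow> bool" where
  "boxed n b B \<longleftrightarrow> finite B \<and> card B = n \<and> {0..<int n - int b} \<subseteq> B \<and> B \<subseteq> {0..<int n + int b}"

lemma boxed_move:
  assumes "boxed n b B" "x \<in> movable 1 B" shows "boxed n b (bead_move 1 x B)"
proof -
  have x: "x \<in> B" "1 \<le> x" "x - 1 \<notin> B" using assms(2) by (auto simp: movable_def)
  have "\<not> x < int n - int b" using assms(1) x by (auto simp: boxed_def subset_iff)
  moreover have "card (bead_move 1 x B) = n" using card_bead_move assms by (auto simp: boxed_def)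
  ultimately show ?thesis using assms(1) x unfolding boxed_def bead_move_def by auto
qed

lemma movable_empty:
  assumes "finite B" "B \<subseteq> {0..}" "movable 1 B = {}"
  shows "B = {0..<int (card B)}"
proof (cases "B = {}")
  case False
  define m where "m = Max B"
  have m: "m \<in> B" "\<And>y. y \<in> B \<Longrightarrow> y \<le> m" using False assms(1) by (auto simp: m_def)
  have down: "y - 1 \<in> B" if "y \<in> B" "1 \<le> y" for y using assms(3) that by (auto simp: movable_def)
  have up: "0 \<le> y \<longrightarrow> y \<in> B" if "y \<le> m" for y
    using that
  proof (induction y rule: int_le_induct)
    case base then show ?case using m by simp
  next
    case (step i) then show ?case using down[of i] by auto
  qed
  have B: "B = {0..<m + 1}"
  proof (intro set_eqI iffI)
    fix y assume y: "y \<in> B"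
    then show "y \<in> {0..<m + 1}" using m(2)[OF y] assms(2) by auto
  next
    fix y assume "y \<in> {0..<m + 1}"
    then show "y \<in> B" using up[of y] by auto
  qed
  moreover have "0 \<le> m" using m assms(2) by auto
  ultimately have "int (card B) = m + 1" by simp
  then show ?thesis using B by simp
qed simp

abbreviation ground :: "nat \<Rightarrow> int set" where "ground n \<equiv> {0..<int n}"

lemma sum_ground_Suc: "\<Sum>(ground (Suc n)) = \<Sum>(ground n) + int n"
proof -
  have "ground (Suc n) = insert (int n) (ground n)" by auto
  then show ?thesis by simp
qed

lemma sum_ground_le:
  assumes "finite B" "B \<subseteq> {0..}" "card B = n"
  shows "\<Sum>(ground n) \<le> \<Sum>B"
  using assms
proof (induction "nat (\<Sum>B)" arbitrary: B rule: less_induct)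
  case less
  show ?case
  proof (cases "movable 1 B = {}")
    case True
    then show ?thesis using movable_empty[OF less.prems(1,2) True] less.prems(3) by simp
  next
    case False
    then obtain x where x: "x \<in> movable 1 B" by blast
    have sub: "bead_move 1 x B \<subseteq> {0..}"
      using x less.prems(2) by (auto simp: movable_def bead_move_def)
    have sum: "\<Sum>(bead_move 1 x B) = \<Sum>B - 1" using sum_bead_move[OF less.prems(1) x] .
    have "0 \<le> \<Sum>(bead_move 1 x B)" using sub by (intro sum_nonneg) auto
    then have "\<Sum>(ground n) \<le> \<Sum>(bead_move 1 x B)"
      using sum sub less.prems card_bead_move[OF less.prems(1) x] by (intro less.hyps) auto
    then show ?thesis using sum by simp
  qed
qed

lemma card_words_step:
  assumes "finite B" "\<Sum>B = \<Sum>G + int (Suc s)"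
  shows "card (words B G) = (\<Sum>x\<in>movable 1 B. card (words (bead_move 1 x B) G))"
proof -
  have "card (words (bead_move 1 x B) G) = chains G (replicate s 1) (bead_move 1 x B)"
    if "x \<in> movable 1 B" for x
    using sum_bead_move[OF assms(1) that] assms that by (intro card_words_chains) auto
  then show ?thesis using card_words_chains[OF assms] by simp
qed

text \<open>Every two removals at least double the count. A shape with two corners branches at once.
  A shape with one corner is a rectangle, and removing that corner leaves two, unless it is a single
  row or column; in the box these have at most \<open>b\<close> cells and do not occur for
  \<open>s > b + 1\<close>.\<close>

lemma card_words_ge:
  assumes "boxed n b B" "\<Sum>B = \<Sum>(ground n) + int s"
  shows "2 ^ ((s - b) div 2) \<le> card (words B (ground n))"
  using assms
proof (induction s arbitrary: B rule: less_induct)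
  case (less s)
  let ?G = "ground n"
  have fin: "finite B" and cB: "card B = n" and lo: "{0..<int n - int b} \<subseteq> B" 
    and hi: "B \<subseteq> {0..<int n + int b}"
    using less.prems by (auto simp: boxed_def)
  have B0: "B \<subseteq> {0..}" using hi by auto
  show ?case
  proof (cases "s = 0")
    case True
    have "movable 1 B = {}"
    proof (rule ccontr)
      assume "movable 1 B \<noteq> {}"
      then obtain x where x: "x \<in> movable 1 B" by blast
      have "boxed n b (bead_move 1 x B)" by (rule boxed_move[OF less.prems(1) x])
      then have "\<Sum>(ground n) \<le> \<Sum>(bead_move 1 x B)"
        by (intro sum_ground_le) (auto simp: boxed_def)
      then show False using sum_bead_move[OF fin x] less.prems(2) True by simp
    qed
    then have "B = ?G" using movable_empty[OF fin B0] cB by simp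
    then have "[] \<in> words B ?G" by (simp add: words_def)
    then have "card (words B ?G) \<ge> 1" using fin by (simp add: Suc_le_eq card_gt_0_iff) auto
    then show ?thesis using True by simp
  next
    case False
    then obtain s' where s': "s = Suc s'" by (cases s) auto
    have sB: "\<Sum>B = \<Sum>?G + int (Suc s')" using less.prems s' by simp
    have step: "card (words B ?G) = (\<Sum>x\<in>movable 1 B. card (words (bead_move 1 x B) ?G))"
      by (rule card_words_step[OF fin sB])
    have ne: "movable 1 B \<noteq> {}"
    proof
      assume "movable 1 B = {}"
      then have "B = ?G" using movable_empty[OF fin B0] cB by simp
      then show False using sB by simp
    qed
    have IH: "2 ^ ((s' - b) div 2) \<le> card (words (bead_move 1 x B) ?G)" if "x \<in> movable 1 B" for x
      using less.IH[of s' "bead_move 1 x B"] boxed_move[OF less.prems(1) that] 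
        sum_bead_move[OF fin that] sB s' by simp
    have ge: "(\<Sum>x\<in>movable 1 B. 2 ^ ((s' - b) div 2)) \<le> card (words B ?G)"
      unfolding step by (intro sum_mono IH)
    consider "s \<le> b + 1" | "2 \<le> card (movable 1 B)" | "s > b + 1" "card (movable 1 B) < 2" by linarith
    then show ?thesis
    proof cases
      case 1
      have "card (movable 1 B) \<ge> 1" using ne fin by (simp add: Suc_le_eq card_gt_0_iff)
      then have "1 \<le> card (words B ?G)" using ge 1 s' by simp
      then show ?thesis using 1 by simp
    next
      case 2
      have "2 ^ ((s - b) div 2) \<le> (2::nat) ^ Suc ((s' - b) div 2)"
        using s' by (intro power_increasing) linarith+
      also have "\<dots> \<le> card (movable 1 B) * 2 ^ ((s' - b) div 2)" using 2 by simp
      also have "\<dots> \<le> card (words B ?G)" using ge by simp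
      finally show ?thesis .
    next
      case 3
      have "card (movable 1 B) = 1" using 3 ne fin by (simp add: card_gt_0_iff le_antisym Suc_le_eq less_Suc_eq numeral_2_eq_2)
      then obtain x where x: "movable 1 B = {x}" using card_1_singletonE by blast
      then have xB: "x \<in> B" "1 \<le> x" "x - 1 \<notin> B" by (auto simp: movable_def)
      have only: "y = x" if "y \<in> B" "1 \<le> y" "y - 1 \<notin> B" for y using x that by (auto simp: movable_def)
      define B' where "B' = bead_move 1 x B"
      have x2: "2 \<le> x" "x - 2 \<notin> B"
      proof -
        have "\<not> (x = 1 \<or> x - 2 \<in> B)"
        proof
          assume H: "x = 1 \<or> x - 2 \<in> B"
          \<comment> \<open>If \<open>x - 1\<close> is the whole gap below \<open>x\<close>, the
            shape is a single column: filling the gap yields all of \<open>0, ..., n\<close>, whence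
            \<open>s = n - (x - 1) \<le> b\<close>.\<close>
          define C where "C = insert (x - 1) B"
          have "y \<notin> movable 1 C" for y
          proof
            assume "y \<in> movable 1 C"
            then have y: "y = x - 1 \<or> y \<in> B" "1 \<le> y" "y - 1 \<notin> B" "y \<noteq> x"
              by (auto simp: movable_def C_def)
            then have "y = x - 1" using only by blast
            then show False using H y by auto
          qed
          then have "movable 1 C = {}" by blast
          moreover have "C \<subseteq> {0..}" "finite C" "card C = Suc n" using B0 xB fin cB by (auto simp: C_def)
          ultimately have "C = ground (Suc n)" using movable_empty[of C] by simp
          then have "\<Sum>C = \<Sum>?G + int n" using sum_ground_Suc by metis
          moreover have "\<Sum>C = \<Sum>B + (x - 1)" using fin xB by (simp add: C_def)
          moreover have "\<not> x - 1 < int n - int b" using lo xB by (auto simp: subset_iff)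
          ultimately show False using less.prems(2) 3(1) by linarith
        qed
        then show "2 \<le> x" "x - 2 \<notin> B" using xB by auto
      qed
      have x1: "x + 1 \<in> B"
      proof (rule ccontr)
        assume H: "x + 1 \<notin> B"
        \<comment> \<open>Without a bead at \<open>x + 1\<close> the shape is a single row: the
          other beads are \<open>0, ..., n - 2\<close>, whence
          \<open>s = x - (n - 1) \<le> b\<close>.\<close>
        define C where "C = B - {x}"
        have "y \<notin> movable 1 C" for y
        proof
          assume "y \<in> movable 1 C"
          then have y: "y \<in> B" "y \<noteq> x" "1 \<le> y" "y - 1 = x \<or> y - 1 \<notin> B"
            by (auto simp: movable_def C_def)
          then have "y = x + 1" using only[of y] by linarith
          then show False using H y by simp
        qed
        then have "movable 1 C = {}" by blast
        moreover have "C \<subseteq> {0..}" "finite C" "Suc (card C) = n"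
          using B0 xB fin cB card_Suc_Diff1[of B x] by (auto simp: C_def)
        ultimately have "C = ground (n - 1)" "n \<ge> 1" using movable_empty[of C] by auto
        then have "\<Sum>?G = \<Sum>C + int (n - 1)" using sum_ground_Suc[of "n - 1"] by simp
        moreover have "\<Sum>B = \<Sum>C + x" using fin xB by (simp add: C_def sum_diff1)
        moreover have "x < int n + int b" using hi xB by auto
        ultimately show False using less.prems(2) 3(1) \<open>n \<ge> 1\<close> by linarith
      qed
      have B': "boxed n b B'" "finite B'" "\<Sum>B' = \<Sum>?G + int s'"
        using boxed_move[OF less.prems(1)] sum_bead_move[OF fin] sB x fin by (auto simp: B'_def)
      obtain s'' where s'': "s' = Suc s''" using 3(1) s' by (cases s') auto
      have two: "x - 1 \<in> movable 1 B'" "x + 1 \<in> movable 1 B'"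
        using x2 x1 xB by (auto simp: B'_def bead_move_def movable_def)
      have IH2: "2 ^ ((s'' - b) div 2) \<le> card (words (bead_move 1 y B') ?G)" if "y \<in> movable 1 B'" for y
        using less.IH[of s'' "bead_move 1 y B'"] boxed_move[OF B'(1) that] 
          sum_bead_move[OF B'(2) that] B'(3) s' s'' by simp
      have "2 ^ ((s - b) div 2) \<le> (2::nat) ^ Suc ((s'' - b) div 2)"
        using s' s'' by (intro power_increasing) linarith+
      also have "\<dots> = (\<Sum>y\<in>{x - 1, x + 1}. 2 ^ ((s'' - b) div 2))" by simp
      also have "\<dots> \<le> (\<Sum>y\<in>movable 1 B'. card (words (bead_move 1 y B') ?G))"
      proof -
        have "(\<Sum>y\<in>{x - 1, x + 1}. 2 ^ ((s'' - b) div 2)) 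
           \<le> (\<Sum>y\<in>{x - 1, x + 1}. card (words (bead_move 1 y B') ?G))"
          using two IH2 by (intro sum_mono) auto
        also have "\<dots> \<le> (\<Sum>y\<in>movable 1 B'. card (words (bead_move 1 y B') ?G))"
          using two B'(2) by (intro sum_mono2) auto
        finally show ?thesis .
      qed
      also have "\<dots> = card (words B' ?G)"
        using card_words_step[OF B'(2), of ?G s''] B'(3) s'' by simp
      also have "\<dots> = card (words B ?G)" unfolding step x B'_def by simp
      finally show ?thesis .
    qed
  qed
qed

text \<open>A word containing the prescribed pairs has at least \<open>5 * A\<close> active windows
  or at most \<open>t = 6 + 4 * 5 * A\<close> jumps. The exponent \<open>14 + 40 * A\<close> is
  \<open>2 * t + 2\<close> from \<open>card_few_jumps\<close>.\<close>

lemma chains_hook_bound: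
  assumes B: "boxed n b B" "\<Sum>B = \<Sum>(ground n) + int s" "5 \<le> s"
    and rs: "\<forall>r\<in>set rs. 2 \<le> r" "sum_list rs = s"
  shows "real (chains (ground n) (map int rs) B)
     \<le> 5 * (6 / 7) ^ A * real (card (words B (ground n))) + real (s * (n + b)) ^ (14 + 40 * A)"
proof -
  let ?G = "ground n"
  have fin: "finite B" and BM: "B \<subseteq> {..int (n + b)}" using B by (auto simp: boxed_def)
  obtain ts where ts: "spread ts" "sum_list ts = int s" "chains ?G (map int rs) B \<le> chains ?G ts B"
    using chains_spread[OF fin rs(1), of ?G] rs(2) by auto
  define I where "I = two_starts ts"
  have dense: "\<exists>j\<in>I. j \<le> i + 1 \<and> i \<le> j + 2" if "2 \<le> i" "i + 1 < s" for i
    using two_starts_dense[OF ts(1) that(1)] that ts(2) by (auto simp: I_def)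
  let ?M = "{w \<in> words B ?G. rigid I w \<and> 5 * A \<le> card (active I w)}"
  let ?F = "{w \<in> words B ?G. card (jumps w) \<le> 6 + 20 * A}"
  have sub: "{w. path B w ?G \<and> dominoed ts w} \<subseteq> ?M \<union> ?F"
  proof
    fix w assume w: "w \<in> {w. path B w ?G \<and> dominoed ts w}"
    then have W: "w \<in> words B ?G" by (simp add: words_def)
    have len: "length w = s" using words_length[OF fin B(2) W] .
    have rig: "rigid I w" using dominoed_two_starts[of ts w] w by (auto simp: rigid_def I_def)
    have "card (jumps w) \<le> 6 + 4 * card (active I w)"
      using card_jumps_le[OF rig] dense len by simp
    then show "w \<in> ?M \<union> ?F" using W rig by auto
  qed
  have "chains ?G (map int rs) B \<le> card {w. path B w ?G \<and> dominoed ts w}"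
    using ts(3) chains_le_dominoed[OF fin ts(1), of ?G] by linarith
  also have "\<dots> \<le> card (?M \<union> ?F)" using sub fin by (intro card_mono) auto
  also have "\<dots> \<le> card ?M + card ?F" by (rule card_Un_le)
  finally have "real (chains ?G (map int rs) B) \<le> real (card ?M) + real (card ?F)" by linarith
  also have "real (card ?F) \<le> real (s * (n + b)) ^ (14 + 40 * A)"
    using card_few_jumps[OF fin B(2) _ BM, of "6 + 20 * A"] B(3)
    by (simp flip: of_nat_power of_nat_mult of_nat_add)
  also have "real (card ?M) \<le> 5 * (6 / 7) ^ A * real (card (words B ?G))"
  proof -
    have "real (card ?M) = real (card ?M) * (7 / 6) ^ A * (6 / 7) ^ A"
      by (simp add: mult.assoc flip: power_mult_distrib)
    also have "\<dots> \<le> 5 * real (card (words B ?G)) * (6 / 7) ^ A"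
      using card_many_active[OF fin B(2,3), of I A] by (intro mult_right_mono) auto
    finally show ?thesis by (simp add: mult_ac)
  qed
  finally show ?thesis by simp
qed

text \<open>Under unit moves both sides satisfy the same recursion and the shape stays in the box,
  so a ratio valid for all shapes with \<open>s\<close> cells left passes to \<open>B\<close>. This
  is why fixed points are removed before the longer cycles.\<close>

lemma chains_fixed_points:
  assumes "boxed n b B" "\<Sum>B = \<Sum>(ground n) + int (a + s)"
    and bound: "\<And>C. boxed n b C \<Longrightarrow> \<Sum>C = \<Sum>(ground n) + int s \<Longrightarrow>
        real (chains (ground n) rs C) \<le> \<delta> * real (card (words C (ground n)))"
  shows "real (chains (ground n) (replicate a 1 @ rs) B) \<le> \<delta> * real (card (words B (ground n)))"
  using assms(1,2)
proof (induction a arbitrary: B)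
  case 0
  then show ?case using bound by simp
next
  case (Suc a)
  have fin: "finite B" using Suc.prems by (simp add: boxed_def)
  have "real (chains (ground n) (replicate (Suc a) 1 @ rs) B)
     = (\<Sum>x\<in>movable 1 B. real (chains (ground n) (replicate a 1 @ rs) (bead_move 1 x B)))" by simp
  also have "\<dots> \<le> (\<Sum>x\<in>movable 1 B. \<delta> * real (card (words (bead_move 1 x B) (ground n))))"
    using Suc boxed_move sum_bead_move[OF fin] by (intro sum_mono Suc.IH) auto
  also have "\<dots> = \<delta> * real (card (words B (ground n)))"
    using card_words_step[OF fin, of "ground n" "a + s"] Suc.prems(2) by (simp add: sum_distrib_left)
  finally show ?case .
qed

section \<open>Characters from the Frobenius formula\<close>

text \<open>Their number is the coefficient of \<open>x^\<alpha>\<close> in the product of power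
  sums for the cycles of \<open>g\<close> on \<open>A\<close>. The set \<open>A\<close> varies
  because cycles are removed one at a time, and \<open>\<alpha>\<close> takes integer values because
  exponents may become negative, in which case there is no colouring.\<close>

definition colourings :: "nat \<Rightarrow> nat set \<Rightarrow> (nat \<Rightarrow> nat) \<Rightarrow> (nat \<Rightarrow> int) \<Rightarrow> (nat \<Rightarrow> nat) set" where
  "colourings n A g \<alpha> = {f \<in> A \<rightarrow>\<^sub>E {0..<n}. (\<forall>i\<in>A. f (g i) = f i) \<and> (\<forall>j<n. int (card {i\<in>A. f i = j}) = \<alpha> j)}"

text \<open>The coefficient of \<open>x\<^sup>L\<close> in \<open>a\<^sub>\<delta>\<close> times the power sum of the cycle type of \<open>g\<close> on \<open>A\<close>.\<close>
definition alternant :: "nat \<Rightarrow> nat set \<Rightarrow> (nat \<Rightarrow> nat) \<Rightarrow> (nat \<Rightarrow> int) \<Rightarrow> int" where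
  "alternant n A g L = (\<Sum>w\<in>perms n. sign w * int (card (colourings n A g (\<lambda>j. L j - int (n - 1 - w j)))))"

definition beta_numbers :: "nat \<Rightarrow> nat list \<Rightarrow> nat \<Rightarrow> int" where
  "beta_numbers n \<nu> j = int (part_at \<nu> j) + int (n - 1 - j)"

lemma irr_char_alternant: "irr_char n \<nu> g = alternant n {0..<n} g (beta_numbers n \<nu>)"
  unfolding irr_char_def alternant_def colourings_def beta_numbers_def
  by (intro sum.cong refl arg_cong2[where f = "(*)"] arg_cong[where f = int] arg_cong[where f = card]) auto

lemma colourings_cong: "(\<And>j. j < n \<Longrightarrow> \<alpha> j = \<beta> j) \<Longrightarrow> colourings n A g \<alpha> = colourings n A g \<beta>"
  unfolding colourings_def by auto

text \<open>Transitivity is expressed by invariant functions: every colouring invariant under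
  \<open>g\<close> is constant on \<open>C\<close>, which is the form in which it is used.\<close>

definition is_orbit :: "(nat \<Rightarrow> nat) \<Rightarrow> nat set \<Rightarrow> bool" where
  "is_orbit g C \<longleftrightarrow> finite C \<and> C \<noteq> {} \<and> g ` C = C \<and>
     (\<forall>f::nat \<Rightarrow> nat. (\<forall>i\<in>C. f (g i) = f i) \<longrightarrow> (\<forall>i\<in>C. \<forall>j\<in>C. f i = f j))"

lemma finite_colourings: "finite A \<Longrightarrow> finite (colourings n A g \<alpha>)"
  unfolding colourings_def by (rule finite_subset[of _ "A \<rightarrow>\<^sub>E {0..<n}"]) (auto intro: finite_PiE)

text \<open>Extracts the factor \<open>x_0^r + ... + x_(n-1)^r\<close> with
  \<open>r = card C\<close>: a colouring takes one colour \<open>p\<close> on the orbit, and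
  forgetting the orbit lowers the exponent of \<open>p\<close> by \<open>r\<close>.\<close>

lemma card_colourings_orbit:
  assumes A: "finite A" "inj g" "g ` A = A" and C: "is_orbit g C" "C \<subseteq> A"
  shows "card (colourings n A g \<alpha>) = (\<Sum>p<n. card (colourings n (A - C) g (\<alpha>(p := \<alpha> p - int (card C)))))"
proof -
  define e where "e p f = (\<lambda>i. if i \<in> C then p else f i)" for p and f :: "nat \<Rightarrow> nat"
  let ?S = "\<lambda>p. colourings n (A - C) g (\<alpha>(p := \<alpha> p - int (card C)))"
  have finC: "finite C" and C0: "C \<noteq> {}" and gC: "g ` C = C" using C by (auto simp: is_orbit_def)
  have gi: "g i \<in> C \<longleftrightarrow> i \<in> C" for i using gC A(2) by (metis inj_image_mem_iff)
  have gA: "g i \<in> A" if "i \<in> A" for i using A(3) that by blast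
  have fibre: "card {i\<in>A. f i = j} = card {i\<in>A - C. f i = j} + (if j = p then card C else 0)"
    if "\<And>i. i \<in> C \<Longrightarrow> f i = p" for f :: "nat \<Rightarrow> nat" and p j
  proof -
    have "{i\<in>A. f i = j} = {i\<in>A - C. f i = j} \<union> (if j = p then C else {})"
      using that C(2) by auto
    also have "card \<dots> = card {i\<in>A - C. f i = j} + card (if j = p then C else {})"
      using A finC by (intro card_Un_disjoint) auto
    finally show ?thesis by simp
  qed
  have eq: "colourings n A g \<alpha> = (\<Union>p<n. e p ` ?S p)"
  proof (intro set_eqI iffI)
    fix f assume f: "f \<in> colourings n A g \<alpha>"
    obtain c where c: "c \<in> C" using C0 by blast
    define p where "p = f c"
    have const: "f i = p" if "i \<in> C" for i
    proof -
      have "\<forall>i\<in>C. f (g i) = f i" using f C(2) by (auto simp: colourings_def)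
      then show ?thesis using C(1) that c unfolding is_orbit_def p_def by blast
    qed
    have pn: "p < n" using f c C(2) by (auto simp: colourings_def p_def PiE_iff)
    define f' where "f' = restrict f (A - C)"
    have card': "card {i\<in>A - C. f' i = j} = card {i\<in>A - C. f i = j}" for j
      by (intro arg_cong[where f = card]) (auto simp: f'_def)
    have f'in: "f' \<in> (A - C) \<rightarrow>\<^sub>E {0..<n}" using f unfolding f'_def colourings_def by auto
    have f'inv: "\<forall>i\<in>A - C. f' (g i) = f' i" using f gi gA by (simp add: f'_def colourings_def)
    have "int (card {i\<in>A - C. f' i = j}) = (\<alpha>(p := \<alpha> p - int (card C))) j" if "j < n" for j
    proof -
      have "int (card {i\<in>A. f i = j}) = \<alpha> j" using f that by (simp add: colourings_def)
      moreover have "card {i\<in>A. f i = j} = card {i\<in>A - C. f i = j} + (if j = p then card C else 0)"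
        by (rule fibre) (rule const)
      ultimately show ?thesis unfolding card' by (simp split: if_splits)
    qed
    then have "f' \<in> ?S p" using f'in f'inv by (simp add: colourings_def)
    moreover have "f = e p f'"
      using f const by (auto simp: e_def f'_def fun_eq_iff colourings_def PiE_iff extensional_def)
    ultimately show "f \<in> (\<Union>p<n. e p ` ?S p)" using pn by blast
  next
    fix f assume "f \<in> (\<Union>p<n. e p ` ?S p)"
    then obtain p f' where p: "p < n" "f' \<in> ?S p" "f = e p f'" by auto
    have const: "f i = p" if "i \<in> C" for i using that p by (simp add: e_def)
    have card': "card {i\<in>A - C. f i = j} = card {i\<in>A - C. f' i = j}" for j
      using p by (intro arg_cong[where f = card]) (auto simp: e_def)
    have "f \<in> A \<rightarrow>\<^sub>E {0..<n}" using p C(2) by (auto simp: e_def colourings_def PiE_iff extensional_def)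
    moreover have "\<forall>i\<in>A. f (g i) = f i" using p gi by (auto simp: e_def colourings_def)
    moreover have "int (card {i\<in>A. f i = j}) = \<alpha> j" if "j < n" for j
    proof -
      have "int (card {i\<in>A - C. f' i = j}) = (\<alpha>(p := \<alpha> p - int (card C))) j"
        using p(2) that by (simp add: colourings_def)
      moreover have "card {i\<in>A. f i = j} = card {i\<in>A - C. f i = j} + (if j = p then card C else 0)"
        by (rule fibre) (rule const)
      ultimately show ?thesis unfolding card' by (simp split: if_splits)
    qed
    ultimately show "f \<in> colourings n A g \<alpha>" by (simp add: colourings_def)
  qed
  have inj: "inj_on (e p) (?S p)" for p
  proof (rule inj_onI)
    fix f h assume fh: "f \<in> ?S p" "h \<in> ?S p" "e p f = e p h"
    have "f i = h i" for i
    proof (cases "i \<in> A - C")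
      case True
      then show ?thesis using fun_cong[OF fh(3), of i] by (simp add: e_def)
    next
      case False
      have "f \<in> extensional (A - C)" "h \<in> extensional (A - C)" using fh(1,2) by (auto simp: colourings_def PiE_iff)
      then show ?thesis using False by (metis extensional_arb)
    qed
    then show "f = h" by blast
  qed
  have disj: "e p ` ?S p \<inter> e q ` ?S q = {}" if "p \<noteq> q" for p q
  proof -
    obtain c where "c \<in> C" using C0 by blast
    then have "e p f c = p" "e q f c = q" for f by (simp_all add: e_def)
    then have "e p f \<noteq> e q h" for f h using that by metis
    then show ?thesis by blast
  qed
  have "card (colourings n A g \<alpha>) = (\<Sum>p<n. card (e p ` ?S p))"
    unfolding eq using A finite_colourings disj by (intro card_UN_disjoint) auto
  also have "\<dots> = (\<Sum>p<n. card (?S p))" using inj by (intro sum.cong refl card_image)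
  finally show ?thesis .
qed

lemma alternant_orbit:
  assumes "finite A" "inj g" "g ` A = A" "is_orbit g C" "C \<subseteq> A"
  shows "alternant n A g L = (\<Sum>p<n. alternant n (A - C) g (L(p := L p - int (card C))))"
proof -
  have "alternant n A g L = (\<Sum>w\<in>perms n. \<Sum>p<n. sign w * int (card (colourings n (A - C) g 
      (\<lambda>j. (L(p := L p - int (card C))) j - int (n - 1 - w j)))))"
    unfolding alternant_def card_colourings_orbit[OF assms] of_nat_sum sum_distrib_left
    by (intro sum.cong refl arg_cong2[where f = "(*)"] arg_cong[where f = int] 
       arg_cong[where f = card] colourings_cong) auto
  also have "\<dots> = (\<Sum>p<n. alternant n (A - C) g (L(p := L p - int (card C))))"
    unfolding alternant_def by (rule sum.swap)
  finally show ?thesis .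
qed

lemma finite_perms [simp]: "finite (perms n)"
  unfolding perms_def by (rule finite_permutations) simp

lemma card_colourings_permute:
  assumes A: "finite A" "g ` A \<subseteq> A" and \<tau>: "\<tau> permutes {0..<n}"
  shows "card (colourings n A g (\<alpha> \<circ> \<tau>)) \<le> card (colourings n A g \<alpha>)"
proof (rule card_inj_on_le[of "\<lambda>f. restrict (\<tau> \<circ> f) A"])
  show "inj_on (\<lambda>f. restrict (\<tau> \<circ> f) A) (colourings n A g (\<alpha> \<circ> \<tau>))"
  proof (rule inj_onI)
    fix f h assume fh: "f \<in> colourings n A g (\<alpha> \<circ> \<tau>)" "h \<in> colourings n A g (\<alpha> \<circ> \<tau>)"
      and eq: "restrict (\<tau> \<circ> f) A = restrict (\<tau> \<circ> h) A"
    have "f i = h i" for i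
    proof (cases "i \<in> A")
      case True
      then have "\<tau> (f i) = \<tau> (h i)" using fun_cong[OF eq, of i] by simp
      then show ?thesis using \<tau> by (meson injD permutes_inj)
    next
      case False
      have "f \<in> extensional A" "h \<in> extensional A" using fh by (auto simp: colourings_def PiE_iff)
      then show ?thesis using False by (metis extensional_arb)
    qed
    then show "f = h" by blast
  qed
  show "(\<lambda>f. restrict (\<tau> \<circ> f) A) ` colourings n A g (\<alpha> \<circ> \<tau>) \<subseteq> colourings n A g \<alpha>"
  proof
    fix h assume "h \<in> (\<lambda>f. restrict (\<tau> \<circ> f) A) ` colourings n A g (\<alpha> \<circ> \<tau>)"
    then obtain f where f: "f \<in> colourings n A g (\<alpha> \<circ> \<tau>)" and h: "h = restrict (\<tau> \<circ> f) A" by blast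
    have lt: "\<tau> j < n" if "j < n" for j using permutes_in_image[OF \<tau>, of j] that by simp
    have "h \<in> A \<rightarrow>\<^sub>E {0..<n}" using f lt by (auto simp: h colourings_def PiE_iff)
    moreover have "\<forall>i\<in>A. g i \<in> A \<and> f (g i) = f i" using f A(2) by (auto simp: colourings_def)
    then have "\<forall>i\<in>A. h (g i) = h i" by (simp add: h)
    moreover have "int (card {i\<in>A. h i = j}) = \<alpha> j" if "j < n" for j
    proof -
      obtain j' where j': "j' < n" "\<tau> j' = j"
        using \<open>j < n\<close> permutes_image[OF \<tau>] by (metis atLeastLessThan_iff imageE zero_le)
      have "\<tau> (f i) = j \<longleftrightarrow> f i = j'" for i
        using inj_eq[OF permutes_inj[OF \<tau>], of "f i" j'] unfolding j'(2) .
      then have "{i\<in>A. h i = j} = {i\<in>A. f i = j'}" by (simp add: h cong: conj_cong)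
      moreover have "int (card {i\<in>A. f i = j'}) = \<alpha> (\<tau> j')" using f j'(1) by (simp add: colourings_def)
      ultimately show ?thesis using j'(2) by simp
    qed
    ultimately show "h \<in> colourings n A g \<alpha>" by (simp add: colourings_def)
  qed
  show "finite (colourings n A g \<alpha>)" using A by (intro finite_colourings)
qed

text \<open>As for a determinant with two equal columns: composing \<open>w\<close> with the
  transposition reverses the sign and keeps the number of colourings.\<close>

lemma alternant_repeated:
  assumes A: "finite A" "g ` A \<subseteq> A" and ij: "i < n" "j < n" "i \<noteq> j" "L i = L j"
  shows "alternant n A g L = 0"
proof -
  let ?\<tau> = "transpose i j"
  let ?F = "\<lambda>w. int (card (colourings n A g (\<lambda>j. L j - int (n - 1 - w j))))"
  have \<tau>: "?\<tau> permutes {0..<n}" using ij by (intro permutes_swap_id) auto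
  have L\<tau>: "L (?\<tau> a) = L a" for a using ij by (simp add: transpose_def)
  have F\<tau>: "?F (w \<circ> ?\<tau>) = ?F w" for w
  proof -
    let ?a = "\<lambda>j. L j - int (n - 1 - w j)" and ?b = "\<lambda>j. L j - int (n - 1 - (w \<circ> ?\<tau>) j)"
    have "?b = ?a \<circ> ?\<tau>" "?a = ?b \<circ> ?\<tau>" by (auto simp: L\<tau>)
    then show ?thesis
      using card_colourings_permute[OF A \<tau>, of ?a] card_colourings_permute[OF A \<tau>, of ?b] by simp
  qed
  have bij: "bij_betw (\<lambda>w. w \<circ> ?\<tau>) (perms n) (perms n)"
    unfolding perms_def by (rule bij_betw_byWitness[of _ "\<lambda>w. w \<circ> ?\<tau>"])
      (auto simp: o_assoc[symmetric] intro: permutes_compose[OF \<tau>])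
  have "sign (w \<circ> ?\<tau>) = - sign w" if "w \<in> perms n" for w
  proof -
    have "permutation w" using that permutation_permutes unfolding perms_def by blast
    moreover have "permutation ?\<tau>" by (rule permutation_swap_id)
    ultimately show ?thesis using ij(3) by (simp add: sign_compose sign_swap_id)
  qed
  then have "(\<Sum>w\<in>perms n. sign (w \<circ> ?\<tau>) * ?F (w \<circ> ?\<tau>)) = (\<Sum>w\<in>perms n. - (sign w * ?F w))"
    unfolding F\<tau> by (intro sum.cong refl) simp
  moreover have "(\<Sum>w\<in>perms n. sign (w \<circ> ?\<tau>) * ?F (w \<circ> ?\<tau>)) = (\<Sum>w\<in>perms n. sign w * ?F w)"
    by (rule sum.reindex_bij_betw[OF bij])
  ultimately have "(\<Sum>w\<in>perms n. sign w * ?F w) = - (\<Sum>w\<in>perms n. sign w * ?F w)"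
    by (simp add: sum_negf)
  then show ?thesis unfolding alternant_def by linarith
qed

lemma alternant_negative:
  assumes "j < n" "L j < 0"
  shows "alternant n A g L = 0"
proof -
  have "colourings n A g (\<lambda>j. L j - int (n - 1 - w j)) = {}" for w
  proof -
    have "f \<notin> colourings n A g (\<lambda>j. L j - int (n - 1 - w j))" for f
      using assms unfolding colourings_def by (auto intro!: exI[of _ j])
    then show ?thesis by blast
  qed
  then show ?thesis by (simp add: alternant_def)
qed

lemma colourings_empty:
  "colourings n {} g \<alpha> = (if \<forall>j<n. \<alpha> j = 0 then {\<lambda>_. undefined} else {})"
  unfolding colourings_def by auto

lemma ground_reflect: "w permutes {0..<n} \<Longrightarrow> (\<lambda>j. int (n - 1 - w j)) ` {0..<n} = ground n"
proof -
  assume w: "w permutes {0..<n}"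
  have "(\<lambda>j. int (n - 1 - w j)) ` {0..<n} = (\<lambda>j. int (n - 1 - j)) ` w ` {0..<n}" by (simp add: image_image)
  also have "\<dots> = ground n" unfolding permutes_image[OF w]
  proof (intro set_eqI iffI)
    fix x assume "x \<in> ground n"
    then show "x \<in> (\<lambda>j. int (n - 1 - j)) ` {0..<n}" by (intro image_eqI[of _ _ "n - 1 - nat x"]) auto
  qed auto
  finally show ?thesis .
qed

lemma alternant_empty_abs:
  "\<bar>alternant n {} g L\<bar> \<le> int (chains (ground n) [] (L ` {0..<n}))"
proof -
  let ?W = "{w \<in> perms n. \<forall>j<n. L j = int (n - 1 - w j)}"
  have "alternant n {} g L = (\<Sum>w\<in>perms n. if \<forall>j<n. L j = int (n - 1 - w j) then sign w else 0)"
    unfolding alternant_def colourings_empty by (intro sum.cong refl) auto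
  also have "\<dots> = (\<Sum>w\<in>?W. sign w)" by (rule sum.inter_filter[symmetric]) simp
  finally have eq: "alternant n {} g L = (\<Sum>w\<in>?W. sign w)" .
  show ?thesis
  proof (cases "?W = {}")
    case True show ?thesis unfolding eq True by simp
  next
    case False
    then obtain w where w: "w \<in> ?W" by blast
    have "v = w" if v: "v \<in> ?W" for v
    proof
      fix j
      show "v j = w j"
      proof (cases "j < n")
        case True
        have "v j < n" "w j < n"
          using v w True permutes_in_image[of v "{0..<n}" j] permutes_in_image[of w "{0..<n}" j]
          by (auto simp: perms_def)
        moreover have "n - 1 - v j = n - 1 - w j" using v w True by auto
        ultimately show ?thesis by linarith
      next
        case False
        then show ?thesis using v w permutes_not_in[of v "{0..<n}" j] permutes_not_in[of w "{0..<n}" j]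
          by (auto simp: perms_def)
      qed
    qed
    then have W: "?W = {w}" using w by blast
    have "L ` {0..<n} = (\<lambda>j. int (n - 1 - w j)) ` {0..<n}" using w by (intro image_cong) auto
    then have "L ` {0..<n} = ground n" using w ground_reflect[of w n] by (simp add: perms_def)
    then show ?thesis unfolding eq W by (simp add: sign_def)
  qed
qed

lemma alternant_empty_eq:
  "alternant n {} g (\<lambda>j. int (n - 1 - j)) = 1"
proof -
  let ?W = "{w \<in> perms n. \<forall>j<n. int (n - 1 - j) = int (n - 1 - w j)}"
  have "alternant n {} g (\<lambda>j. int (n - 1 - j)) = (\<Sum>w\<in>perms n. if \<forall>j<n. int (n - 1 - j) = int (n - 1 - w j) then sign w else 0)"
    unfolding alternant_def colourings_empty by (intro sum.cong refl) auto
  also have "\<dots> = (\<Sum>w\<in>?W. sign w)" by (rule sum.inter_filter[symmetric]) simp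
  also have "?W = {id}"
  proof (intro set_eqI iffI)
    fix w assume w: "w \<in> ?W"
    have "w j = j" for j
    proof (cases "j < n")
      case True
      have "w j < n" using w True permutes_in_image[of w "{0..<n}" j] by (auto simp: perms_def)
      moreover have "n - 1 - j = n - 1 - w j" using w True by auto
      ultimately show ?thesis using True by linarith
    qed (use w permutes_not_in[of w "{0..<n}" j] in \<open>auto simp: perms_def\<close>)
    then show "w \<in> {id}" by auto
  qed (auto simp: perms_def permutes_id)
  finally show ?thesis by simp
qed

section \<open>Bead moves for the cycles of a permutation\<close>

inductive cycle_lengths :: "(nat \<Rightarrow> nat) \<Rightarrow> nat set \<Rightarrow> nat list \<Rightarrow> bool" for g where
  Nil: "cycle_lengths g {} []"
| Cons: "is_orbit g C \<Longrightarrow> C \<subseteq> A \<Longrightarrow> finite A \<Longrightarrow> g ` A = A \<Longrightarrow> cycle_lengths g (A - C) rs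
    \<Longrightarrow> cycle_lengths g A (card C # rs)"

lemma fun_upd_image: "inj_on L A \<Longrightarrow> p \<in> A \<Longrightarrow> (L(p := y)) ` A = insert y (L ` A - {L p})"
  by (auto simp: inj_on_def)

text \<open>The Murnaghan-Nakayama rule with the signs dropped.\<close>
lemma alternant_abs_le_chains:
  assumes "cycle_lengths g A rs" "inj g" "inj_on L {0..<n}" "\<forall>j<n. 0 \<le> L j"
  shows "\<bar>alternant n A g L\<bar> \<le> int (chains (ground n) (map int rs) (L ` {0..<n}))"
  using assms
proof (induction arbitrary: L rule: cycle_lengths.induct)
  case Nil
  then show ?case using alternant_empty_abs by simp
next
  case (Cons C A rs)
  let ?r = "int (card C)" and ?B = "L ` {0..<n}"
  let ?L = "\<lambda>p. L(p := L p - ?r)"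
  have r: "0 < ?r" using Cons.hyps(1) by (auto simp: is_orbit_def card_gt_0_iff)
  have AC: "finite (A - C)" "g ` (A - C) \<subseteq> A - C"
  proof -
    show "finite (A - C)" using Cons.hyps by simp
    have "g ` (A - C) = g ` A - g ` C" by (rule image_set_diff[OF Cons.prems(1)])
    then show "g ` (A - C) \<subseteq> A - C" using Cons.hyps by (simp add: is_orbit_def)
  qed
  let ?P = "{p \<in> {..<n}. L p \<in> movable ?r ?B}"
  \<comment> \<open>Lowering \<open>L p\<close> by \<open>r\<close> is a bead move unless the result
    is negative or already occupied; in both cases the alternant vanishes.\<close>
  have zero: "alternant n (A - C) g (?L p) = 0" if p: "p < n" "L p \<notin> movable ?r ?B" for p
  proof (cases "?r \<le> L p")
    case False
    then show ?thesis using p by (intro alternant_negative[of p]) auto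
  next
    case True
    then obtain q where q: "q < n" "L q = L p - ?r" using p by (auto simp: movable_def)
    then have "q \<noteq> p" using r by auto
    then show ?thesis using p q by (intro alternant_repeated[OF AC, of p n q]) auto
  qed
  have bound: "\<bar>alternant n (A - C) g (?L p)\<bar> \<le> int (chains (ground n) (map int rs) (bead_move ?r (L p) ?B))"
    if p: "p \<in> ?P" for p
  proof -
    have notin: "L p - ?r \<notin> ?B" "?r \<le> L p" using p by (auto simp: movable_def)
    have inj': "inj_on (?L p) {0..<n}"
    proof (rule inj_onI)
      fix i j assume ij: "i \<in> {0..<n}" "j \<in> {0..<n}" "(?L p) i = (?L p) j"
      have "L i \<noteq> L p - ?r" "L j \<noteq> L p - ?r" using notin ij by force+
      then show "i = j" using ij inj_onD[OF Cons.prems(2)] by (auto split: if_splits)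
    qed
    have im: "(?L p) ` {0..<n} = bead_move ?r (L p) ?B"
      unfolding bead_move_def by (rule fun_upd_image[OF Cons.prems(2)]) (use p in simp)
    have "\<forall>j<n. 0 \<le> (?L p) j" using Cons.prems(3) notin by simp
    from Cons.IH[OF Cons.prems(1) inj' this] show ?thesis unfolding im .
  qed
  have bij: "bij_betw L ?P (movable ?r ?B)"
    using Cons.prems(2) by (auto simp: bij_betw_def inj_on_def movable_def)
  have "\<bar>alternant n A g L\<bar> \<le> (\<Sum>p<n. \<bar>alternant n (A - C) g (?L p)\<bar>)"
    using alternant_orbit[of A g C n L] Cons.hyps Cons.prems(1) by (simp add: sum_abs)
  also have "\<dots> = (\<Sum>p\<in>?P. \<bar>alternant n (A - C) g (?L p)\<bar>)"
    using zero by (intro sum.mono_neutral_right) auto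
  also have "\<dots> \<le> (\<Sum>p\<in>?P. int (chains (ground n) (map int rs) (bead_move ?r (L p) ?B)))"
    by (intro sum_mono bound)
  also have "\<dots> = (\<Sum>x\<in>movable ?r ?B. int (chains (ground n) (map int rs) (bead_move ?r x ?B)))"
    by (rule sum.reindex_bij_betw[OF bij])
  finally show ?case by simp
qed

lemma decreasing_inj:
  fixes L :: "nat \<Rightarrow> int"
  assumes "\<And>i j. i < j \<Longrightarrow> j < n \<Longrightarrow> L j < L i"
  shows "inj_on L {0..<n}"
proof (rule linorder_inj_onI')
  fix i j assume "i \<in> {0..<n}" "j \<in> {0..<n}" "i < j"
  then show "L i \<noteq> L j" using assms[of i j] by simp
qed

lemma decreasing_ground:
  fixes L :: "nat \<Rightarrow> int"
  assumes dec: "\<And>i j. i < j \<Longrightarrow> j < n \<Longrightarrow> L j < L i" and nn: "\<And>j. j < n \<Longrightarrow> 0 \<le> L j" and "j < n"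
  shows "int (n - 1 - j) \<le> L j"
  using \<open>j < n\<close>
proof (induction "n - 1 - j" arbitrary: j)
  case 0
  then show ?case using nn by simp
next
  case (Suc m)
  have "int (n - 1 - Suc j) \<le> L (Suc j)" using Suc by (intro Suc.hyps(1)) auto
  moreover have "L (Suc j) < L j" using dec[of j "Suc j"] Suc by auto
  ultimately show ?case using Suc by linarith
qed

text \<open>A bead moved by one step passes no other bead, so \<open>L\<close> stays strictly
  decreasing and the only permutation left at the end is the identity. Hence no sign occurs and the
  bound becomes an equality; this evaluates the character at the identity.\<close>

lemma alternant_unit_steps:
  assumes "cycle_lengths g A rs" "inj g" "set rs \<subseteq> {1}"
    "\<And>i j. i < j \<Longrightarrow> j < n \<Longrightarrow> L j < L i" "\<And>j. j < n \<Longrightarrow> 0 \<le> L j"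
  shows "alternant n A g L = int (chains (ground n) (map int rs) (L ` {0..<n}))"
  using assms
proof (induction arbitrary: L rule: cycle_lengths.induct)
  case Nil
  show ?case
  proof (cases "L ` {0..<n} = ground n")
    case False
    then show ?thesis using alternant_empty_abs[of n g L] by simp
  next
    case True
    have inj: "inj_on L {0..<n}" using Nil.prems(3) by (rule decreasing_inj)
    have le: "int (n - 1 - j) \<le> L j" if "j < n" for j
      using decreasing_ground[of n L] Nil.prems that by blast
    \<comment> \<open>Termwise \<open>L j \<ge> n - 1 - j\<close>, so equality of the sums forces
      equality of the sequences.\<close>
    have "(\<Sum>j\<in>{0..<n}. L j) = (\<Sum>j\<in>{0..<n}. int (n - 1 - j))"
    proof -
      have "(\<Sum>j\<in>{0..<n}. L j) = \<Sum>(L ` {0..<n})" using inj by (simp add: sum.reindex)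
      also have "\<dots> = \<Sum>((\<lambda>j. int (n - 1 - j)) ` {0..<n})"
        using ground_reflect[of id n] True by (simp add: permutes_id)
      also have "\<dots> = (\<Sum>j\<in>{0..<n}. int (n - 1 - j))"
        by (subst sum.reindex) (auto simp: inj_on_def)
      finally show ?thesis .
    qed
    then have eq: "L j = int (n - 1 - j)" if "j < n" for j
      using sum_mono_inv[of "\<lambda>j. int (n - 1 - j)" "{0..<n}" L j] le that by auto
    have "alternant n {} g L = alternant n {} g (\<lambda>j. int (n - 1 - j))"
      unfolding alternant_def
      by (intro sum.cong refl arg_cong2[where f = "(*)"] arg_cong[where f = int] 
        arg_cong[where f = card] colourings_cong) (simp add: eq)
    then show ?thesis using True alternant_empty_eq by simp
  qed
next
  case (Cons C A rs)
  have r: "card C = 1" using Cons.prems by simp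
  let ?B = "L ` {0..<n}"
  let ?L = "\<lambda>p. L(p := L p - 1)"
  have inj: "inj_on L {0..<n}" using Cons.prems(3) by (rule decreasing_inj)
  have AC: "finite (A - C)" "g ` (A - C) \<subseteq> A - C"
  proof -
    show "finite (A - C)" using Cons.hyps by simp
    have "g ` (A - C) = g ` A - g ` C" by (rule image_set_diff[OF Cons.prems(1)])
    then show "g ` (A - C) \<subseteq> A - C" using Cons.hyps by (simp add: is_orbit_def)
  qed
  let ?P = "{p \<in> {..<n}. L p \<in> movable 1 ?B}"
  have zero: "alternant n (A - C) g (?L p) = 0" if p: "p < n" "L p \<notin> movable 1 ?B" for p
  proof (cases "1 \<le> L p")
    case False
    then show ?thesis using p by (intro alternant_negative[of p]) auto
  next
    case True
    then obtain q where q: "q < n" "L q = L p - 1" using p by (auto simp: movable_def)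
    then have "q \<noteq> p" by auto
    then show ?thesis using p q by (intro alternant_repeated[OF AC, of p n q]) auto
  qed
  have step: "alternant n (A - C) g (?L p) = int (chains (ground n) (map int rs) (bead_move 1 (L p) ?B))"
    if p: "p \<in> ?P" for p
  proof -
    have notin: "L p - 1 \<notin> ?B" "1 \<le> L p" using p by (auto simp: movable_def)
    have "(?L p) j < (?L p) i" if ij: "i < j" "j < n" for i j
    proof -
      have "L j \<noteq> L p - 1" using notin ij by force
      then show ?thesis using Cons.prems(3)[OF ij] by auto
    qed
    moreover have "0 \<le> (?L p) j" if "j < n" for j using Cons.prems(4)[OF that] notin by simp
    moreover have im: "(?L p) ` {0..<n} = bead_move 1 (L p) ?B"
      unfolding bead_move_def by (rule fun_upd_image[OF inj]) (use p in simp)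
    moreover have "set rs \<subseteq> {1}" using Cons.prems(2) by simp
    ultimately show ?thesis using Cons.IH[OF Cons.prems(1), of "?L p"] unfolding im by blast
  qed
  have bij: "bij_betw L ?P (movable 1 ?B)"
    using inj by (auto simp: bij_betw_def inj_on_def movable_def)
  have "alternant n A g L = (\<Sum>p<n. alternant n (A - C) g (?L p))"
    using alternant_orbit[of A g C n L] Cons.hyps Cons.prems(1) r by simp
  also have "\<dots> = (\<Sum>p\<in>?P. alternant n (A - C) g (?L p))"
    using zero by (intro sum.mono_neutral_right) auto
  also have "\<dots> = (\<Sum>p\<in>?P. int (chains (ground n) (map int rs) (bead_move 1 (L p) ?B)))"
    by (intro sum.cong refl step)
  also have "\<dots> = (\<Sum>x\<in>movable 1 ?B. int (chains (ground n) (map int rs) (bead_move 1 x ?B)))"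
    by (rule sum.reindex_bij_betw[OF bij])
  finally show ?case using r by simp
qed

lemma orbit_exists:
  assumes "finite A" "inj g" "g ` A = A" "a \<in> A"
  shows "\<exists>C. is_orbit g C \<and> C \<subseteq> A \<and> a \<in> C"
proof -
  define C where "C = range (\<lambda>t. (g ^^ t) a)"
  have "(g ^^ t) a \<in> A" for t using assms by (induction t) auto
  then have CA: "C \<subseteq> A" by (auto simp: C_def)
  have fin: "finite C" using CA assms(1) finite_subset by blast
  have "g ` C \<subseteq> C"
  proof
    fix x assume "x \<in> g ` C"
    then obtain t where "x = (g ^^ Suc t) a" by (auto simp: C_def)
    then show "x \<in> C" unfolding C_def by blast
  qed
  then have gC: "g ` C = C" using fin assms(2) by (intro endo_inj_surj) (auto intro: inj_on_subset)
  have aC: "a \<in> C" unfolding C_def by (rule image_eqI[of _ _ 0]) auto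
  have const: "f i = f a" if "\<forall>i\<in>C. f (g i) = f i" "i \<in> C" for f :: "nat \<Rightarrow> nat" and i
  proof -
    have "f ((g ^^ t) a) = f a" for t
    proof (induction t)
      case (Suc t)
      have "(g ^^ t) a \<in> C" by (simp add: C_def)
      then show ?case using that(1) Suc by simp
    qed simp
    then show ?thesis using that(2) by (auto simp: C_def)
  qed
  have "is_orbit g C" unfolding is_orbit_def using fin aC gC const by (metis empty_iff)
  then show ?thesis using CA aC by blast
qed

text \<open>The order of the cycles is free. Fixed points are taken off as long as there are any, so
  that the ones precede the longer cycles, as \<open>chains_fixed_points\<close> requires.\<close>

lemma cycle_lengths_exist:
  assumes "finite A" "inj g" "g ` A = A"
  shows "\<exists>rs. cycle_lengths g A (replicate (card {i\<in>A. g i = i}) 1 @ rs) \<and> (\<forall>r\<in>set rs. 2 \<le> r)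
    \<and> sum_list rs = card {i\<in>A. g i \<noteq> i}"
  using assms
proof (induction "card A" arbitrary: A rule: less_induct)
  case less
  consider "A = {}" | a where "a \<in> A" "g a = a" | "A \<noteq> {}" "\<forall>i\<in>A. g i \<noteq> i" by blast
  then show ?case
  proof cases
    case 1
    then show ?thesis by (intro exI[of _ "[]"]) (auto intro: cycle_lengths.Nil)
  next
    case (2 a)
    have orb: "is_orbit g {a}" using 2 by (auto simp: is_orbit_def)
    have "g ` (A - {a}) = A - {a}" using image_set_diff[OF less.prems(2), of A "{a}"] less.prems(3) 2 by simp
    moreover have "card (A - {a}) < card A" using less.prems(1) 2 by (meson card_Diff1_less)
    ultimately obtain rs where rs: "cycle_lengths g (A - {a}) (replicate (card {i\<in>A - {a}. g i = i}) 1 @ rs)"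
       "\<forall>r\<in>set rs. 2 \<le> r" "sum_list rs = card {i\<in>A - {a}. g i \<noteq> i}"
      using less.hyps[of "A - {a}"] less.prems by auto
    have "{i\<in>A - {a}. g i \<noteq> i} = {i\<in>A. g i \<noteq> i}" using 2 by auto
    moreover have "{i\<in>A. g i = i} = insert a {i\<in>A - {a}. g i = i}" using 2 by auto
    then have "card {i\<in>A. g i = i} = Suc (card {i\<in>A - {a}. g i = i})" using less.prems(1) by simp
    ultimately show ?thesis
      using rs cycle_lengths.Cons[OF orb _ less.prems(1,3) rs(1)] 2 by (intro exI[of _ rs]) simp
  next
    case 3
    then obtain a where a: "a \<in> A" by blast
    obtain C where C: "is_orbit g C" "C \<subseteq> A" "a \<in> C" using orbit_exists[OF less.prems a] by blast
    have finC: "finite C" and gC: "g ` C = C" using C by (auto simp: is_orbit_def)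
    have "{a, g a} \<subseteq> C" using C gC by blast
    then have c2: "2 \<le> card C" using card_mono[OF finC, of "{a, g a}"] 3 a by auto
    have "g ` (A - C) = A - C" using image_set_diff[OF less.prems(2), of A C] less.prems(3) gC by simp
    moreover have "card (A - C) < card A" using less.prems(1) C a by (intro psubset_card_mono) auto
    ultimately obtain rs where rs: "cycle_lengths g (A - C) (replicate (card {i\<in>A - C. g i = i}) 1 @ rs)"
       "\<forall>r\<in>set rs. 2 \<le> r" "sum_list rs = card {i\<in>A - C. g i \<noteq> i}"
      using less.hyps[of "A - C"] less.prems by auto
    have no: "{i\<in>A. g i = i} = {}" "{i\<in>A - C. g i = i} = {}" "{i\<in>A. g i \<noteq> i} = A" "{i\<in>A - C. g i \<noteq> i} = A - C"
      using 3 by auto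
    have "card (A - C) = card A - card C" "card C \<le> card A"
      using C finC less.prems(1) by (auto simp: card_Diff_subset card_mono)
    then show ?thesis
      using rs cycle_lengths.Cons[OF C(1,2) less.prems(1,3) rs(1)] c2 unfolding no
      by (intro exI[of _ "card C # rs"]) auto
  qed
qed

section \<open>Standard Young tableaux\<close>

definition closed_diagram :: "(nat \<times> nat) set \<Rightarrow> bool" where
  "closed_diagram Y \<longleftrightarrow> finite Y \<and> (\<forall>i j. (i, j + 1) \<in> Y \<longrightarrow> (i, j) \<in> Y) \<and> (\<forall>i j. (i + 1, j) \<in> Y \<longrightarrow> (i, j) \<in> Y)"

text \<open>The set counted by \<open>num_syt\<close>, for an arbitrary set of cells, so that a
  corner can be deleted without renaming the shape.\<close>

definition tableaux :: "(nat \<times> nat) set \<Rightarrow> (nat \<times> nat \<Rightarrow> nat) set" where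
  "tableaux Y = {T \<in> Y \<rightarrow>\<^sub>E {1..card Y}. bij_betw T Y {1..card Y} \<and>
      (\<forall>i j. (i, j + 1) \<in> Y \<longrightarrow> T (i, j) < T (i, j + 1)) \<and>
      (\<forall>i j. (i + 1, j) \<in> Y \<longrightarrow> T (i, j) < T (i + 1, j))}"

definition corners :: "(nat \<times> nat) set \<Rightarrow> (nat \<times> nat) set" where
  "corners Y = {(i, j) \<in> Y. (i, j + 1) \<notin> Y \<and> (i + 1, j) \<notin> Y}"

lemma finite_tableaux: "finite Y \<Longrightarrow> finite (tableaux Y)"
  unfolding tableaux_def by (rule finite_subset[of _ "Y \<rightarrow>\<^sub>E {1..card Y}"]) (auto intro: finite_PiE)

lemma tableaux_remove:
  assumes Y: "closed_diagram Y" "card Y = Suc s" and c: "c \<in> corners Y"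
  shows "card {T \<in> tableaux Y. T c = Suc s} = card (tableaux (Y - {c}))"
proof -
  have fin: "finite Y" using Y(1) unfolding closed_diagram_def by blast
  have cY: "c \<in> Y" using c by (auto simp: corners_def)
  have cs: "card (Y - {c}) = s" using Y cY fin by simp
  have Yc: "insert c (Y - {c}) = Y" using cY by blast
  let ?e = "\<lambda>T. T(c := Suc s)"
  \<comment> \<open>Extensional functions are \<open>undefined\<close> outside their domain, so the
    inverse resets the value at the deleted cell to \<open>undefined\<close>.\<close>
  have "bij_betw ?e (tableaux (Y - {c})) {T \<in> tableaux Y. T c = Suc s}"
  proof (rule bij_betw_byWitness[of _ "\<lambda>T. T(c := undefined)"])
    show "\<forall>T\<in>tableaux (Y - {c}). (?e T)(c := undefined) = T"
      by (auto simp: tableaux_def PiE_iff extensional_def fun_eq_iff)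
    show "\<forall>T\<in>{T \<in> tableaux Y. T c = Suc s}. ?e (T(c := undefined)) = T" by (auto simp: fun_eq_iff)
    show "?e ` tableaux (Y - {c}) \<subseteq> {T \<in> tableaux Y. T c = Suc s}"
    proof
      fix T' assume "T' \<in> ?e ` tableaux (Y - {c})"
      then obtain T where T: "T \<in> tableaux (Y - {c})" and T': "T' = T(c := Suc s)" by blast
      have bT: "bij_betw T (Y - {c}) {1..s}" using T by (simp add: tableaux_def cs)
      have le: "T x < Suc s" if "x \<in> Y - {c}" for x
      proof -
        have "T x \<in> {1..s}" using bT that by (rule bij_betwE[THEN bspec])
        then show ?thesis by simp
      qed
      have "bij_betw T' (Y - {c}) {1..s}" using bT unfolding T' by (subst bij_betw_cong) auto
      then have "bij_betw T' (insert c (Y - {c})) (insert (T' c) {1..s})"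
        using notIn_Un_bij_betw[of c "Y - {c}" T' "{1..s}"] by (simp add: T')
      moreover have "insert (T' c) {1..s} = {1..Suc s}" by (auto simp: T')
      ultimately have b: "bij_betw T' Y {1..card Y}" by (simp only: Yc Y(2))
      have e: "T' \<in> Y \<rightarrow>\<^sub>E {1..card Y}" 
      proof (rule PiE_I)
        show "T' x \<in> {1..card Y}" if "x \<in> Y" for x using bij_betwE[OF b] that by blast
        show "T' x = undefined" if "x \<notin> Y" for x
          using that T cY PiE_arb[of T "Y - {c}" _ x] unfolding T' tableaux_def by auto
      qed
      have row: "T' (i, j) < T' (i, j + 1)" if "(i, j + 1) \<in> Y" for i j
      proof -
        have ij: "(i, j) \<in> Y" using Y(1) that unfolding closed_diagram_def by blast
        have ne: "(i, j) \<noteq> c" using c that by (auto simp: corners_def)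
        then have lt: "T (i, j) < Suc s" using le ij by blast
        have "T (i, j) < T (i, j + 1)" if "(i, j + 1) \<noteq> c"
          using T that \<open>(i, j + 1) \<in> Y\<close> unfolding tableaux_def by blast
        then show ?thesis using ne lt unfolding T' fun_upd_apply by presburger
      qed
      have col: "T' (i, j) < T' (i + 1, j)" if "(i + 1, j) \<in> Y" for i j
      proof -
        have ij: "(i, j) \<in> Y" using Y(1) that unfolding closed_diagram_def by blast
        have ne: "(i, j) \<noteq> c" using c that by (auto simp: corners_def)
        then have lt: "T (i, j) < Suc s" using le ij by blast
        have "T (i, j) < T (i + 1, j)" if "(i + 1, j) \<noteq> c"
          using T that \<open>(i + 1, j) \<in> Y\<close> unfolding tableaux_def by blast
        then show ?thesis using ne lt unfolding T' fun_upd_apply by presburger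
      qed
      show "T' \<in> {T \<in> tableaux Y. T c = Suc s}"
      proof -
        have "T' \<in> tableaux Y" using b e row col unfolding tableaux_def by blast
        moreover have "T' c = Suc s" by (simp add: T')
        ultimately show ?thesis by blast
      qed
    qed
    show "(\<lambda>T. T(c := undefined)) ` {T \<in> tableaux Y. T c = Suc s} \<subseteq> tableaux (Y - {c})"
    proof
      fix T' assume "T' \<in> (\<lambda>T. T(c := undefined)) ` {T \<in> tableaux Y. T c = Suc s}"
      then obtain T where T: "T \<in> tableaux Y" "T c = Suc s" and T': "T' = T(c := undefined)" by blast
      have bT: "bij_betw T Y {1..Suc s}" using T Y(2) by (simp add: tableaux_def)
      have "bij_betw T (Y - {c}) ({1..Suc s} - {T c})" using bij_betw_DiffI[OF bT, of "{c}" "{T c}"] cY T by auto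
      moreover have "{1..Suc s} - {T c} = {1..s}" using T(2) by auto
      ultimately have b: "bij_betw T' (Y - {c}) {1..s}" unfolding T' by (subst bij_betw_cong[of _ _ T]) auto
      have e: "T' \<in> (Y - {c}) \<rightarrow>\<^sub>E {1..s}"
      proof (rule PiE_I)
        show "T' x \<in> {1..s}" if "x \<in> Y - {c}" for x using bij_betwE[OF b] that by blast
        show "T' x = undefined" if "x \<notin> Y - {c}" for x
          using that T(1) PiE_arb[of T Y _ x] unfolding T' tableaux_def by auto
      qed
      have row: "T' (i, j) < T' (i, j + 1)" if "(i, j + 1) \<in> Y - {c}" for i j
        using that c T(1) by (auto simp: T' corners_def tableaux_def)
      have col: "T' (i, j) < T' (i + 1, j)" if "(i + 1, j) \<in> Y - {c}" for i j
        using that c T(1) by (auto simp: T' corners_def tableaux_def)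
      show "T' \<in> tableaux (Y - {c})" using b e row col unfolding tableaux_def cs by blast
    qed
  qed
  from bij_betw_same_card[OF this] show ?thesis by (rule sym)
qed

lemma tableaux_branching:
  assumes Y: "closed_diagram Y" "card Y = Suc s"
  shows "card (tableaux Y) = (\<Sum>c\<in>corners Y. card (tableaux (Y - {c})))"
proof -
  have fin: "finite Y" using Y(1) unfolding closed_diagram_def by blast
  have finc: "finite (corners Y)" by (rule finite_subset[OF _ fin]) (auto simp: corners_def)
  have "tableaux Y = (\<Union>c\<in>corners Y. {T \<in> tableaux Y. T c = Suc s})"
  proof (intro set_eqI iffI)
    fix T assume T: "T \<in> tableaux Y"
    then have bT: "bij_betw T Y {1..Suc s}" using Y by (simp add: tableaux_def)
    have "Suc s \<in> T ` Y" using bij_betw_imp_surj_on[OF bT] by simp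
    then obtain i j where ij: "(i, j) \<in> Y" "T (i, j) = Suc s" by auto
    have le: "T x \<le> Suc s" if "x \<in> Y" for x using bij_betwE[OF bT] that by auto
    have "(i, j + 1) \<notin> Y"
    proof
      assume "(i, j + 1) \<in> Y"
      then have "T (i, j) < T (i, j + 1)" "T (i, j + 1) \<le> Suc s" using T le unfolding tableaux_def by auto
      then show False using ij by simp
    qed
    moreover have "(i + 1, j) \<notin> Y"
    proof
      assume "(i + 1, j) \<in> Y"
      then have "T (i, j) < T (i + 1, j)" "T (i + 1, j) \<le> Suc s" using T le unfolding tableaux_def by auto
      then show False using ij by simp
    qed
    ultimately have "(i, j) \<in> corners Y" using ij by (simp add: corners_def)
    then show "T \<in> (\<Union>c\<in>corners Y. {T \<in> tableaux Y. T c = Suc s})" using T ij by blast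
  qed auto
  then have "card (tableaux Y) = card (\<Union>c\<in>corners Y. {T \<in> tableaux Y. T c = Suc s})" by simp
  also have "\<dots> = (\<Sum>c\<in>corners Y. card {T \<in> tableaux Y. T c = Suc s})"
  proof (rule card_UN_disjoint[OF finc])
    show "\<forall>c\<in>corners Y. finite {T \<in> tableaux Y. T c = Suc s}" using finite_tableaux[OF fin] by simp
    show "\<forall>c\<in>corners Y. \<forall>c'\<in>corners Y. c \<noteq> c' \<longrightarrow> {T \<in> tableaux Y. T c = Suc s} \<inter> {T \<in> tableaux Y. T c' = Suc s} = {}"
    proof (intro ballI impI)
      fix c c' assume cc: "c \<in> corners Y" "c' \<in> corners Y" "c \<noteq> c'"
      have "c \<in> Y" "c' \<in> Y" using cc by (auto simp: corners_def)
      then have ne: "T c \<noteq> T c'" if "T \<in> tableaux Y" for T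
        using that cc(3) unfolding tableaux_def bij_betw_def by (auto dest: inj_onD)
      show "{T \<in> tableaux Y. T c = Suc s} \<inter> {T \<in> tableaux Y. T c' = Suc s} = {}"
      proof (rule equals0I)
        fix T assume "T \<in> {T \<in> tableaux Y. T c = Suc s} \<inter> {T \<in> tableaux Y. T c' = Suc s}"
        then have "T \<in> tableaux Y" "T c = T c'" by simp_all
        then show False using ne by blast
      qed
    qed
  qed
  also have "\<dots> = (\<Sum>c\<in>corners Y. card (tableaux (Y - {c})))"
    by (intro sum.cong refl tableaux_remove[OF Y])
  finally show ?thesis .
qed

definition diagram :: "nat \<Rightarrow> (nat \<Rightarrow> int) \<Rightarrow> (nat \<times> nat) set" where
  "diagram n L = {(i, j). i < n \<and> int j < L i - int (n - 1 - i)}"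

lemma finite_diagram: "finite (diagram n L)"
proof -
  have "diagram n L = (SIGMA i:{..<n}. {..<nat (L i - int (n - 1 - i))})"
    by (auto simp: diagram_def)
  then show ?thesis by simp
qed

lemma decreasing_row:
  assumes "\<And>i j. i < j \<Longrightarrow> j < n \<Longrightarrow> L j < (L i :: int)" "i + 1 < n"
  shows "L (i + 1) - int (n - 1 - (i + 1)) \<le> L i - int (n - 1 - i)"
  using assms(1)[of i "i + 1"] assms(2) by auto

lemma closed_diagram_diagram:
  assumes "\<And>i j. i < j \<Longrightarrow> j < n \<Longrightarrow> L j < (L i :: int)"
  shows "closed_diagram (diagram n L)"
proof -
  have "(i, j) \<in> diagram n L" if "(i + 1, j) \<in> diagram n L" for i j
    using that decreasing_row[of n L i] assms by (auto simp: diagram_def)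
  then show ?thesis unfolding closed_diagram_def using finite_diagram by (auto simp: diagram_def)
qed

text \<open>Both sides branch in the same way: the largest entry stands in a corner, and row
  \<open>p\<close> ends in a corner exactly when the bead \<open>L p\<close> can be lowered by
  one.\<close>

lemma card_tableaux_diagram:
  assumes "\<And>i j. i < j \<Longrightarrow> j < n \<Longrightarrow> L j < (L i :: int)" "\<And>j. j < n \<Longrightarrow> 0 \<le> L j"
    "card (diagram n L) = s"
  shows "card (tableaux (diagram n L)) = chains (ground n) (replicate s 1) (L ` {0..<n})"
  using assms
proof (induction s arbitrary: L)
  case 0
  have ge: "int (n - 1 - j) \<le> L j" if "j < n" for j using decreasing_ground[of n L] 0 that by blast
  have empty: "diagram n L = {}" using 0 finite_diagram[of n L] by simp
  have "L j = int (n - 1 - j)" if "j < n" for j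
  proof -
    have "(j, 0) \<notin> diagram n L" using empty by simp
    then show ?thesis using ge[OF that] that by (simp add: diagram_def)
  qed
  then have "L ` {0..<n} = (\<lambda>j. int (n - 1 - id j)) ` {0..<n}" by (intro image_cong) auto
  then have "L ` {0..<n} = ground n" using ground_reflect[of id n] by (simp add: permutes_id)
  moreover have "tableaux {} = {\<lambda>_. undefined}" unfolding tableaux_def by (auto simp: bij_betw_def)
  ultimately show ?case using empty by simp
next
  case (Suc s)
  let ?B = "L ` {0..<n}" and ?Y = "diagram n L"
  let ?L = "\<lambda>p. L(p := L p - 1)"
  let ?P = "{p \<in> {..<n}. L p \<in> movable 1 ?B}"
  define row where "row p = L p - int (n - 1 - p)" for p
  have inj: "inj_on L {0..<n}" using Suc.prems(1) by (rule decreasing_inj)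
  have ge: "0 \<le> row j" if "j < n" for j
    using decreasing_ground[of n L j] Suc.prems(1,2) that unfolding row_def by fastforce
  have dec: "row (i + 1) \<le> row i" if "i + 1 < n" for i
    using decreasing_row[of n L i] Suc.prems(1) that unfolding row_def by blast
  have Y: "closed_diagram ?Y" using closed_diagram_diagram Suc.prems(1) by blast
  have P_iff: "p \<in> ?P \<longleftrightarrow> 1 \<le> row p \<and> (p + 1 < n \<longrightarrow> row (p + 1) < row p)" if p: "p < n" for p
  proof
    assume "p \<in> ?P"
    then have 1: "1 \<le> L p" "L p - 1 \<notin> ?B" by (auto simp: movable_def)
    have 2: "row (p + 1) < row p" if "p + 1 < n"
    proof -
      have "L (p + 1) < L p" using Suc.prems(1) that by simp
      moreover have "L (p + 1) \<noteq> L p - 1" using 1(2) that by force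
      ultimately show ?thesis using that by (simp add: row_def of_nat_diff)
    qed
    moreover have "1 \<le> row p"
    proof (cases "p + 1 < n")
      case True
      then show ?thesis using ge[of "p + 1"] 2 by simp
    next
      case False
      then have "p = n - 1" using p by simp
      then show ?thesis using 1 by (simp add: row_def)
    qed
    ultimately show "1 \<le> row p \<and> (p + 1 < n \<longrightarrow> row (p + 1) < row p)" by blast
  next
    assume H: "1 \<le> row p \<and> (p + 1 < n \<longrightarrow> row (p + 1) < row p)"
    have "L q \<noteq> L p - 1" if q: "q < n" for q
    proof
      assume eq: "L q = L p - 1"
      have "\<not> q \<le> p" using Suc.prems(1)[of q p] p eq by (cases "q = p") auto
      then have pq: "p + 1 \<le> q" by simp
      then have "L q \<le> L (p + 1)" using Suc.prems(1)[of "p + 1" q] q by (cases "q = p + 1") auto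
      moreover have "L (p + 1) < L p - 1" using H pq q by (simp add: row_def of_nat_diff)
      ultimately show False using eq by simp
    qed
    then have "L p - 1 \<notin> ?B" by (metis atLeastLessThan_iff imageE)
    moreover have "1 \<le> L p" using H by (simp add: row_def)
    ultimately show "p \<in> ?P" using p by (simp add: movable_def)
  qed
  have mem: "(i, j) \<in> ?Y \<longleftrightarrow> i < n \<and> int j < row i" for i j by (simp add: diagram_def row_def)
  have corner_iff: "(i, j) \<in> corners ?Y \<longleftrightarrow> i \<in> ?P \<and> int j = row i - 1" for i j
  proof (cases "i < n")
    case True
    show ?thesis unfolding P_iff[OF True] corners_def using True by (auto simp: mem)
  next
    case False
    then show ?thesis by (auto simp: corners_def mem)
  qed
  have bijc: "bij_betw (\<lambda>p. (p, nat (row p - 1))) ?P (corners ?Y)"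
  proof (rule bij_betw_imageI)
    show "inj_on (\<lambda>p. (p, nat (row p - 1))) ?P" by (auto simp: inj_on_def)
    have "(p, nat (row p - 1)) \<in> corners ?Y" if "p \<in> ?P" for p
      using that P_iff[of p] corner_iff by simp
    moreover have "\<exists>p\<in>?P. (i, j) = (p, nat (row p - 1))" if "(i, j) \<in> corners ?Y" for i j
      using that corner_iff[of i j] by (intro bexI[of _ i]) auto
    ultimately show "(\<lambda>p. (p, nat (row p - 1))) ` ?P = corners ?Y" by (auto simp: image_iff)
  qed
  have step: "card (tableaux (?Y - {(p, nat (row p - 1))})) = chains (ground n) (replicate s 1) (bead_move 1 (L p) ?B)"
    if p: "p \<in> ?P" for p
  proof -
    have pn: "p < n" using p by simp
    have r1: "1 \<le> row p" using P_iff[OF pn] p by blast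
    have eq: "?Y - {(p, nat (row p - 1))} = diagram n (?L p)"
      using r1 pn by (auto simp: diagram_def row_def split: if_splits)
    have notin: "L p - 1 \<notin> ?B" "1 \<le> L p" using p by (auto simp: movable_def)
    have d: "(?L p) j < (?L p) i" if ij: "i < j" "j < n" for i j
    proof -
      have "L j \<noteq> L p - 1" using notin ij by force
      then show ?thesis using Suc.prems(1)[OF ij] by auto
    qed
    have nn: "0 \<le> (?L p) j" if "j < n" for j using Suc.prems(2)[OF that] notin by simp
    have im: "(?L p) ` {0..<n} = bead_move 1 (L p) ?B"
      unfolding bead_move_def by (rule fun_upd_image[OF inj]) (use pn in simp)
    have "(p, nat (row p - 1)) \<in> ?Y" using r1 pn by (simp add: mem)
    then have "card (diagram n (?L p)) = s" using Suc.prems(3) finite_diagram[of n L] unfolding eq[symmetric] by simp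
    from Suc.IH[OF d nn this] show ?thesis unfolding eq im .
  qed
  have bij: "bij_betw L ?P (movable 1 ?B)"
    using inj by (auto simp: bij_betw_def inj_on_def movable_def)
  have "card (tableaux ?Y) = (\<Sum>c\<in>corners ?Y. card (tableaux (?Y - {c})))"
    by (rule tableaux_branching[OF Y Suc.prems(3)])
  also have "\<dots> = (\<Sum>p\<in>?P. card (tableaux (?Y - {(p, nat (row p - 1))})))"
    by (rule sum.reindex_bij_betw[OF bijc, symmetric])
  also have "\<dots> = (\<Sum>p\<in>?P. chains (ground n) (replicate s 1) (bead_move 1 (L p) ?B))"
    by (intro sum.cong refl step)
  also have "\<dots> = (\<Sum>x\<in>movable 1 ?B. chains (ground n) (replicate s 1) (bead_move 1 x ?B))"
    by (rule sum.reindex_bij_betw[OF bij])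
  finally show ?case by simp
qed

section \<open>Beta numbers of a partition\<close>

definition beads :: "nat \<Rightarrow> nat list \<Rightarrow> int set" where
  "beads n \<nu> = beta_numbers n \<nu> ` {0..<n}"

lemma partition_length:
  assumes "is_partition n \<nu>" shows "length \<nu> \<le> n"
proof -
  have "\<forall>x\<in>set \<nu>. 1 \<le> x" using assms by (auto simp: is_partition_def)
  then have "length \<nu> \<le> sum_list \<nu>" by (induction \<nu>) auto
  then show ?thesis using assms by (simp add: is_partition_def)
qed

lemma part_at_antimono:
  assumes "is_partition n \<nu>" "i \<le> j" shows "part_at \<nu> j \<le> part_at \<nu> i"
  using assms sorted_wrt_nth_less[of "(\<ge>)" \<nu> i j] unfolding part_at_def is_partition_def
  by (cases "i = j") auto

lemma beta_numbers_decreasing: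
  assumes "is_partition n \<nu>" "i < j" "j < n"
  shows "beta_numbers n \<nu> j < beta_numbers n \<nu> i"
  using part_at_antimono[OF assms(1), of i j] assms by (simp add: beta_numbers_def)

lemma beta_numbers_nonneg: "0 \<le> beta_numbers n \<nu> j"
  by (simp add: beta_numbers_def)

lemma diagram_cells:
  assumes "is_partition n \<nu>" shows "diagram n (beta_numbers n \<nu>) = cells \<nu>"
  using partition_length[OF assms] by (auto simp: diagram_def cells_def beta_numbers_def part_at_def split: if_splits)

lemma card_cells: "card (cells \<nu>) = sum_list \<nu>"
proof -
  have "cells \<nu> = (SIGMA i:{0..<length \<nu>}. {..<\<nu> ! i})" by (auto simp: cells_def)
  then show ?thesis by (simp add: sum_list_sum_nth)
qed

lemma num_syt_chains:
  assumes "is_partition n \<nu>"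
  shows "num_syt \<nu> = chains (ground n) (replicate n 1) (beads n \<nu>)"
proof -
  have n: "sum_list \<nu> = n" using assms by (simp add: is_partition_def)
  have "num_syt \<nu> = card (tableaux (cells \<nu>))" unfolding num_syt_def tableaux_def card_cells ..
  also have "\<dots> = card (tableaux (diagram n (beta_numbers n \<nu>)))" by (simp add: diagram_cells[OF assms])
  also have "\<dots> = chains (ground n) (replicate n 1) (beads n \<nu>)"
    unfolding beads_def using beta_numbers_decreasing[OF assms] beta_numbers_nonneg card_cells n
    by (intro card_tableaux_diagram) (auto simp: diagram_cells[OF assms])
  finally show ?thesis .
qed

lemma sum_beads:
  assumes "is_partition n \<nu>"
  shows "\<Sum>(beads n \<nu>) = \<Sum>(ground n) + int n"
proof -
  have inj: "inj_on (beta_numbers n \<nu>) {0..<n}" using beta_numbers_decreasing[OF assms] by (rule decreasing_inj)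
  have "(\<Sum>j\<in>{0..<n}. part_at \<nu> j) = (\<Sum>j\<in>{0..<length \<nu>}. part_at \<nu> j)"
    using partition_length[OF assms] by (intro sum.mono_neutral_right) (auto simp: part_at_def)
  also have "\<dots> = sum_list \<nu>" by (simp add: part_at_def sum_list_sum_nth)
  finally have "(\<Sum>j\<in>{0..<n}. part_at \<nu> j) = n" using assms by (simp add: is_partition_def)
  then have "(\<Sum>j\<in>{0..<n}. int (part_at \<nu> j)) = int n" by (simp flip: of_nat_sum)
  moreover have "(\<Sum>j\<in>{0..<n}. int (n - 1 - j)) = \<Sum>((\<lambda>j. int (n - 1 - j)) ` {0..<n})"
    by (subst sum.reindex) (auto simp: inj_on_def)
  moreover have "(\<lambda>j. int (n - 1 - j)) ` {0..<n} = ground n" using ground_reflect[of id n] by (simp add: permutes_id)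
  moreover have "\<Sum>(beads n \<nu>) = (\<Sum>j\<in>{0..<n}. int (part_at \<nu> j) + int (n - 1 - j))"
    unfolding beads_def sum.reindex[OF inj] by (simp add: beta_numbers_def)
  ultimately show ?thesis by (simp add: sum.distrib)
qed

lemma boxed_beads:
  assumes \<nu>: "is_partition n \<nu>" and b: "first_row \<nu> \<le> b" "length \<nu> \<le> b"
  shows "boxed n b (beads n \<nu>)"
proof -
  have inj: "inj_on (beta_numbers n \<nu>) {0..<n}" using beta_numbers_decreasing[OF \<nu>] by (rule decreasing_inj)
  have "part_at \<nu> 0 = first_row \<nu>" by (cases \<nu>) (auto simp: part_at_def first_row_def)
  then have row: "part_at \<nu> j \<le> b" for j using part_at_antimono[OF \<nu>, of 0 j] b by simp
  have "x \<in> beads n \<nu>" if x: "0 \<le> x" "x < int n - int b" for x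
  proof -
    define j where "j = n - 1 - nat x"
    have j: "j < n" "length \<nu> \<le> j" "int (n - 1 - j) = x" using x b by (auto simp: j_def)
    then have "beta_numbers n \<nu> j = x" by (simp add: beta_numbers_def part_at_def)
    then show ?thesis unfolding beads_def using j(1) by (intro image_eqI[of _ _ j]) auto
  qed
  moreover have "beta_numbers n \<nu> j < int n + int b" if "j < n" for j
    using row[of j] that by (simp add: beta_numbers_def)
  ultimately show ?thesis
    unfolding boxed_def using inj beta_numbers_nonneg by (auto simp: beads_def card_image)
qed

lemma irr_char_id:
  assumes "is_partition n \<nu>" shows "irr_char n \<nu> id = int (num_syt \<nu>)"
proof -
  obtain rs where rs: "cycle_lengths id {0..<n} (replicate (card {i\<in>{0..<n}. id i = i}) 1 @ rs)"
      "\<forall>r\<in>set rs. 2 \<le> r" "sum_list rs = card {i\<in>{0..<n}. id i \<noteq> i}"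
    using cycle_lengths_exist[of "{0..<n}" id] by auto
  have "rs = []" using rs(2,3) by (cases rs) auto
  then have "cycle_lengths id {0..<n} (replicate n 1)" using rs(1) by simp
  then have "alternant n {0..<n} id (beta_numbers n \<nu>) 
      = int (chains (ground n) (map int (replicate n 1)) (beta_numbers n \<nu> ` {0..<n}))"
    using beta_numbers_decreasing[OF assms] beta_numbers_nonneg
    by (intro alternant_unit_steps) auto
  then show ?thesis using num_syt_chains[OF assms] by (simp add: irr_char_alternant beads_def)
qed

text \<open>The constant 6 is 5 from the words with many active windows plus 1 from those with few
  jumps. The last hypothesis makes the latter at most \<open>(6/7)^A\<close> times the lower bound
  of \<open>card_words_ge\<close>, applied to each shape that remains when the fixed points are
  gone.\<close>

lemma irr_char_abs_le:
  assumes \<nu>: "is_partition n \<nu>" and b: "first_row \<nu> \<le> b" "length \<nu> \<le> b" and g: "g \<in> perms n"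
    and s: "card {i\<in>{0..<n}. g i \<noteq> i} = s" "5 \<le> s"
    and A: "real (s * (n + b)) ^ (14 + 40 * A) \<le> (6 / 7) ^ A * 2 ^ ((s - b) div 2)"
  shows "\<bar>real_of_int (irr_char n \<nu> g)\<bar> \<le> 6 * (6 / 7) ^ A * real (num_syt \<nu>)"
proof -
  let ?a = "card {i\<in>{0..<n}. g i = i}"
  have gp: "g permutes {0..<n}" using g by (simp add: perms_def)
  have inj: "inj_on (beta_numbers n \<nu>) {0..<n}" using beta_numbers_decreasing[OF \<nu>] by (rule decreasing_inj)
  have as: "?a + s = n"
  proof -
    have "card ({i\<in>{0..<n}. g i = i} \<union> {i\<in>{0..<n}. g i \<noteq> i}) = ?a + s"
      using s by (subst card_Un_disjoint) auto
    moreover have "{i\<in>{0..<n}. g i = i} \<union> {i\<in>{0..<n}. g i \<noteq> i} = {0..<n}" by auto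
    ultimately show ?thesis by simp
  qed
  obtain rs where rs: "cycle_lengths g {0..<n} (replicate ?a 1 @ rs)" "\<forall>r\<in>set rs. 2 \<le> r" "sum_list rs = s"
    using cycle_lengths_exist[of "{0..<n}" g] permutes_inj[OF gp] permutes_image[OF gp] s by auto
  have box: "boxed n b (beads n \<nu>)" by (rule boxed_beads[OF \<nu> b])
  have "\<bar>irr_char n \<nu> g\<bar> \<le> int (chains (ground n) (map int (replicate ?a 1 @ rs)) (beads n \<nu>))"
    unfolding irr_char_alternant beads_def
    using rs(1) permutes_inj[OF gp] inj beta_numbers_nonneg by (intro alternant_abs_le_chains) auto
  then have "\<bar>real_of_int (irr_char n \<nu> g)\<bar> \<le> real (chains (ground n) (replicate ?a 1 @ map int rs) (beads n \<nu>))"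
    using of_int_le_iff[of "\<bar>irr_char n \<nu> g\<bar>", where ?'a = real] by simp
  also have "\<dots> \<le> 6 * (6 / 7) ^ A * real (card (words (beads n \<nu>) (ground n)))"
  proof (rule chains_fixed_points[OF box])
    show "\<Sum>(beads n \<nu>) = \<Sum>(ground n) + int (?a + s)" using sum_beads[OF \<nu>] as by simp
  next
    fix C assume C: "boxed n b C" "\<Sum>C = \<Sum>(ground n) + int s"
    have "real (s * (n + b)) ^ (14 + 40 * A) \<le> (6 / 7) ^ A * real (card (words C (ground n)))"
    proof -
      have "real (2 ^ ((s - b) div 2)) \<le> real (card (words C (ground n)))"
        using card_words_ge[OF C] by (rule of_nat_mono)
      then have "(6 / 7) ^ A * real (2 ^ ((s - b) div 2)) \<le> (6 / 7) ^ A * real (card (words C (ground n)))"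
        by (intro mult_left_mono) auto
      moreover have "real (s * (n + b)) ^ (14 + 40 * A) \<le> (6 / 7) ^ A * real (2 ^ ((s - b) div 2))"
        using A unfolding of_nat_power of_nat_numeral .
      ultimately show ?thesis by linarith
    qed
    then show "real (chains (ground n) (map int rs) C) \<le> 6 * (6 / 7) ^ A * real (card (words C (ground n)))"
      using chains_hook_bound[OF C s(2) rs(2,3), of A] by linarith
  qed
  also have "card (words (beads n \<nu>) (ground n)) = num_syt \<nu>"
    using card_words_chains[of "beads n \<nu>" "ground n" n] sum_beads[OF \<nu>] num_syt_chains[OF \<nu>] 
    by (simp add: beads_def)
  finally show ?thesis .
qed

lemma num_syt_pos:
  assumes "is_partition n \<nu>" shows "0 < num_syt \<nu>"
proof -
  define b where "b = max (first_row \<nu>) (length \<nu>)"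
  have "boxed n b (beads n \<nu>)" by (rule boxed_beads[OF assms]) (auto simp: b_def)
  then have "2 ^ ((n - b) div 2) \<le> card (words (beads n \<nu>) (ground n))"
    using sum_beads[OF assms] by (rule card_words_ge)
  also have "\<dots> = num_syt \<nu>"
    using card_words_chains[of "beads n \<nu>" "ground n" n] sum_beads[OF assms] num_syt_chains[OF assms] 
    by (simp add: beads_def)
  finally have "2 ^ ((n - b) div 2) \<le> num_syt \<nu>" .
  then show ?thesis by (rule less_le_trans[rotated]) simp
qed

section \<open>The centralizer\<close>

lemma card_colourings_conj_le:
  assumes x: "x permutes {0..<n}" and g: "g permutes {0..<n}"
  shows "card (colourings n {0..<n} (x \<circ> g \<circ> inv x) \<alpha>) \<le> card (colourings n {0..<n} g \<alpha>)"
proof (rule card_inj_on_le[of "\<lambda>f. restrict (f \<circ> x) {0..<n}"])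
  have lt: "x i < n \<longleftrightarrow> i < n" for i using permutes_in_image[OF x, of i] by simp
  have ix: "inv x (x i) = i" "x (inv x i) = i" for i using permutes_inverses[OF x] by auto
  show "inj_on (\<lambda>f. restrict (f \<circ> x) {0..<n}) (colourings n {0..<n} (x \<circ> g \<circ> inv x) \<alpha>)"
  proof (rule inj_onI)
    fix f h assume fh: "f \<in> colourings n {0..<n} (x \<circ> g \<circ> inv x) \<alpha>" "h \<in> colourings n {0..<n} (x \<circ> g \<circ> inv x) \<alpha>"
      and eq: "restrict (f \<circ> x) {0..<n} = restrict (h \<circ> x) {0..<n}"
    have ext: "f \<in> {0..<n} \<rightarrow>\<^sub>E {0..<n}" "h \<in> {0..<n} \<rightarrow>\<^sub>E {0..<n}" using fh by (auto simp: colourings_def)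
    show "f = h"
    proof (rule PiE_ext[OF ext])
      fix i assume i: "i \<in> {0..<n}"
      then have "inv x i < n" using lt[of "inv x i"] ix by simp
      then show "f i = h i" using fun_cong[OF eq, of "inv x i"] ix by simp
    qed
  qed
  show "(\<lambda>f. restrict (f \<circ> x) {0..<n}) ` colourings n {0..<n} (x \<circ> g \<circ> inv x) \<alpha> \<subseteq> colourings n {0..<n} g \<alpha>"
  proof
    fix h assume "h \<in> (\<lambda>f. restrict (f \<circ> x) {0..<n}) ` colourings n {0..<n} (x \<circ> g \<circ> inv x) \<alpha>"
    then obtain f where f: "f \<in> colourings n {0..<n} (x \<circ> g \<circ> inv x) \<alpha>" and h: "h = restrict (f \<circ> x) {0..<n}"
      by blast
    have fin: "f i < n" if "i < n" for i using f that by (auto simp: colourings_def PiE_iff)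
    have "h \<in> {0..<n} \<rightarrow>\<^sub>E {0..<n}" using fin lt by (auto simp: h)
    moreover have "\<forall>i\<in>{0..<n}. h (g i) = h i"
    proof
      fix i assume i: "i \<in> {0..<n}"
      have gi: "g i < n" using permutes_in_image[OF g, of i] i by simp
      have "\<forall>j\<in>{0..<n}. f ((x \<circ> g \<circ> inv x) j) = f j" using f by (simp add: colourings_def)
      then have "f ((x \<circ> g \<circ> inv x) (x i)) = f (x i)" using lt[of i] i by auto
      then show "h (g i) = h i" using i gi by (simp add: h ix)
    qed
    moreover have "int (card {i\<in>{0..<n}. h i = j}) = \<alpha> j" if "j < n" for j
    proof -
      have "{i\<in>{0..<n}. f i = j} = x ` {i\<in>{0..<n}. h i = j}"
      proof (intro set_eqI iffI)
        fix i assume i: "i \<in> {i\<in>{0..<n}. f i = j}"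
        then have "inv x i < n" using lt[of "inv x i"] ix by simp
        then show "i \<in> x ` {i\<in>{0..<n}. h i = j}"
          using i ix by (intro image_eqI[of _ _ "inv x i"]) (auto simp: h)
      qed (auto simp: h lt)
      then have "card {i\<in>{0..<n}. f i = j} = card {i\<in>{0..<n}. h i = j}"
        using permutes_inj_on[OF x] by (simp add: card_image)
      moreover have "int (card {i\<in>{0..<n}. f i = j}) = \<alpha> j" using f that unfolding colourings_def by blast
      ultimately show ?thesis by simp
    qed
    ultimately show "h \<in> colourings n {0..<n} g \<alpha>" by (simp add: colourings_def)
  qed
  show "finite (colourings n {0..<n} g \<alpha>)" by (intro finite_colourings) simp
qed

lemma perms_conj:
  assumes "x \<in> perms n" "g \<in> perms n" shows "x \<circ> g \<circ> inv x \<in> perms n"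
  using assms unfolding perms_def by (auto intro!: permutes_compose permutes_inv)

lemma perms_conj_inv:
  assumes "x \<in> perms n" shows "inv x \<circ> (x \<circ> g \<circ> inv x) \<circ> inv (inv x) = g"
proof -
  have x: "x permutes {0..<n}" using assms by (simp add: perms_def)
  then show ?thesis using permutes_inverses[OF x] by (simp add: fun_eq_iff permutes_inv_inv)
qed

lemma irr_char_conj:
  assumes x: "x \<in> perms n" and g: "g \<in> perms n"
  shows "irr_char n \<nu> (x \<circ> g \<circ> inv x) = irr_char n \<nu> g"
proof -
  let ?h = "x \<circ> g \<circ> inv x"
  have p: "x permutes {0..<n}" "g permutes {0..<n}" "inv x permutes {0..<n}" "?h permutes {0..<n}"
    using x g perms_conj[OF x g] by (auto simp: perms_def permutes_inv)
  have "card (colourings n {0..<n} ?h \<alpha>) = card (colourings n {0..<n} g \<alpha>)" for \<alpha>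
    using card_colourings_conj_le[OF p(1,2), of \<alpha>] card_colourings_conj_le[OF p(3,4), of \<alpha>]
    unfolding perms_conj_inv[OF x] by (rule antisym)
  then show ?thesis by (simp add: irr_char_alternant alternant_def)
qed

lemma bij_betw_perms_conj:
  assumes x: "x \<in> perms n" shows "bij_betw (\<lambda>g. x \<circ> g \<circ> inv x) (perms n) (perms n)"
proof (rule bij_betw_byWitness[of _ "\<lambda>g. inv x \<circ> g \<circ> inv (inv x)"])
  have p: "x permutes {0..<n}" using x by (simp add: perms_def)
  then have ix: "inv x \<in> perms n" by (simp add: perms_def permutes_inv)
  show "\<forall>g\<in>perms n. inv x \<circ> (x \<circ> g \<circ> inv x) \<circ> inv (inv x) = g" using perms_conj_inv[OF x] by blast
  show "\<forall>g\<in>perms n. x \<circ> (inv x \<circ> g \<circ> inv (inv x)) \<circ> inv x = g"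
    using permutes_inverses[OF p] by (simp add: fun_eq_iff permutes_inv_inv[OF p])
  show "(\<lambda>g. x \<circ> g \<circ> inv x) ` perms n \<subseteq> perms n" using perms_conj[OF x] by blast
  show "(\<lambda>g. inv x \<circ> g \<circ> inv (inv x)) ` perms n \<subseteq> perms n" using perms_conj[OF ix] by blast
qed

lemma card_perms: "card (perms n) = fact n"
  unfolding perms_def by (rule card_permutations) auto

text \<open>Frobenius reciprocity. After the sums are exchanged, conjugation by \<open>x\<close>
  reindexes the sum over \<open>g\<close>, which becomes independent of \<open>x\<close>; the
  resulting factor \<open>n!\<close> cancels the one in \<open>char_inner\<close>.\<close>

lemma char_inner_ind_char:
  assumes H: "H \<subseteq> perms n"
    and \<chi>: "\<And>x g. x \<in> perms n \<Longrightarrow> g \<in> perms n \<Longrightarrow> \<chi> (x \<circ> g \<circ> inv x) = \<chi> g"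
  shows "char_inner n (ind_char n H \<phi>) \<chi> = (\<Sum>h\<in>H. \<phi> h * cnj (\<chi> h)) / of_nat (card H)"
proof -
  let ?F = "\<lambda>h. (if h \<in> H then \<phi> h else 0) * cnj (\<chi> h)"
  have "(\<Sum>g\<in>perms n. (\<Sum>x\<in>perms n. if x \<circ> g \<circ> inv x \<in> H then \<phi> (x \<circ> g \<circ> inv x) else 0) * cnj (\<chi> g))
     = (\<Sum>g\<in>perms n. \<Sum>x\<in>perms n. ?F (x \<circ> g \<circ> inv x))"
    unfolding sum_distrib_right by (intro sum.cong refl) (simp add: \<chi>)
  also have "\<dots> = (\<Sum>x\<in>perms n. \<Sum>g\<in>perms n. ?F (x \<circ> g \<circ> inv x))" by (rule sum.swap)
  also have "\<dots> = (\<Sum>x\<in>perms n. \<Sum>g\<in>perms n. ?F g)"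
    by (intro sum.cong refl sum.reindex_bij_betw[OF bij_betw_perms_conj])
  also have "\<dots> = of_nat (fact n) * (\<Sum>g\<in>perms n. ?F g)" by (simp add: card_perms)
  also have "(\<Sum>g\<in>perms n. ?F g) = (\<Sum>g\<in>H. ?F g)" using H by (intro sum.mono_neutral_right) auto
  also have "\<dots> = (\<Sum>h\<in>H. \<phi> h * cnj (\<chi> h))" by (intro sum.cong) auto
  finally have eq: "(\<Sum>g\<in>perms n. (\<Sum>x\<in>perms n. if x \<circ> g \<circ> inv x \<in> H then \<phi> (x \<circ> g \<circ> inv x) else 0) * cnj (\<chi> g))
    = of_nat (fact n) * (\<Sum>h\<in>H. \<phi> h * cnj (\<chi> h))" .
  have "(of_nat (fact n) :: complex) \<noteq> 0" by simp
  then show ?thesis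
    unfolding char_inner_def ind_char_def times_divide_eq_left sum_divide_distrib[symmetric] eq by simp
qed

section \<open>Block structure of the centralizer\<close>

lemma block_bound: "q < k \<Longrightarrow> r < m \<Longrightarrow> q * m + r < m * (k::nat)"
proof -
  assume "q < k" "r < m"
  then have "q * m + r < Suc q * m" by simp
  also have "\<dots> \<le> m * k" using \<open>q < k\<close> by (metis Suc_leI mult.commute mult_le_mono1)
  finally show ?thesis .
qed

lemma rect_perm_block:
  assumes "q < k" "r < m"
  shows "rect_perm m k (q * m + r) = q * m + (r + 1) mod m"
proof -
  have "(q * m + r) mod m = r" using assms by simp
  then show ?thesis using block_bound[OF assms] assms by (cases "r = m - 1") (auto simp: rect_perm_def)
qed

lemma block_div: "i < m * k \<Longrightarrow> i div m < (k::nat)"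
  by (simp add: less_mult_imp_div_less mult.commute)

lemma centralizer_lt:
  assumes "z \<in> rect_centralizer m k" "i < m * k" shows "z i < m * k"
  using assms permutes_in_image[of z "{0..<m * k}" i] by (auto simp: rect_centralizer_def perms_def)

lemma centralizer_block:
  assumes z: "z \<in> rect_centralizer m k" and j: "j < k" and r: "r < m"
  shows "z (j * m + r) = z (j * m) div m * m + (z (j * m) mod m + r) mod m"
  using r
proof (induction r)
  case 0
  then show ?case by simp
next
  case (Suc r)
  let ?q = "z (j * m) div m" and ?a = "z (j * m) mod m"
  have q: "?q < k" using centralizer_lt[OF z, of "j * m"] block_bound[OF j, of 0 m] Suc.prems
    by (intro block_div) auto
  have "rect_perm m k (j * m + r) = j * m + Suc r" using rect_perm_block[OF j, of r m] Suc.prems by simp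
  then have "z (j * m + Suc r) = (z \<circ> rect_perm m k) (j * m + r)" by simp
  also have "\<dots> = rect_perm m k (z (j * m + r))" using z by (simp add: rect_centralizer_def)
  also have "\<dots> = rect_perm m k (?q * m + (?a + r) mod m)" using Suc by simp
  also have "\<dots> = ?q * m + ((?a + r) mod m + 1) mod m" using Suc.prems by (intro rect_perm_block q) simp
  also have "\<dots> = ?q * m + (?a + Suc r) mod m" by (simp add: mod_Suc_eq)
  finally show ?case .
qed

lemma centralizer_outside:
  "z \<in> rect_centralizer m k \<Longrightarrow> \<not> i < m * k \<Longrightarrow> z i = i"
  by (auto simp: rect_centralizer_def perms_def permutes_def)

lemma centralizer_eqI:
  assumes m: "1 \<le> m" and z: "z \<in> rect_centralizer m k" and z': "z' \<in> rect_centralizer m k"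
    and eq: "\<And>j. j < k \<Longrightarrow> z (j * m) = z' (j * m)"
  shows "z = z'"
proof
  fix i
  show "z i = z' i"
  proof (cases "i < m * k")
    case True
    then have j: "i div m < k" by (rule block_div)
    have r: "i mod m < m" using m by simp
    show ?thesis using centralizer_block[OF z j r] centralizer_block[OF z' j r] eq[OF j] by simp
  qed (simp add: centralizer_outside[OF z] centralizer_outside[OF z'])
qed

lemma centralizer_inj_blocks:
  assumes m: "1 \<le> m" and z: "z \<in> rect_centralizer m k"
  shows "inj_on (\<lambda>j. z (j * m) div m) {0..<k}"
proof (rule inj_onI)
  fix i j assume ij: "i \<in> {0..<k}" "j \<in> {0..<k}" "z (i * m) div m = z (j * m) div m"
  let ?a = "z (i * m) mod m" and ?b = "z (j * m) mod m"
  \<comment> \<open>The rotation taking offset \<open>?a\<close> to \<open>?b\<close>, with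
    \<open>m - ?a\<close> in place of \<open>- ?a\<close>. If both blocks had the same image,
    \<open>z\<close> would agree at \<open>i * m + r\<close> and \<open>j * m\<close>.\<close>
  define r where "r = (?b + (m - ?a)) mod m"
  have r: "r < m" using m by (simp add: r_def)
  have a: "?a < m" and b: "?b < m" using m by auto
  have "(?a + r) mod m = (?a + (?b + (m - ?a))) mod m" by (simp add: r_def mod_add_right_eq)
  also have "?a + (?b + (m - ?a)) = ?b + m" using a by simp
  also have "(?b + m) mod m = ?b" using b by simp
  finally have "z (i * m + r) = z (j * m)" using centralizer_block[OF z _ r, of i] ij
    by (metis atLeastLessThan_iff div_mult_mod_eq)
  then have eq: "i * m + r = j * m"
    using z permutes_inj[of z "{0..<m * k}"] by (auto simp: rect_centralizer_def perms_def dest: injD)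
  have "(i * m + r) div m = i" using r by simp
  moreover have "(j * m) div m = j" using m by simp
  ultimately show "i = j" using eq by simp
qed

lemma add_mod_right_cancel:
  assumes "(r + a) mod m = (r' + a) mod m" "r < m" "r' < (m::nat)"
  shows "r = r'"
proof -
  obtain q q' where "r + a + m * q = r' + a + m * q'" using assms(1) unfolding nat_mod_eq_iff by blast
  then have "r + m * q = r' + m * q'" by linarith
  then have "(r + m * q) mod m = (r' + m * q') mod m" by simp
  then show ?thesis using assms(2,3) by simp
qed

text \<open>The wreath product element that permutes the blocks by \<open>\<sigma>\<close> and
  rotates block \<open>j\<close> by \<open>a j\<close>; it serves to count the centralizer.\<close>

definition wreath_perm :: "nat \<Rightarrow> nat \<Rightarrow> (nat \<Rightarrow> nat) \<times> (nat \<Rightarrow> nat) \<Rightarrow> nat \<Rightarrow> nat" where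
  "wreath_perm m k = (\<lambda>(\<sigma>, a) i. if i < m * k then \<sigma> (i div m) * m + (i mod m + a (i div m)) mod m else i)"

lemma wreath_perm_block:
  assumes "j < k" "r < m"
  shows "wreath_perm m k (\<sigma>, a) (j * m + r) = \<sigma> j * m + (r + a j) mod m"
  using block_bound[OF assms] assms by (simp add: wreath_perm_def)

lemma wreath_perm_centralizer:
  assumes m: "1 \<le> m" and \<sigma>: "\<sigma> permutes {0..<k}"
  shows "wreath_perm m k (\<sigma>, a) \<in> rect_centralizer m k"
proof -
  let ?z = "wreath_perm m k (\<sigma>, a)"
  have \<sigma>lt: "\<sigma> j < k" if "j < k" for j using permutes_in_image[OF \<sigma>, of j] that by simp
  have decomp: "i = i div m * m + i mod m" "i mod m < m" for i using m by auto
  have maps: "?z i < m * k" if i: "i < m * k" for i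
  proof -
    have "?z (i div m * m + i mod m) = \<sigma> (i div m) * m + (i mod m + a (i div m)) mod m"
      by (rule wreath_perm_block[OF block_div[OF i] decomp(2)])
    also have "\<dots> < m * k" using m by (intro block_bound \<sigma>lt block_div[OF i]) simp
    finally show ?thesis by simp
  qed
  have inj: "inj_on ?z {0..<m * k}"
  proof (rule inj_onI)
    fix i i' assume ii: "i \<in> {0..<m * k}" "i' \<in> {0..<m * k}" "?z i = ?z i'"
    let ?j = "i div m" and ?r = "i mod m" and ?j' = "i' div m" and ?r' = "i' mod m"
    have j: "?j < k" "?j' < k" using ii block_div by auto
    have eq: "\<sigma> ?j * m + (?r + a ?j) mod m = \<sigma> ?j' * m + (?r' + a ?j') mod m"
      using wreath_perm_block[OF j(1) decomp(2), of \<sigma> a i] wreath_perm_block[OF j(2) decomp(2), of \<sigma> a i'] ii(3) by simp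
    have lt: "(?r + a ?j) mod m < m" "(?r' + a ?j') mod m < m" using m by auto
    have "\<sigma> ?j = (\<sigma> ?j * m + (?r + a ?j) mod m) div m" using lt by simp
    also have "\<dots> = \<sigma> ?j'" unfolding eq using lt by simp
    finally have jj: "?j = ?j'" using permutes_inj[OF \<sigma>] by (auto dest: injD)
    then have "(?r + a ?j) mod m = (?r' + a ?j) mod m" using eq by simp
    then have "?r = ?r'" by (rule add_mod_right_cancel) (use m in auto)
    then show "i = i'" using jj decomp(1)[of i] decomp(1)[of i'] by metis
  qed
  have "?z ` {0..<m * k} = {0..<m * k}" using maps inj by (intro endo_inj_surj) auto
  then have "?z permutes {0..<m * k}"
    using inj by (intro bij_imp_permutes) (auto simp: bij_betw_def wreath_perm_def)
  moreover have "?z \<circ> rect_perm m k = rect_perm m k \<circ> ?z"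
  proof
    fix i
    show "(?z \<circ> rect_perm m k) i = (rect_perm m k \<circ> ?z) i"
    proof (cases "i < m * k")
      case True
      let ?j = "i div m" and ?r = "i mod m"
      have j: "?j < k" by (rule block_div[OF True])
      have lt: "(?r + 1) mod m < m" "(?r + a ?j) mod m < m" using m by auto
      have "?z (rect_perm m k i) = ?z (?j * m + (?r + 1) mod m)"
        using rect_perm_block[OF j decomp(2), of i] by simp
      also have "\<dots> = \<sigma> ?j * m + ((?r + 1) mod m + a ?j) mod m" by (rule wreath_perm_block[OF j lt(1)])
      also have "((?r + 1) mod m + a ?j) mod m = ((?r + a ?j) mod m + 1) mod m"
        by (simp add: mod_add_left_eq mod_Suc_eq)
      also have "\<sigma> ?j * m + ((?r + a ?j) mod m + 1) mod m = rect_perm m k (\<sigma> ?j * m + (?r + a ?j) mod m)"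
        by (rule rect_perm_block[OF \<sigma>lt[OF j] lt(2), symmetric])
      also have "\<sigma> ?j * m + (?r + a ?j) mod m = ?z i" using wreath_perm_block[OF j decomp(2), of \<sigma> a i] by simp
      finally show ?thesis by simp
    next
      case False
      then show ?thesis by (simp add: rect_perm_def wreath_perm_def)
    qed
  qed
  ultimately show ?thesis by (simp add: rect_centralizer_def perms_def)
qed

lemma card_rect_centralizer:
  assumes m: "1 \<le> m" shows "card (rect_centralizer m k) = m ^ k * fact k"
proof -
  let ?S = "{\<sigma>. \<sigma> permutes {0..<k}} \<times> ({0..<k} \<rightarrow>\<^sub>E {0..<m})"
  have "bij_betw (wreath_perm m k) ?S (rect_centralizer m k)"
  proof (rule bij_betw_imageI)
    show "inj_on (wreath_perm m k) ?S"
    proof (rule inj_onI)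
      fix p p' assume p: "p \<in> ?S" "p' \<in> ?S" and eq: "wreath_perm m k p = wreath_perm m k p'"
      obtain \<sigma> a \<sigma>' a' where pp: "p = (\<sigma>, a)" "p' = (\<sigma>', a')" by (cases p; cases p')
      have a: "a \<in> {0..<k} \<rightarrow>\<^sub>E {0..<m}" "a' \<in> {0..<k} \<rightarrow>\<^sub>E {0..<m}" and
        \<sigma>: "\<sigma> permutes {0..<k}" "\<sigma>' permutes {0..<k}" using p pp by auto
      have blk: "\<sigma> j = \<sigma>' j \<and> a j = a' j" if j: "j < k" for j
      proof -
        have lt: "a j < m" "a' j < m" using a j by (auto simp: PiE_iff)
        have "\<sigma> j * m + a j = \<sigma>' j * m + a' j"
          using wreath_perm_block[OF j, of 0 m \<sigma> a] wreath_perm_block[OF j, of 0 m \<sigma>' a'] eq pp lt m by simp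
        then have "(\<sigma> j * m + a j) div m = (\<sigma>' j * m + a' j) div m" "(\<sigma> j * m + a j) mod m = (\<sigma>' j * m + a' j) mod m"
          by auto
        then show ?thesis using lt by simp
      qed
      have "\<sigma> = \<sigma>'"
      proof
        fix j show "\<sigma> j = \<sigma>' j"
          using blk[of j] permutes_not_in[OF \<sigma>(1), of j] permutes_not_in[OF \<sigma>(2), of j] by (cases "j < k") auto
      qed
      moreover have "a = a'" by (rule PiE_ext[OF a]) (use blk in auto)
      ultimately show "p = p'" using pp by simp
    qed
    show "wreath_perm m k ` ?S = rect_centralizer m k"
    proof
      show "wreath_perm m k ` ?S \<subseteq> rect_centralizer m k" using wreath_perm_centralizer[OF m] by auto
      show "rect_centralizer m k \<subseteq> wreath_perm m k ` ?S"
      proof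
        fix z assume z: "z \<in> rect_centralizer m k"
        define \<sigma> where "\<sigma> j = (if j < k then z (j * m) div m else j)" for j
        define a where "a = restrict (\<lambda>j. z (j * m) mod m) {0..<k}"
        have lt: "z (j * m) < m * k" if "j < k" for j
          using centralizer_lt[OF z] block_bound[OF that, of 0 m] m by simp
        have inj: "inj_on \<sigma> {0..<k}"
          using centralizer_inj_blocks[OF m z] by (auto simp: inj_on_def \<sigma>_def)
        have "\<sigma> ` {0..<k} = {0..<k}" using inj lt block_div by (intro endo_inj_surj) (auto simp: \<sigma>_def)
        then have \<sigma>: "\<sigma> permutes {0..<k}" using inj by (intro bij_imp_permutes) (auto simp: bij_betw_def \<sigma>_def)
        have "a \<in> {0..<k} \<rightarrow>\<^sub>E {0..<m}" using m by (auto simp: a_def)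
        moreover have "z = wreath_perm m k (\<sigma>, a)"
        proof (rule centralizer_eqI[OF m z wreath_perm_centralizer[OF m \<sigma>]])
          fix j assume j: "j < k"
          show "z (j * m) = wreath_perm m k (\<sigma>, a) (j * m)"
            using wreath_perm_block[OF j, of 0 m \<sigma> a] j m by (simp add: \<sigma>_def a_def)
        qed
        ultimately show "z \<in> wreath_perm m k ` ?S" using \<sigma> by blast
      qed
    qed
  qed
  then have "card (rect_centralizer m k) = card ?S" by (simp add: bij_betw_same_card)
  also have "\<dots> = fact k * m ^ k" by (simp add: card_cartesian_product card_permutations card_PiE)
  finally show ?thesis by simp
qed

definition moved_blocks :: "nat \<Rightarrow> nat \<Rightarrow> (nat \<Rightarrow> nat) \<Rightarrow> nat set" where
  "moved_blocks m k z = {j \<in> {0..<k}. z (j * m) \<noteq> j * m}"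

text \<open>A block is fixed pointwise or moved at each of its points: one fixed point forces the
  block onto itself with rotation 0. A block that is only rotated thus counts as moved, and its
  first point detects this.\<close>

lemma card_support_centralizer:
  assumes m: "1 \<le> m" and z: "z \<in> rect_centralizer m k"
  shows "card {i \<in> {0..<m * k}. z i \<noteq> i} = m * card (moved_blocks m k z)"
proof -
  have fixed: "z (j * m + r) \<noteq> j * m + r \<longleftrightarrow> z (j * m) \<noteq> j * m" if j: "j < k" and r: "r < m" for j r
  proof
    assume H: "z (j * m + r) \<noteq> j * m + r"
    show "z (j * m) \<noteq> j * m"
    proof
      assume "z (j * m) = j * m"
      then show False using centralizer_block[OF z j r] H r m by simp
    qed
  next
    assume H: "z (j * m) \<noteq> j * m"
    show "z (j * m + r) \<noteq> j * m + r"
    proof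
      assume eq: "z (j * m + r) = j * m + r"
      let ?q = "z (j * m) div m" and ?a = "z (j * m) mod m"
      have e: "?q * m + (?a + r) mod m = j * m + r" using centralizer_block[OF z j r] eq by simp
      have lt: "(?a + r) mod m < m" "?a < m" using m by auto
      have "?q = (?q * m + (?a + r) mod m) div m" using lt by simp
      also have "\<dots> = j" unfolding e using r by simp
      finally have q: "?q = j" .
      then have "(?a + r) mod m = (0 + r) mod m" using e r by simp
      then have *: "(?a + r) mod m = r" using r by simp
      have "?a = 0"
      proof (cases "?a + r < m")
        case True
        then show ?thesis using * by simp
      next
        case False
        then have "?a + r - m = r" using * lt(2) r by (simp add: le_mod_geq not_less)
        then show ?thesis using False lt(2) by linarith
      qed
      then show False using H q by (metis add.right_neutral div_mult_mod_eq)
    qed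
  qed
  let ?f = "\<lambda>(j, r). j * m + r"
  have eq: "{i \<in> {0..<m * k}. z i \<noteq> i} = ?f ` (moved_blocks m k z \<times> {0..<m})"
  proof (intro set_eqI iffI)
    fix i assume i: "i \<in> {i \<in> {0..<m * k}. z i \<noteq> i}"
    have j: "i div m < k" using i by (intro block_div) auto
    have r: "i mod m < m" using m by simp
    have "i div m \<in> moved_blocks m k z" using fixed[OF j r] i j by (simp add: moved_blocks_def)
    then show "i \<in> ?f ` (moved_blocks m k z \<times> {0..<m})" using r by (intro image_eqI[of _ _ "(i div m, i mod m)"]) auto
  next
    fix i assume "i \<in> ?f ` (moved_blocks m k z \<times> {0..<m})"
    then obtain j r where jr: "j \<in> moved_blocks m k z" "r < m" "i = j * m + r" by auto
    then have j: "j < k" by (simp add: moved_blocks_def)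
    show "i \<in> {i \<in> {0..<m * k}. z i \<noteq> i}"
      using fixed[OF j jr(2)] jr block_bound[OF j jr(2)] by (simp add: moved_blocks_def)
  qed
  have "inj_on ?f (moved_blocks m k z \<times> {0..<m})"
  proof (rule inj_onI)
    fix p p' assume p: "p \<in> moved_blocks m k z \<times> {0..<m}" "p' \<in> moved_blocks m k z \<times> {0..<m}" "?f p = ?f p'"
    obtain j r j' r' where pp: "p = (j, r)" "p' = (j', r')" by (cases p; cases p')
    then have e: "j * m + r = j' * m + r'" "r < m" "r' < m" using p by auto
    then have "(j * m + r) div m = (j' * m + r') div m" "(j * m + r) mod m = (j' * m + r') mod m" by auto
    then show "p = p'" using e(2,3) pp by simp
  qed
  then show ?thesis unfolding eq by (simp add: card_image card_cartesian_product)
qed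

text \<open>An element of the centralizer is determined by the images of the first points of the blocks.\<close>
lemma sum_moved_blocks_le:
  fixes \<delta> :: real
  assumes m: "1 \<le> m" and \<delta>: "0 \<le> \<delta>"
  shows "(\<Sum>z\<in>rect_centralizer m k. \<delta> ^ card (moved_blocks m k z)) \<le> (1 + real (m * k) * \<delta>) ^ k"
proof -
  let ?F = "\<lambda>z. restrict (\<lambda>j. z (j * m)) {0..<k}"
  let ?g = "\<lambda>j y. if y = j * m then 1 else \<delta>"
  let ?P = "{0..<k} \<rightarrow>\<^sub>E {0..<m * k}"
  have inj: "inj_on ?F (rect_centralizer m k)"
  proof (rule inj_onI)
    fix z z' assume zz: "z \<in> rect_centralizer m k" "z' \<in> rect_centralizer m k" "?F z = ?F z'"
    have "z (j * m) = z' (j * m)" if "j < k" for j using fun_cong[OF zz(3), of j] that by simp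
    then show "z = z'" using centralizer_eqI[OF m zz(1,2)] by blast
  qed
  have sub: "?F ` rect_centralizer m k \<subseteq> ?P"
    using centralizer_lt block_bound[of _ k 0 m] m by fastforce
  have "(\<Sum>z\<in>rect_centralizer m k. \<delta> ^ card (moved_blocks m k z)) 
      = (\<Sum>z\<in>rect_centralizer m k. \<Prod>j\<in>{0..<k}. ?g j (?F z j))"
  proof (intro sum.cong refl)
    fix z
    have "(\<Prod>j\<in>{0..<k}. ?g j (?F z j)) = (\<Prod>j\<in>{0..<k}. if z (j * m) \<noteq> j * m then \<delta> else 1)"
      by (intro prod.cong) auto
    also have "\<dots> = (\<Prod>j\<in>moved_blocks m k z. \<delta>)"
      unfolding moved_blocks_def by (rule prod.inter_filter[symmetric]) simp
    finally show "\<delta> ^ card (moved_blocks m k z) = (\<Prod>j\<in>{0..<k}. ?g j (?F z j))" by simp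
  qed
  also have "\<dots> = (\<Sum>f\<in>?F ` rect_centralizer m k. \<Prod>j\<in>{0..<k}. ?g j (f j))"
    by (subst sum.reindex[OF inj]) (simp add: o_def)
  also have "\<dots> \<le> (\<Sum>f\<in>?P. \<Prod>j\<in>{0..<k}. ?g j (f j))"
    using sub \<delta> by (intro sum_mono2) (auto intro!: finite_PiE prod_nonneg)
  also have "\<dots> = (\<Prod>j\<in>{0..<k}. \<Sum>y\<in>{0..<m * k}. ?g j y)"
    by (rule prod_sum_PiE[symmetric]) auto
  also have "\<dots> \<le> (\<Prod>j\<in>{0..<k}. 1 + real (m * k) * \<delta>)"
  proof (intro prod_mono conjI)
    fix j
    show "0 \<le> (\<Sum>y\<in>{0..<m * k}. ?g j y)" using \<delta> by (intro sum_nonneg) auto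
    have "(\<Sum>y\<in>{0..<m * k}. ?g j y) \<le> (\<Sum>y\<in>{0..<m * k}. (if y = j * m then 1 else 0) + \<delta>)"
      using \<delta> by (intro sum_mono) auto
    also have "\<dots> = (\<Sum>y\<in>{0..<m * k}. if y = j * m then 1 else 0) + real (m * k) * \<delta>"
      by (simp add: sum.distrib)
    also have "\<dots> \<le> 1 + real (m * k) * \<delta>" by simp
    finally show "(\<Sum>y\<in>{0..<m * k}. ?g j y) \<le> 1 + real (m * k) * \<delta>" .
  qed
  finally show ?thesis by simp
qed

section \<open>The multiplicity as an average over the centralizer\<close>

lemma lie_schur_mult_sum:
  assumes m: "1 \<le> m"
  shows "lie_schur_mult m k \<nu> = (\<Sum>z\<in>rect_centralizer m k. rect_lin_char m k z * of_int (irr_char (m * k) \<nu> z))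
     / of_nat (m ^ k * fact k)"
proof -
  have sub: "rect_centralizer m k \<subseteq> perms (m * k)" by (auto simp: rect_centralizer_def)
  show ?thesis
    unfolding lie_schur_mult_def higher_lie_rect_def
    by (subst char_inner_ind_char[OF sub]) (auto simp: irr_char_conj card_rect_centralizer[OF m])
qed

text \<open>The linear character has modulus 1, so each term other than the identity is bounded by
  its character value. The identity moves no block and has weight \<open>\<delta>^0 = 1\<close>,
  which is the 1 subtracted on the right.\<close>

lemma lie_schur_mult_approx:
  assumes m: "1 \<le> m" and \<nu>: "is_partition (m * k) \<nu>" and \<delta>: "0 \<le> \<delta>"
    and bound: "\<And>z. z \<in> rect_centralizer m k \<Longrightarrow> z \<noteq> id \<Longrightarrow>
      \<bar>real_of_int (irr_char (m * k) \<nu> z)\<bar> \<le> \<delta> ^ card (moved_blocks m k z) * real (num_syt \<nu>)"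
  shows "cmod (lie_schur_mult m k \<nu> / complex_of_real (real (num_syt \<nu>) / (real m ^ k * fact k)) - 1)
     \<le> (1 + real (m * k) * \<delta>) ^ k - 1"
proof -
  let ?Z = "rect_centralizer m k" and ?f = "real (num_syt \<nu>)" and ?n = "m * k"
  let ?t = "\<lambda>z. rect_lin_char m k z * of_int (irr_char ?n \<nu> z)"
  have f: "?f > 0" using num_syt_pos[OF \<nu>] by simp
  have id: "id \<in> ?Z" by (simp add: rect_centralizer_def perms_def permutes_id)
  have fin: "finite ?Z" by (rule finite_subset[OF _ finite_perms[of ?n]]) (auto simp: rect_centralizer_def)
  have lin_id: "rect_lin_char m k id = 1" by (simp add: rect_lin_char_def)
  have lin: "cmod (rect_lin_char m k z) = 1" for z by (simp add: rect_lin_char_def)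
  have z0: "complex_of_real (real m ^ k * fact k) \<noteq> 0" using m by simp
  have "lie_schur_mult m k \<nu> / complex_of_real (?f / (real m ^ k * fact k)) = (\<Sum>z\<in>?Z. ?t z) / complex_of_real ?f"
    unfolding lie_schur_mult_sum[OF m] using z0 f by (simp add: field_simps)
  also have "(\<Sum>z\<in>?Z. ?t z) = complex_of_real ?f + (\<Sum>z\<in>?Z - {id}. ?t z)"
    using fin id by (subst sum.remove[of _ id]) (auto simp: lin_id irr_char_id[OF \<nu>])
  also have "(complex_of_real ?f + (\<Sum>z\<in>?Z - {id}. ?t z)) / complex_of_real ?f 
      = 1 + (\<Sum>z\<in>?Z - {id}. ?t z) / complex_of_real ?f"
    using f by (simp add: field_simps)
  finally have "cmod (lie_schur_mult m k \<nu> / complex_of_real (?f / (real m ^ k * fact k)) - 1) 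
      = cmod (\<Sum>z\<in>?Z - {id}. ?t z) / ?f"
    using f by (simp add: norm_divide)
  also have "\<dots> \<le> (\<Sum>z\<in>?Z - {id}. \<delta> ^ card (moved_blocks m k z) * ?f) / ?f"
  proof (intro divide_right_mono sum_norm_le)
    fix z assume "z \<in> ?Z - {id}"
    then show "cmod (?t z) \<le> \<delta> ^ card (moved_blocks m k z) * ?f"
      using bound[of z] lin by (simp add: norm_mult)
  qed (use f in simp)
  also have "\<dots> = (\<Sum>z\<in>?Z - {id}. \<delta> ^ card (moved_blocks m k z))"
    using f by (simp flip: sum_distrib_right)
  also have "\<dots> = (\<Sum>z\<in>?Z. \<delta> ^ card (moved_blocks m k z)) - 1"
    using fin id by (subst (2) sum.remove[of _ id]) (auto simp: moved_blocks_def)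
  also have "\<dots> \<le> (1 + real (m * k) * \<delta>) ^ k - 1" using sum_moved_blocks_le[OF m \<delta>, of k] by simp
  finally show ?thesis .
qed

section \<open>Asymptotics\<close>

text \<open>With \<open>L\<close> of order \<open>log m\<close>, the second inequality compares
  \<open>log^2 m\<close> with \<open>m\<close>. Its constants come from
  \<open>irr_char_centralizer_bound\<close>: \<open>270 = 5 * 54\<close> from the base
  \<open>m^5\<close> and \<open>14 + 40 * A \<le> 54 * A\<close>, and \<open>m div 8\<close> from
  the part of the lower bound that belongs to one moved block.\<close>

lemma eventually_saving_exponent:
  "\<forall>\<^sub>F m in sequentially. \<exists>L\<ge>1. 6 * (6 / 7) ^ L \<le> inverse (real m ^ 4) \<and>
     real m ^ (270 * L) \<le> (6 / 7) ^ L * 2 ^ (m div 8)"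
proof -
  have "\<forall>\<^sub>F m in sequentially. (270 * ln (real m) + 1) * (35 * ln (real m) + 1) \<le> (real m / 8 - 1) * ln 2"
    by real_asymp
  then show ?thesis using eventually_ge_at_top[of 6]
  proof eventually_elim
    case (elim m)
    \<comment> \<open>Since \<open>ln (7/6) \<ge> 1/7\<close>, the factor \<open>35 = 5 * 7\<close>
      gives \<open>(6/7)^L \<le> m^-5\<close>; one power of \<open>m \<ge> 6\<close> absorbs the
      factor 6.\<close>
    define L where "L = nat \<lceil>35 * ln (real m)\<rceil>"
    have m: "6 \<le> real m" "0 < real m" using elim by auto
    have lm: "0 < ln (real m)" using m by simp
    have L: "35 * ln (real m) \<le> real L" "real L \<le> 35 * ln (real m) + 1"
      using lm by (auto simp: L_def)
    then have L1: "1 \<le> L" using lm by linarith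
    have q: "1 / 7 \<le> ln (7 / 6 :: real)" using ln_add_one_self_le_self2[of "-1/7 :: real"] 
      ln_inverse[of "6/7 :: real"] by simp
    have q2: "ln (7 / 6 :: real) \<le> 1" using ln_le_minus_one[of "7/6 :: real"] by simp
    have pow: "(6 / 7 :: real) ^ L = exp (- (real L * ln (7 / 6)))"
    proof -
      have "exp (- ln (7 / 6)) = (6 / 7 :: real)" by (simp add: exp_minus)
      then have "(6 / 7 :: real) ^ L = exp (real L * - ln (7 / 6))" by (simp only: exp_of_nat_mult)
      then show ?thesis by simp
    qed
    have "5 * ln (real m) \<le> real L * (1 / 7)" using L by simp
    also have "\<dots> \<le> real L * ln (7 / 6)" using q by (intro mult_left_mono) auto
    finally have "(6 / 7 :: real) ^ L \<le> exp (- (5 * ln (real m)))" unfolding pow by simp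
    also have "\<dots> = inverse (real m ^ 5)"
      using m by (simp add: exp_minus exp_of_nat_mult[of 5 "ln (real m)", simplified])
    finally have "6 * (6 / 7 :: real) ^ L \<le> real m * inverse (real m ^ 5)"
      using m by (intro mult_mono) auto
    also have "\<dots> = inverse (real m ^ 4)"
      using m power_Suc[of "real m" 4] by (simp add: field_simps)
    finally have 1: "6 * (6 / 7) ^ L \<le> inverse (real m ^ 4)" .
    have "real L * (270 * ln (real m) + ln (7 / 6)) \<le> (35 * ln (real m) + 1) * (270 * ln (real m) + 1)"
      using L q2 lm q by (intro mult_mono) auto
    also have "\<dots> \<le> (real m / 8 - 1) * ln 2" using elim by (simp add: mult.commute)
    also have "\<dots> \<le> real (m div 8) * ln 2" 
    proof (rule mult_right_mono)
      show "real m / 8 - 1 \<le> real (m div 8)" by linarith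
    qed simp
    finally have "exp (real (270 * L) * ln (real m)) \<le> exp (real (m div 8) * ln 2 - real L * ln (7 / 6))"
      by (simp add: algebra_simps)
    also have "\<dots> = exp (- (real L * ln (7 / 6))) * exp (real (m div 8) * ln 2)"
      by (simp flip: exp_add)
    also have "\<dots> = (6 / 7) ^ L * 2 ^ (m div 8)" unfolding pow by (simp add: exp_of_nat_mult)
    finally have 2: "real m ^ (270 * L) \<le> (6 / 7) ^ L * 2 ^ (m div 8)"
      unfolding exp_of_nat_mult exp_ln[OF m(2)] .
    show ?case using 1 2 L1 by blast
  qed
qed

text \<open>Taking \<open>A = J * L\<close>, proportional to the number \<open>J\<close> of moved
  blocks, turns every estimate into the \<open>J\<close>-th power of one for a single block, so one
  \<open>L\<close> depending on \<open>m\<close> alone serves all \<open>J\<close>.\<close>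

lemma irr_char_centralizer_bound:
  assumes m: "6 \<le> m" and k: "k \<le> m" and \<nu>: "is_partition (m * k) \<nu>"
    and b: "first_row \<nu> \<le> m div 2" "length \<nu> \<le> m div 2"
    and L: "1 \<le> L" "6 * (6 / 7) ^ L \<le> inverse (real m ^ 4)" "real m ^ (270 * L) \<le> (6 / 7) ^ L * 2 ^ (m div 8)"
    and z: "z \<in> rect_centralizer m k" "z \<noteq> id"
  shows "\<bar>real_of_int (irr_char (m * k) \<nu> z)\<bar>
     \<le> inverse (real m ^ 4) ^ card (moved_blocks m k z) * real (num_syt \<nu>)"
proof -
  define J where "J = card (moved_blocks m k z)"
  let ?n = "m * k" and ?s = "m * J" and ?b = "m div 2" and ?A = "J * L"
  have m1: "1 \<le> m" using m by simp
  have "moved_blocks m k z \<noteq> {}"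
  proof
    assume "moved_blocks m k z = {}"
    then have "z (j * m) = id (j * m)" if "j < k" for j using that by (auto simp: moved_blocks_def)
    moreover have "id \<in> rect_centralizer m k" by (simp add: rect_centralizer_def perms_def permutes_id)
    ultimately show False using centralizer_eqI[OF m1 z(1)] z(2) by blast
  qed
  then have J1: "1 \<le> J" unfolding J_def by (simp add: Suc_le_eq card_gt_0_iff moved_blocks_def)
  have "J \<le> card {0..<k}" unfolding J_def by (intro card_mono) (auto simp: moved_blocks_def)
  then have Jk: "J \<le> m" using k by simp
  have s: "5 \<le> ?s" using m J1 mult_le_mono[OF m J1] by simp
  have "?s * (?n + ?b) \<le> m ^ 5"
  proof -
    have "?s \<le> m * m" using Jk by simp
    moreover have "?n + ?b \<le> m * m + m * m" using k by (intro add_mono mult_le_mono2) (auto intro: order.trans[of _ m])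
    ultimately have "?s * (?n + ?b) \<le> (m * m) * (m * m + m * m)" by (rule mult_le_mono)
    also have "\<dots> = 2 * (m * m * m * m)" by (simp add: algebra_simps)
    also have "\<dots> \<le> m * (m * m * m * m)" using m by (intro mult_le_mono1) auto
    also have "\<dots> = m ^ 5" by (simp add: numeral_eq_Suc)
    finally show ?thesis .
  qed
  then have "real (?s * (?n + ?b)) \<le> real m ^ 5" by (metis of_nat_le_iff of_nat_power)
  then have "real (?s * (?n + ?b)) ^ (14 + 40 * ?A) \<le> (real m ^ 5) ^ (14 + 40 * ?A)"
    by (intro power_mono) auto
  also have "\<dots> \<le> (real m ^ 5) ^ (54 * ?A)"
    using m J1 L(1) mult_le_mono[OF J1 L(1)] by (intro power_increasing) (auto intro: one_le_power)
  also have "\<dots> = (real m ^ (270 * L)) ^ J" by (simp flip: power_mult add: algebra_simps)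
  also have "\<dots> \<le> ((6 / 7) ^ L * 2 ^ (m div 8)) ^ J" using L(3) by (intro power_mono) auto
  also have "\<dots> = (6 / 7) ^ ?A * 2 ^ (m div 8 * J)" by (simp add: power_mult_distrib mult.commute flip: power_mult)
  also have "\<dots> \<le> (6 / 7) ^ ?A * 2 ^ ((?s - ?b) div 2)"
  proof (intro mult_left_mono power_increasing)
    \<comment> \<open>Since \<open>m div 2 \<le> y\<close> and \<open>2 * y \<le> m * J\<close>,
      subtracting the box side leaves at least \<open>y \<ge> 4 * x\<close>, more than the required
      \<open>2 * x\<close>.\<close>
    define x y where "x = m div 8 * J" and "y = m div 2 * J"
    have "4 * (m div 8) * J \<le> m div 2 * J" by (intro mult_le_mono1) linarith
    then have "4 * x \<le> y" by (simp only: x_def y_def mult.assoc)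
    moreover have "m div 2 * 1 \<le> y" unfolding y_def using J1 by (rule mult_le_mono2)
    moreover have "2 * (m div 2) * J \<le> m * J" by (intro mult_le_mono1) linarith
    then have "2 * y \<le> m * J" by (simp only: y_def mult.assoc)
    ultimately have "2 * x \<le> ?s - ?b" by linarith
    then have "2 * (m div 8 * J) \<le> ?s - ?b" by (simp only: x_def)
    then show "m div 8 * J \<le> (?s - ?b) div 2" by linarith
  qed auto
  finally have A: "real (?s * (?n + ?b)) ^ (14 + 40 * ?A) \<le> (6 / 7) ^ ?A * 2 ^ ((?s - ?b) div 2)" .
  have "z \<in> perms ?n" using z(1) by (simp add: rect_centralizer_def)
  then have "\<bar>real_of_int (irr_char ?n \<nu> z)\<bar> \<le> 6 * (6 / 7) ^ ?A * real (num_syt \<nu>)"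
    using card_support_centralizer[OF m1 z(1)] by (intro irr_char_abs_le[OF \<nu> b _ _ s A]) (simp_all add: J_def)
  also have "\<dots> \<le> inverse (real m ^ 4) ^ J * real (num_syt \<nu>)"
  proof (intro mult_right_mono)
    have "6 * (6 / 7 :: real) ^ ?A \<le> 6 ^ J * ((6 / 7) ^ L) ^ J"
      unfolding mult.commute[of J L] power_mult using self_le_power[of "6::real" J] J1 by (intro mult_right_mono) auto
    also have "\<dots> = (6 * (6 / 7) ^ L) ^ J" by (simp add: power_mult_distrib)
    also have "\<dots> \<le> inverse (real m ^ 4) ^ J" using L(2) by (intro power_mono) auto
    finally show "6 * (6 / 7) ^ ?A \<le> inverse (real m ^ 4) ^ J" .
  qed auto
  finally show ?thesis unfolding J_def .
qed

text \<open>Squaring the balance condition gives \<open>r^2 \<le> a^2 * m * k\<close>, which is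
  \<open>o(m^2)\<close>.\<close>

lemma eventually_rows_le_half:
  fixes k :: "nat \<Rightarrow> nat" and r :: "nat \<Rightarrow> nat"
  assumes k: "(\<lambda>m. real (k m)) \<in> o(\<lambda>m. real m)"
    and r: "\<forall>m\<ge>1. real (r m) \<le> a * sqrt (real (m * k m))"
  shows "\<forall>\<^sub>F m in sequentially. r m \<le> m div 2"
proof -
  \<comment> \<open>Chosen so that \<open>a^2 * c \<le> 1/4\<close>; the summand 1 keeps the
    denominator positive when \<open>a = 0\<close>.\<close>
  define c where "c = 1 / (4 * (a\<^sup>2 + 1))"
  have c: "c > 0" by (simp add: c_def add_nonneg_pos)
  have "\<forall>\<^sub>F m in sequentially. norm (real (k m)) \<le> c * norm (real m)" by (rule landau_o.smallD[OF k c])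
  then show ?thesis using eventually_ge_at_top[of 1]
  proof eventually_elim
    case (elim m)
    have "real (r m) \<le> \<bar>a * sqrt (real (m * k m))\<bar>" using r elim by (meson abs_ge_self order.trans)
    then have "(real (r m))\<^sup>2 \<le> \<bar>a * sqrt (real (m * k m))\<bar>\<^sup>2" by (intro power_mono) auto
    also have "\<dots> = a\<^sup>2 * (real m * real (k m))" by (simp add: power_mult_distrib)
    also have "\<dots> \<le> a\<^sup>2 * (real m * (c * real m))" using elim by (intro mult_left_mono) auto
    also have "\<dots> = (a\<^sup>2 * c) * (real m)\<^sup>2" by (simp add: power2_eq_square)
    also have "\<dots> \<le> 1 / 4 * (real m)\<^sup>2"
    proof (intro mult_right_mono)
      have "a\<^sup>2 * c = a\<^sup>2 / (a\<^sup>2 + 1) / 4" by (simp add: c_def)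
      also have "a\<^sup>2 / (a\<^sup>2 + 1) \<le> 1" by (simp add: divide_le_eq_1 add_nonneg_pos)
      finally show "a\<^sup>2 * c \<le> 1 / 4" by simp
    qed auto
    also have "\<dots> = (real m / 2)\<^sup>2" by (simp add: power_divide)
    finally have "real (r m) \<le> real m / 2" by (rule power2_le_imp_le) simp
    then show ?case by linarith
  qed
qed

theorem theorem4p1:
  fixes k :: "nat \<Rightarrow> nat" and \<nu> :: "nat \<Rightarrow> nat list"
  assumes k_pos: "\<forall>m\<ge>1. k m \<ge> 1"
    and k_small: "(\<lambda>m. real (k m)) \<in> o(\<lambda>m. real m)"
    and part: "\<forall>m\<ge>1. is_partition (m * k m) (\<nu> m)"
    and balanced: "\<exists>a::real. \<forall>m\<ge>1.
          real (first_row (\<nu> m)) \<le> a * sqrt (real (m * k m)) \<and>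
          real (length (\<nu> m)) \<le> a * sqrt (real (m * k m))"
  shows "(\<lambda>m. lie_schur_mult m (k m) (\<nu> m)) \<sim>[sequentially]
         (\<lambda>m. complex_of_real (real (num_syt (\<nu> m)) / (real m ^ k m * fact (k m))))"
proof (rule asymp_equivI')
  let ?q = "\<lambda>m. lie_schur_mult m (k m) (\<nu> m) / complex_of_real (real (num_syt (\<nu> m)) / (real m ^ k m * fact (k m)))"
  obtain a where a: "\<forall>m\<ge>1. real (first_row (\<nu> m)) \<le> a * sqrt (real (m * k m))"
     "\<forall>m\<ge>1. real (length (\<nu> m)) \<le> a * sqrt (real (m * k m))"
    using balanced by blast
  have "\<forall>\<^sub>F m in sequentially. norm (real (k m)) \<le> 1 * norm (real m)"
    by (rule landau_o.smallD[OF k_small]) simp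
  then have ev: "\<forall>\<^sub>F m in sequentially. norm (?q m - 1) \<le> (1 + 1 / real m ^ 2) ^ m - 1"
    using eventually_rows_le_half[OF k_small a(1)] eventually_rows_le_half[OF k_small a(2)]
      eventually_saving_exponent eventually_ge_at_top[of 6]
  proof eventually_elim
    case (elim m)
    obtain L where L: "1 \<le> L" "6 * (6 / 7) ^ L \<le> inverse (real m ^ 4)" "real m ^ (270 * L) \<le> (6 / 7) ^ L * 2 ^ (m div 8)"
      using elim(4) by blast
    have km: "k m \<le> m" using elim by simp
    have \<nu>: "is_partition (m * k m) (\<nu> m)" using part elim by simp
    have "norm (?q m - 1) \<le> (1 + real (m * k m) * inverse (real m ^ 4)) ^ k m - 1"
      using elim km by (intro lie_schur_mult_approx \<nu> irr_char_centralizer_bound[OF _ km \<nu> _ _ L]) auto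
    moreover have "(1 + real (m * k m) * inverse (real m ^ 4)) ^ k m \<le> (1 + 1 / real m ^ 2) ^ m"
    proof -
      have "real (m * k m) * inverse (real m ^ 4) \<le> real (m * m) * inverse (real m ^ 4)"
        using km by (intro mult_right_mono of_nat_mono mult_le_mono2) simp_all
      also have "real (m * m) * inverse (real m ^ 4) = 1 / real m ^ 2"
        using elim(5) by (simp add: divide_simps power2_eq_square power4_eq_xxxx)
      finally have "(1 + real (m * k m) * inverse (real m ^ 4)) ^ k m \<le> (1 + 1 / real m ^ 2) ^ k m"
        by (intro power_mono) auto
      also have "\<dots> \<le> (1 + 1 / real m ^ 2) ^ m" using km by (intro power_increasing) auto
      finally show ?thesis .
    qed
    ultimately show ?case by linarith
  qed
  have lim: "(\<lambda>m. (1 + 1 / real m ^ 2) ^ m - 1) \<longlonglongrightarrow> 0" by real_asymp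
  have "(\<lambda>m. norm (?q m - 1)) \<longlonglongrightarrow> 0"
    by (rule tendsto_sandwich[OF _ ev tendsto_const lim]) simp
  then have "(\<lambda>m. ?q m - 1) \<longlonglongrightarrow> 0" by (rule tendsto_norm_zero_cancel)
  then show "?q \<longlonglongrightarrow> 1" using LIM_zero_iff by blast
qed

end
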